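(* Let $(X,d)$ be a compact metric space, $T:X\to X$ a continuous map, and $m$ a Borel probability measure on $X$ such that $(T,m)$ satisfies the non-uniform specification property, with shadowing holding on the set $K$ of full $m$-measure. Let $\varphi\in C(X)$ satisfy $\inf_{\mu\in M(K,T)}\int\varphi\, d\mu<\sup_{\mu\in M(K,T)}\int\varphi\, d\mu$, and let $\psi\in C(X)$. Put $$\mathbf{C}:=\sup\Big\{h_\mu+\int\psi\, d\mu:\mu\in M(K,T)\Big\}.$$ Assume further that $P(X,\psi)$ is finite and that for all $\gamma>0$ there exist ergodic measures $\mu_1,\mu_2\in M(K,T)$ satisfying 1. $h_{\mu_i}+\int\psi\, d\mu_i>\mathbf{C}-\gamma$ for $i=1,2$; 2. $\int\varphi\, d\mu_1\neq\int\varphi\, d\mu_2$. Let $\widehat{X}(\varphi,T)=\{x\in X:\lim_{n\to\infty}\frac1n\sum_{i=0}^{n-1}\varphi(T^ix)\text{ does not exist}\}$. Then $$P(\widehat{X}(\varphi,T),\psi)\ge\mathbf{C}.$$ Moreover, if there exists $\mu\in M(K,T)$ which is an equilibrium state for $T$ with respect to the potential $\psi$, then $P(\widehat{X}(\varphi,T),\psi)=P(X,\psi)$.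
   Context: Notation: $C(X)$ is the space of continuous real functions on $X$; $d_n(x,y)=\max_{0\le i\le n-1}d(T^ix,T^iy)$; $B_n(x,\epsilon)=\{y\in X:d_n(x,y)<\epsilon\}$; $S_n\psi(x)=\sum_{i=0}^{n-1}\psi(T^ix)$; $h_\mu$ is the measure-theoretic entropy of $T$ with respect to the $T$-invariant measure $\mu$. Non-uniform specification property (with time lag $p(x,n,\epsilon)$): there exists $\eta>0$ such that for $m$-almost every $x$, every $n\ge1$ and every $0<\epsilon<\eta$ there is an integer $p(x,n,\epsilon)\ge 1$ with $\lim_{\epsilon\to0}\limsup_{n\to\infty}\frac1n p(x,n,\epsilon)=0$, and so that the following holds: given points $x_1,\dots,x_k$ in a full $m$-measure set and positive integers $n_1,\dots,n_k$, if $p_i\ge p(x_i,n_i,\epsilon)$ for each $i$, then there exists $z\in X$ with $z\in B_{n_1}(x_1,\epsilon)$ and $T^{n_1+p_1+\cdots+n_{i-1}+p_{i-1}}(z)\in B_{n_i}(x_i,\epsilon)$ for every $2\le i\le k$. Throughout, $K$ denotes the full $m$-measure set on which this shadowing property holds with time lag $p(x,n,\epsilon)$. The conventions are that $K$ is $T$-invariant and that for $x\in K$ and $0<\epsilon_1<\epsilon_2$ one has $p(x,n,\epsilon_1)\ge p(x,n,\epsilon_2)$; hence $\limsup_{n\to\infty}p(x,n,\epsilon)/n=0$ for all $x\in K$ and all $\epsilon$. $M(K,T)$ is the set of $T$-invariant Borel probability measures $\mu$ on $X$ with $\mu(K)=1$. Topological pressure of a (not necessarily compact or invariant) Borel set $Z\subset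 X$ with respect to $\psi\in C(X)$: let $\Gamma_n(Z,\epsilon)$ be the collection of all finite or countable covers of $Z$ by sets $B_m(x,\epsilon)$ with $m\ge n$. Put $$M(Z,t,\psi,n,\epsilon)=\inf_{\mathcal C\in\Gamma_n(Z,\epsilon)}\sum_{B_m(x,\epsilon)\in\mathcal C}\exp\Big(-tm+\sup_{y\in B_m(x,\epsilon)}S_m\psi(y)\Big),\quad M(Z,t,\psi,\epsilon)=\lim_{n\to\infty}M(Z,t,\psi,n,\epsilon),$$ $P(Z,\psi,\epsilon)=\inf\{t:M(Z,t,\psi,\epsilon)=0\}=\sup\{t:M(Z,t,\psi,\epsilon)=\infty\}$ and $P(Z,\psi)=\lim_{\epsilon\to0}P(Z,\psi,\epsilon)$. An equilibrium state for $T$ with respect to $\psi$ is a $T$-invariant Borel probability measure $\mu$ with $h_\mu+\int\psi\,d\mu=P(X,\psi)$. *)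

theory Defs
  imports "HOL-Probability.Probability"
begin

text \<open>The compact metric space is a whole type of class \<^class>\<open>metric_space\<close> whose universe is
  compact; Borel measures on it are measures with the \<sigma>-algebra of \<^const>\<open>borel\<close>.\<close>

section \<open>Orbits\<close>

definition bowen_dist :: "('a::metric_space \<Rightarrow> 'a) \<Rightarrow> nat \<Rightarrow> 'a \<Rightarrow> 'a \<Rightarrow> real" where
  \<comment> \<open>meaningful for \<open>n \<ge> 1\<close> only\<close>
  "bowen_dist T n x y = (MAX i\<in>{..<n}. dist ((T ^^ i) x) ((T ^^ i) y))"

definition bowen_ball :: "('a::metric_space \<Rightarrow> 'a) \<Rightarrow> nat \<Rightarrow> 'a \<Rightarrow> real \<Rightarrow> 'a set" where
  "bowen_ball T n x \<epsilon> = {y. bowen_dist T n x y < \<epsilon>}"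

definition birkhoff_sum :: "('a \<Rightarrow> 'a) \<Rightarrow> nat \<Rightarrow> ('a \<Rightarrow> real) \<Rightarrow> 'a \<Rightarrow> real" where
  "birkhoff_sum T n \<psi> x = (\<Sum>i<n. \<psi> ((T ^^ i) x))"

definition irregular_set :: "('a \<Rightarrow> real) \<Rightarrow> ('a \<Rightarrow> 'a) \<Rightarrow> 'a set" where
  "irregular_set \<phi> T = {x. \<not> convergent (\<lambda>n. birkhoff_sum T n \<phi> x / real n)}"

section \<open>Invariant measures and measure-theoretic entropy\<close>

definition invariant_prob :: "('a::topological_space \<Rightarrow> 'a) \<Rightarrow> 'a measure \<Rightarrow> bool" where
  "invariant_prob T \<mu> \<longleftrightarrow> prob_space \<mu> \<and> sets \<mu> = sets borel \<and> distr \<mu> borel T = \<mu>"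

definition invariant_probs_on :: "'a set \<Rightarrow> ('a::topological_space \<Rightarrow> 'a) \<Rightarrow> 'a measure set" where
  "invariant_probs_on K T = {\<mu>. invariant_prob T \<mu> \<and> measure \<mu> K = 1}"

definition ergodic :: "('a::topological_space \<Rightarrow> 'a) \<Rightarrow> 'a measure \<Rightarrow> bool" where
  "ergodic T \<mu> \<longleftrightarrow> invariant_prob T \<mu> \<and>
     (\<forall>A\<in>sets \<mu>. T -` A = A \<longrightarrow> measure \<mu> A = 0 \<or> measure \<mu> A = 1)"

definition partition_entropy :: "'a measure \<Rightarrow> 'a set set \<Rightarrow> real" where
  \<comment> \<open>\<open>ln 0 = 0\<close> supplies the convention \<open>0 log 0 = 0\<close>\<close>
  "partition_entropy \<mu> \<xi> = - (\<Sum>A\<in>\<xi>. measure \<mu> A * ln (measure \<mu> A))"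

definition iterated_join :: "('a \<Rightarrow> 'a) \<Rightarrow> nat \<Rightarrow> 'a set set \<Rightarrow> 'a set set" where
  \<comment> \<open>the empty set may occur as a cell; it contributes nothing to the entropy\<close>
  "iterated_join T n \<xi> = {(\<Inter>i<n. (T ^^ i) -` A i) | A. \<forall>i<n. A i \<in> \<xi>}"

definition entropy_wrt_partition :: "('a \<Rightarrow> 'a) \<Rightarrow> 'a measure \<Rightarrow> 'a set set \<Rightarrow> real" where
  "entropy_wrt_partition T \<mu> \<xi> = lim (\<lambda>n. partition_entropy \<mu> (iterated_join T n \<xi>) / real n)"

definition measure_entropy :: "('a \<Rightarrow> 'a) \<Rightarrow> 'a measure \<Rightarrow> ereal" where
  "measure_entropy T \<mu> =
     (SUP \<xi>\<in>{\<xi>. finite \<xi> \<and> \<xi> \<subseteq> sets \<mu> \<and> partition_on (space \<mu>) \<xi>}. ereal (entropy_wrt_partition T \<mu> \<xi>))"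

section \<open>Topological pressure of subsets\<close>

text \<open>A cover by Bowen balls is recorded by its set of centres and lengths \<open>(x, k)\<close>, because the
  set \<open>bowen_ball T k x \<epsilon>\<close> need not determine \<open>k\<close>.\<close>

definition bowen_covers ::
  "('a::metric_space \<Rightarrow> 'a) \<Rightarrow> nat \<Rightarrow> 'a set \<Rightarrow> real \<Rightarrow> ('a \<times> nat) set set" where
  "bowen_covers T n Z \<epsilon> =
     {C. countable C \<and> (\<forall>(x, k)\<in>C. n \<le> k) \<and> Z \<subseteq> (\<Union>(x, k)\<in>C. bowen_ball T k x \<epsilon>)}"

definition pressure_pre ::
  "('a::metric_space \<Rightarrow> 'a) \<Rightarrow> 'a set \<Rightarrow> real \<Rightarrow> ('a \<Rightarrow> real) \<Rightarrow> nat \<Rightarrow> real \<Rightarrow> ennreal" where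
  "pressure_pre T Z t \<psi> n \<epsilon> =
     (INF C\<in>bowen_covers T n Z \<epsilon>.
        \<Sum>\<^sub>\<infinity>(x, k)\<in>C. ennreal (exp (- t * real k + (SUP y\<in>bowen_ball T k x \<epsilon>. birkhoff_sum T k \<psi> y))))"

definition pressure_outer ::
  "('a::metric_space \<Rightarrow> 'a) \<Rightarrow> 'a set \<Rightarrow> real \<Rightarrow> ('a \<Rightarrow> real) \<Rightarrow> real \<Rightarrow> ennreal" where
  "pressure_outer T Z t \<psi> \<epsilon> = lim (\<lambda>n. pressure_pre T Z t \<psi> n \<epsilon>)"

definition pressure_at ::
  "('a::metric_space \<Rightarrow> 'a) \<Rightarrow> 'a set \<Rightarrow> ('a \<Rightarrow> real) \<Rightarrow> real \<Rightarrow> ereal" where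
  "pressure_at T Z \<psi> \<epsilon> = Inf (ereal ` {t. pressure_outer T Z t \<psi> \<epsilon> = 0})"

definition pressure :: "('a::metric_space \<Rightarrow> 'a) \<Rightarrow> 'a set \<Rightarrow> ('a \<Rightarrow> real) \<Rightarrow> ereal" where
  "pressure T Z \<psi> = Lim (at_right 0) (\<lambda>\<epsilon>. pressure_at T Z \<psi> \<epsilon>)"

definition equilibrium_state :: "('a::metric_space \<Rightarrow> 'a) \<Rightarrow> ('a \<Rightarrow> real) \<Rightarrow> 'a measure \<Rightarrow> bool" where
  "equilibrium_state T \<psi> \<mu> \<longleftrightarrow> invariant_prob T \<mu> \<and>
     measure_entropy T \<mu> + ereal (\<integral>x. \<psi> x \<partial>\<mu>) = pressure T UNIV \<psi>"

section \<open>Non-uniform specification\<close>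

text \<open>The \<open>k\<close> orbit segments are numbered from \<open>0\<close>, so that the shift leading to segment \<open>i\<close> is the
  sum of \<open>n j + q j\<close> over \<open>j < i\<close>.\<close>

definition shadowing_on ::
  "('a::metric_space \<Rightarrow> 'a) \<Rightarrow> 'a set \<Rightarrow> real \<Rightarrow> ('a \<Rightarrow> nat \<Rightarrow> real \<Rightarrow> nat) \<Rightarrow> bool" where
  "shadowing_on T K \<eta> p \<longleftrightarrow>
     (\<forall>\<epsilon> k. \<forall>x :: nat \<Rightarrow> 'a. \<forall>n q :: nat \<Rightarrow> nat.
        0 < \<epsilon> \<longrightarrow> \<epsilon> < \<eta> \<longrightarrow>
        (\<forall>i<k. x i \<in> K \<and> 1 \<le> n i \<and> p (x i) (n i) \<epsilon> \<le> q i) \<longrightarrow>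
        (\<exists>z. \<forall>i<k. (T ^^ (\<Sum>j<i. n j + q j)) z \<in> bowen_ball T (n i) (x i) \<epsilon>))"

definition nonuniform_specification ::
  "('a::metric_space \<Rightarrow> 'a) \<Rightarrow> 'a measure \<Rightarrow> 'a set \<Rightarrow> real \<Rightarrow> ('a \<Rightarrow> nat \<Rightarrow> real \<Rightarrow> nat) \<Rightarrow> bool" where
  "nonuniform_specification T m K \<eta> p \<longleftrightarrow>
     0 < \<eta> \<and>
     K \<in> sets borel \<and> measure m K = 1 \<and>
     (\<forall>x\<in>K. \<forall>n\<ge>1. \<forall>\<epsilon>. 0 < \<epsilon> \<and> \<epsilon> < \<eta> \<longrightarrow> 1 \<le> p x n \<epsilon>) \<and>
     (\<forall>x\<in>K. ((\<lambda>\<epsilon>. limsup (\<lambda>n. ereal (real (p x n \<epsilon>) / real n))) \<longlongrightarrow> 0) (at_right 0)) \<and>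
     shadowing_on T K \<eta> p"

end

theory Submission
  imports Defs
begin

text \<open>
  The irregular set contains a set of points whose orbits can be prescribed almost freely along
  blocks, and the number of prescriptions already produces the pressure \<open>CC\<close>. Fix \<open>\<gamma> > 0\<close> and the two
  ergodic measures \<open>\<mu>\<^sub>1\<close>, \<open>\<mu>\<^sub>2\<close> that belong to it. For one large length \<open>n\<close> each \<open>\<mu>\<^sub>i\<close> supplies a finite set
  \<open>S\<^sub>i \<subseteq> K\<close> of points that are separated along \<open>n\<close> steps, number at least
  \<open>exp (n (h\<^sub>i - \<delta>))\<close>, have \<open>\<phi>\<close>- and \<open>\<psi>\<close>-averages \<open>\<delta>\<close>-close to the integrals, and have specification gaps
  at most \<open>\<delta> n\<close> (\<open>typical_separated_points\<close>). All gaps may then be given the same length \<open>q \<le> \<delta> n\<close>, so that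
  the \<open>i\<close>-th block starts at time \<open>i L\<close> with \<open>L = n + q\<close>, whatever was prescribed before.

  Choose which of the two sets the \<open>i\<close>-th block is taken from by a fixed sequence whose
  frequencies oscillate (\<open>ex_oscillating_sequence\<close>). Every point that shadows such blocks within a fixed
  \<open>\<epsilon>\<close> has oscillating \<open>\<phi>\<close>-averages: the errors caused by \<open>\<epsilon>\<close>, \<open>\<delta>\<close> and the gaps are small against
  the distance of the two integrals of \<open>\<phi>\<close> (\<open>irregular_setI\<close>).

  The pressure of the set of these points is bounded below by counting
  (\<open>pressure_outer_shadow_set_pos\<close>). A cover by Bowen balls already has a finite subfamily which, by
  compactness, covers all points that shadow the first \<open>k\<close> blocks for some \<open>k\<close>. A ball of
  length \<open>m\<close> contains shadowing points for at most one initial word of \<open>m div L\<close> blocks, hence for at most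
  the fraction \<open>exp (- \<Sum> ln |S\<^sub>i|)\<close> of all words, and the Birkhoff sum of \<open>\<psi>\<close> on the ball makes its weight at
  least a constant times this fraction. Adding up over the subfamily bounds the covering sums away from
  zero.

  The cardinality of \<open>S\<^sub>i\<close> comes from entropy estimates for sets of almost full outer measure. The points
  that satisfy the requirements on averages and gaps form such a set: for the averages this is the ergodic
  theorem, which follows from the maximal inequality, and for the gaps it is continuity of outer measure, the
  gap function being an arbitrary function of the point. So the cells of the iterated partition that meet these points
  carry nearly full measure, which forces their number to be at least
  \<open>exp (n (h\<^sub>i - \<delta>))\<close> (\<open>entropy_le_log_card\<close>). Points in a common Bowen ball mostly
  visit the same cells, by approximating the cells with disjoint closed sets, so a small number of balls
  can only meet a small number of cells (\<open>many_separated_points\<close>).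

  The second claim is formal: an equilibrium state on \<open>K\<close> gives \<open>P(X, \<psi>) \<le> CC\<close>, and pressure is monotone in
  the set.
\<close>

section \<open>Birkhoff sums\<close>

lemma birkhoff_sum_0 [simp]: "birkhoff_sum T 0 f x = 0"
  by (simp add: birkhoff_sum_def)

lemma birkhoff_sum_Suc: "birkhoff_sum T (Suc n) f x = f x + birkhoff_sum T n f (T x)"
  unfolding birkhoff_sum_def by (subst sum.lessThan_Suc_shift) (simp add: funpow_swap1)

lemma birkhoff_sum_add:
  "birkhoff_sum T (a + b) f x = birkhoff_sum T a f x + birkhoff_sum T b f ((T ^^ a) x)"
  by (induction a arbitrary: x) (simp_all add: birkhoff_sum_Suc funpow_swap1)

lemma birkhoff_sum_mult:
  "birkhoff_sum T (k * L) f x = (\<Sum>i<k. birkhoff_sum T L f ((T ^^ (i * L)) x))"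
proof (induction k)
  case (Suc k)
  have "birkhoff_sum T (Suc k * L) f x = birkhoff_sum T (k * L + L) f x" by (simp add: add.commute)
  then show ?case by (simp add: birkhoff_sum_add Suc)
qed simp

lemma birkhoff_sum_abs_le:
  assumes "\<And>x. \<bar>f x\<bar> \<le> B"
  shows "\<bar>birkhoff_sum T n f x\<bar> \<le> real n * B"
proof -
  have "\<bar>birkhoff_sum T n f x\<bar> \<le> (\<Sum>i<n. \<bar>f ((T ^^ i) x)\<bar>)"
    unfolding birkhoff_sum_def by (rule sum_abs)
  also have "\<dots> \<le> (\<Sum>i<n. B)" by (rule sum_mono) (rule assms)
  finally show ?thesis by simp
qed

lemma birkhoff_sum_diff_le:
  assumes "\<And>i. i < n \<Longrightarrow> \<bar>f ((T ^^ i) x) - f ((T ^^ i) y)\<bar> \<le> v"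
  shows "\<bar>birkhoff_sum T n f x - birkhoff_sum T n f y\<bar> \<le> real n * v"
proof -
  have "\<bar>birkhoff_sum T n f x - birkhoff_sum T n f y\<bar> = \<bar>\<Sum>i<n. f ((T ^^ i) x) - f ((T ^^ i) y)\<bar>"
    by (simp add: birkhoff_sum_def sum_subtractf)
  also have "\<dots> \<le> (\<Sum>i<n. \<bar>f ((T ^^ i) x) - f ((T ^^ i) y)\<bar>)" by (rule sum_abs)
  also have "\<dots> \<le> (\<Sum>i<n. v)" by (rule sum_mono) (use assms in auto)
  finally show ?thesis by simp
qed

lemma continuous_on_funpow:
  fixes T :: "'a::topological_space \<Rightarrow> 'a"
  assumes "continuous_on UNIV T"
  shows "continuous_on UNIV (T ^^ n)"
proof (induction n)
  case (Suc n)
  then show ?case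
    using continuous_on_compose2[OF assms Suc] by (simp add: o_def)
qed (simp add: id_def)

section \<open>Ergodic averages\<close>

lemma invariant_prob_space: "invariant_prob T \<mu> \<Longrightarrow> space \<mu> = UNIV"
  unfolding invariant_prob_def using sets_eq_imp_space_eq[of \<mu> borel] by simp

lemma invariant_prob_measurable_funpow [measurable]:
  assumes "invariant_prob T \<mu>" "continuous_on UNIV T"
  shows "T ^^ n \<in> measurable \<mu> \<mu>"
proof -
  have "T ^^ n \<in> measurable borel borel"
    by (rule borel_measurable_continuous_onI) (rule continuous_on_funpow[OF assms(2)])
  then show ?thesis
    using assms(1) measurable_cong_sets unfolding invariant_prob_def by blast
qed

lemma invariant_prob_measurable:
  assumes "invariant_prob T \<mu>" "continuous_on UNIV T"
  shows "T \<in> measurable \<mu> \<mu>"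
  using invariant_prob_measurable_funpow[OF assms, of 1] by simp

lemma distr_funpow:
  assumes inv: "invariant_prob T \<mu>" and T: "continuous_on UNIV T"
  shows "distr \<mu> \<mu> (T ^^ n) = \<mu>"
proof (induction n)
  case 0
  then show ?case by (simp add: id_def distr_id)
next
  case (Suc n)
  have "distr \<mu> \<mu> T = \<mu>"
    using inv distr_cong[of \<mu> \<mu> \<mu> borel T T] unfolding invariant_prob_def by simp
  then have "distr \<mu> \<mu> (T \<circ> T ^^ n) = \<mu>"
    using distr_distr[OF invariant_prob_measurable[OF inv T] invariant_prob_measurable_funpow[OF inv T]]
      Suc by metis
  then show ?case by (simp only: funpow.simps)
qed

lemma measure_funpow_vimage:
  assumes inv: "invariant_prob T \<mu>" and T: "continuous_on UNIV T" and A: "A \<in> sets \<mu>"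
  shows "measure \<mu> ((T ^^ n) -` A) = measure \<mu> A"
  using measure_distr[OF invariant_prob_measurable_funpow[OF inv T] A, of n]
  by (simp add: distr_funpow[OF inv T] invariant_prob_space[OF inv])

lemma integral_funpow:
  fixes f :: "'a::topological_space \<Rightarrow> real"
  assumes inv: "invariant_prob T \<mu>" and T: "continuous_on UNIV T" and f: "f \<in> borel_measurable \<mu>"
  shows "(\<integral>x. f ((T ^^ n) x) \<partial>\<mu>) = (\<integral>x. f x \<partial>\<mu>)"
  using integral_distr[OF invariant_prob_measurable_funpow[OF inv T] f, of n]
  by (simp add: distr_funpow[OF inv T])

lemma birkhoff_sum_measurable:
  assumes inv: "invariant_prob T \<mu>" and T: "continuous_on UNIV T"
    and [measurable]: "f \<in> borel_measurable \<mu>"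
  shows "birkhoff_sum T n f \<in> borel_measurable \<mu>"
proof -
  have [measurable]: "T ^^ i \<in> measurable \<mu> \<mu>" for i
    by (rule invariant_prob_measurable_funpow[OF inv T])
  have "(\<lambda>x. \<Sum>i<n. f ((T ^^ i) x)) \<in> borel_measurable \<mu>" by measurable
  then show ?thesis by (simp add: birkhoff_sum_def[abs_def])
qed

text \<open>This is \<open>max (S\<^sub>0 f, \<dots>, S\<^sub>N f)\<close> for the Birkhoff sums \<open>S\<^sub>n f\<close>. The recursion, rather than
  a maximum over a set, is the form in which the maximal inequality uses it.\<close>

fun running_max :: "('a \<Rightarrow> 'a) \<Rightarrow> ('a \<Rightarrow> real) \<Rightarrow> nat \<Rightarrow> 'a \<Rightarrow> real" where
  "running_max T f 0 x = 0"
| "running_max T f (Suc N) x = max 0 (f x + running_max T f N (T x))"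

lemma running_max_nonneg: "0 \<le> running_max T f N x"
  by (cases N) auto

lemma running_max_Suc_ge: "running_max T f N x \<le> running_max T f (Suc N) x"
proof (induction N arbitrary: x)
  case (Suc N)
  have "running_max T f N (T x) \<le> running_max T f (Suc N) (T x)" by (rule Suc)
  then show ?case
    unfolding running_max.simps(2)[of T f "Suc N"] running_max.simps(2)[of T f N x] by linarith
qed (simp add: running_max_nonneg)

lemma running_max_ge_birkhoff_sum:
  "n \<le> N \<Longrightarrow> birkhoff_sum T n f x \<le> running_max T f N x"
proof (induction N arbitrary: n x)
  case (Suc N)
  show ?case
  proof (cases n)
    case (Suc k)
    then show ?thesis using Suc.IH[of k "T x"] Suc.prems by (auto simp: birkhoff_sum_Suc)
  qed (simp add: running_max_nonneg)
qed simp

lemma running_max_le: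
  assumes "\<And>x. \<bar>f x\<bar> \<le> B"
  shows "running_max T f N x \<le> real N * B"
proof (induction N arbitrary: x)
  case (Suc N)
  have "0 \<le> B" using assms[of x] by linarith
  then show ?case using Suc[of "T x"] assms[of x] by (auto simp: algebra_simps)
qed simp

lemma running_max_measurable:
  assumes [measurable]: "T \<in> measurable \<mu> \<mu>" "f \<in> borel_measurable \<mu>"
  shows "running_max T f N \<in> borel_measurable \<mu>"
proof (induction N)
  case (Suc N)
  note [measurable] = Suc
  have "(\<lambda>x. max 0 (f x + running_max T f N (T x))) \<in> borel_measurable \<mu>" by measurable
  then show ?case by (simp cong: measurable_cong)
qed (simp cong: measurable_cong)

text \<open>Garsia's argument: where the running maximum \<open>M\<close> is positive it equals \<open>f\<close> plus the previous
  maximum at \<open>T x\<close>, so \<open>M - M \<circ> T \<le> f\<close> there; elsewhere \<open>M - M \<circ> T \<le> 0\<close>. The integral of \<open>M - M \<circ> T\<close>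
  vanishes by invariance.\<close>

lemma maximal_ergodic:
  fixes f :: "'a::topological_space \<Rightarrow> real"
  assumes inv: "invariant_prob T \<mu>" and T: "continuous_on UNIV T"
    and f: "f \<in> borel_measurable \<mu>" and B: "\<And>x. \<bar>f x\<bar> \<le> B"
  shows "0 \<le> (\<integral>x. f x * indicator {x. 0 < running_max T f (Suc N) x} x \<partial>\<mu>)"
proof -
  interpret prob_space \<mu> using inv by (simp add: invariant_prob_def)
  let ?M = "running_max T f (Suc N)"
  have Tm [measurable]: "T \<in> measurable \<mu> \<mu>" by (rule invariant_prob_measurable[OF inv T])
  have M [measurable]: "?M \<in> borel_measurable \<mu>" by (rule running_max_measurable[OF Tm f])
  note [measurable] = f
  have bd: "\<bar>?M x\<bar> \<le> real (Suc N) * B" for x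
    using running_max_le[of f B T "Suc N" x] running_max_nonneg[of T f "Suc N" x] B by simp
  have i1: "integrable \<mu> ?M"
    by (rule integrable_const_bound[where B="real (Suc N) * B"])
      (use bd in \<open>simp_all del: running_max.simps of_nat_Suc\<close>)
  have i2: "integrable \<mu> (\<lambda>x. ?M (T x))"
    by (rule integrable_const_bound[where B="real (Suc N) * B"])
      (use bd in \<open>simp_all del: running_max.simps of_nat_Suc\<close>)
  have sp: "space \<mu> = UNIV" by (rule invariant_prob_space[OF inv])
  have i3: "integrable \<mu> (\<lambda>x. f x * indicator {x. 0 < ?M x} x)"
  proof (rule integrable_const_bound[where B=B])
    show "AE x in \<mu>. norm (f x * indicator {x. 0 < ?M x} x) \<le> B"
      using B by (auto simp: indicator_def intro: order_trans[OF abs_ge_zero])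
    have "{x. 0 < ?M x} = {x\<in>space \<mu>. 0 < ?M x}" by (simp add: sp)
    also have "\<dots> \<in> sets \<mu>" by measurable
    finally show "(\<lambda>x. f x * indicator {x. 0 < ?M x} x) \<in> borel_measurable \<mu>" by measurable
  qed
  have "0 = (\<integral>x. ?M x \<partial>\<mu>) - (\<integral>x. ?M (T x) \<partial>\<mu>)"
    using integral_funpow[OF inv T M, of 1] by simp
  also have "\<dots> = (\<integral>x. ?M x - ?M (T x) \<partial>\<mu>)"
    by (rule Bochner_Integration.integral_diff[OF i1 i2, symmetric])
  also have "\<dots> \<le> (\<integral>x. f x * indicator {x. 0 < ?M x} x \<partial>\<mu>)"
  proof (rule integral_mono[OF Bochner_Integration.integrable_diff[OF i1 i2] i3])
    fix x
    show "?M x - ?M (T x) \<le> f x * indicator {x. 0 < ?M x} x"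
    proof (cases "0 < ?M x")
      case True
      then have "?M x = f x + running_max T f N (T x)" by (simp add: max_def split: if_splits)
      then show ?thesis using running_max_Suc_ge[of T f N "T x"] True by (simp del: running_max.simps)
    next
      case False
      then show ?thesis using running_max_nonneg[of T f "Suc N" "T x"] by (simp del: running_max.simps)
    qed
  qed
  finally show ?thesis .
qed

text \<open>The set where the Birkhoff sums are unbounded above is strictly invariant, since one more summand
  changes them by a bounded amount. If it had full measure, the maximal inequality would pass to the limit and give
  \<open>0 \<le> \<integral> f\<close>. Working with unbounded sums instead of the upper limit of averages makes
  the invariance immediate.\<close>

lemma ergodic_unbounded_sums_null:
  fixes f :: "'a::topological_space \<Rightarrow> real"
  assumes erg: "ergodic T \<mu>" and T: "continuous_on UNIV T"
    and f: "f \<in> borel_measurable \<mu>" and B: "\<And>x. \<bar>f x\<bar> \<le> B"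
    and neg: "(\<integral>x. f x \<partial>\<mu>) < 0"
  defines "E \<equiv> {x. \<forall>k::nat. \<exists>n. real k < birkhoff_sum T n f x}"
  shows "E \<in> sets \<mu>" "measure \<mu> E = 0"
proof -
  have inv: "invariant_prob T \<mu>" using erg by (simp add: ergodic_def)
  interpret prob_space \<mu> using inv by (simp add: invariant_prob_def)
  have sp: "space \<mu> = UNIV" by (rule invariant_prob_space[OF inv])
  have Tm: "T \<in> measurable \<mu> \<mu>" by (rule invariant_prob_measurable[OF inv T])
  note [measurable] = f birkhoff_sum_measurable[OF inv T f] running_max_measurable[OF Tm f]
  have "{x\<in>space \<mu>. \<forall>k::nat. \<exists>n. real k < birkhoff_sum T n f x} \<in> sets \<mu>" by measurable
  then show E: "E \<in> sets \<mu>" by (simp add: E_def sp)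
  have iff: "x \<in> E \<longleftrightarrow> T x \<in> E" for x
  proof
    assume x: "x \<in> E"
    show "T x \<in> E" unfolding E_def
    proof safe
      fix k :: nat
      obtain n where n: "real (k + nat \<lceil>\<bar>f x\<bar>\<rceil>) < birkhoff_sum T n f x"
        using x unfolding E_def by blast
      have "0 \<le> real (k + nat \<lceil>\<bar>f x\<bar>\<rceil>)" by (rule of_nat_0_le_iff)
      with n have "n \<noteq> 0" by (intro notI) (simp del: of_nat_add)
      then obtain n' where "n = Suc n'" by (cases n) auto
      then have "real k < birkhoff_sum T n' f (T x)"
        using n of_nat_ceiling[of "\<bar>f x\<bar>"] by (simp add: birkhoff_sum_Suc) linarith
      then show "\<exists>n. real k < birkhoff_sum T n f (T x)" ..
    qed
  next
    assume x: "T x \<in> E"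
    show "x \<in> E" unfolding E_def
    proof safe
      fix k :: nat
      obtain n where n: "real (k + nat \<lceil>\<bar>f x\<bar>\<rceil>) < birkhoff_sum T n f (T x)"
        using x unfolding E_def by blast
      then have "real k < birkhoff_sum T (Suc n) f x"
        using of_nat_ceiling[of "\<bar>f x\<bar>"] by (simp add: birkhoff_sum_Suc) linarith
      then show "\<exists>n. real k < birkhoff_sum T n f x" ..
    qed
  qed
  then have "T -` E = E" by auto
  then have "measure \<mu> E = 0 \<or> measure \<mu> E = 1"
    using erg E by (simp add: ergodic_def)
  moreover have "measure \<mu> E \<noteq> 1"
  proof
    assume "measure \<mu> E = 1"
    then have AE: "AE x in \<mu>. x \<in> E" using E by (simp add: AE_prob_1)
    let ?A = "\<lambda>N. {x. 0 < running_max T f (Suc N) x}"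
    have Am: "?A N \<in> sets \<mu>" for N
    proof -
      have "{x\<in>space \<mu>. 0 < running_max T f (Suc N) x} \<in> sets \<mu>" by measurable
      then show ?thesis by (simp add: sp del: running_max.simps)
    qed
    have "(\<lambda>N. \<integral>x. f x * indicator (?A N) x \<partial>\<mu>) \<longlonglongrightarrow> (\<integral>x. f x \<partial>\<mu>)"
    proof (rule integral_dominated_convergence[where w="\<lambda>_. B"])
      show "AE x in \<mu>. (\<lambda>N. f x * indicator (?A N) x) \<longlonglongrightarrow> f x"
        using AE
      proof eventually_elim
        case (elim x)
        then have "\<exists>n. real 0 < birkhoff_sum T n f x" unfolding E_def by blast
        then obtain n where n: "0 < birkhoff_sum T n f x" by auto
        have "f x * indicator (?A N) x = f x" if "n \<le> N" for N
          using running_max_ge_birkhoff_sum[of n "Suc N" T f x] n that by (simp del: running_max.simps)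
        then show ?case
          by (intro tendsto_eventually) (auto simp: eventually_sequentially)
      qed
      show "AE x in \<mu>. norm (f x * indicator (?A N) x) \<le> B" for N
        using B by (auto simp: indicator_def intro: order_trans[OF abs_ge_zero])
    qed (use Am in \<open>auto simp del: running_max.simps\<close>)
    then have "0 \<le> (\<integral>x. f x \<partial>\<mu>)"
      by (rule LIMSEQ_le_const) (use maximal_ergodic[OF inv T f B] in blast)
    with neg show False by simp
  qed
  ultimately show "measure \<mu> E = 0" by blast
qed

text \<open>If the average is at least \<open>c\<close> infinitely often, then the sums of \<open>f - c'\<close> are unbounded
  for every \<open>c' < c\<close>; for \<open>c'\<close> above the integral this is a null event.\<close>

lemma ergodic_averages_upper:
  fixes f :: "'a::topological_space \<Rightarrow> real"
  assumes erg: "ergodic T \<mu>" and T: "continuous_on UNIV T"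
    and f: "f \<in> borel_measurable \<mu>" and B: "\<And>x. \<bar>f x\<bar> \<le> B"
    and c: "(\<integral>x. f x \<partial>\<mu>) < c"
  shows "(\<lambda>n. measure \<mu> {x. real n * c \<le> birkhoff_sum T n f x}) \<longlonglongrightarrow> 0"
proof -
  have inv: "invariant_prob T \<mu>" using erg by (simp add: ergodic_def)
  interpret prob_space \<mu> using inv by (simp add: invariant_prob_def)
  have sp: "space \<mu> = UNIV" by (rule invariant_prob_space[OF inv])
  obtain c' where c': "(\<integral>x. f x \<partial>\<mu>) < c'" "c' < c" using c dense by blast
  define g where "g = (\<lambda>x. f x - c')"
  note [measurable] = f birkhoff_sum_measurable[OF inv T f]
  have g: "g \<in> borel_measurable \<mu>" by (simp add: g_def)
  have gb: "\<bar>g x\<bar> \<le> B + \<bar>c'\<bar>" for x using B[of x] by (simp add: g_def)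
  have "integrable \<mu> f" by (rule integrable_const_bound[where B=B]) (use B in auto)
  then have gneg: "(\<integral>x. g x \<partial>\<mu>) < 0" using c' by (simp add: g_def prob_space)
  have Sg: "birkhoff_sum T n g x = birkhoff_sum T n f x - real n * c'" for n x
    by (simp add: birkhoff_sum_def g_def sum_subtractf)
  let ?E = "{x. \<forall>k::nat. \<exists>n. real k < birkhoff_sum T n g x}"
  note E = ergodic_unbounded_sums_null[OF erg T g gb gneg]
  let ?G = "\<lambda>n. {x. \<exists>k\<ge>n. real k * c \<le> birkhoff_sum T k f x}"
  have Gm: "?G n \<in> sets \<mu>" for n
  proof -
    have "{x\<in>space \<mu>. \<exists>k\<in>{n..}. real k * c \<le> birkhoff_sum T k f x} \<in> sets \<mu>" by measurable
    then show ?thesis by (simp add: sp Bex_def)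
  qed
  have sub: "(\<Inter>n. ?G n) \<subseteq> ?E"
  proof safe
    fix x k assume x: "x \<in> (\<Inter>n. ?G n)"
    obtain n :: nat where n: "real k / (c - c') < real n" using reals_Archimedean2 by blast
    then obtain j where j: "n \<le> j" "real j * c \<le> birkhoff_sum T j f x" using x by auto
    have "real k < real n * (c - c')" using n c' by (simp add: field_simps)
    also have "\<dots> \<le> real j * (c - c')" using j c' by (intro mult_right_mono) auto
    also have "\<dots> \<le> birkhoff_sum T j g x" using j by (simp add: Sg algebra_simps)
    finally show "\<exists>n. real k < birkhoff_sum T n g x" ..
  qed
  have "(\<lambda>n. measure \<mu> (?G n)) \<longlonglongrightarrow> measure \<mu> (\<Inter>n. ?G n)"
    by (rule finite_Lim_measure_decseq) (use Gm in \<open>auto simp: decseq_def intro: order_trans\<close>)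
  moreover have "measure \<mu> (\<Inter>n. ?G n) = 0"
    using finite_measure_mono[OF sub E(1)] E(2) by (simp add: measure_le_0_iff)
  ultimately have lim: "(\<lambda>n. measure \<mu> (?G n)) \<longlonglongrightarrow> 0" by simp
  show ?thesis
  proof (rule tendsto_sandwich[OF _ _ tendsto_const lim])
    show "\<forall>\<^sub>F n in sequentially. measure \<mu> {x. real n * c \<le> birkhoff_sum T n f x} \<le> measure \<mu> (?G n)"
      by (intro always_eventually allI finite_measure_mono Gm) auto
  qed simp
qed

lemma ergodic_averages:
  fixes f :: "'a::topological_space \<Rightarrow> real"
  assumes erg: "ergodic T \<mu>" and T: "continuous_on UNIV T"
    and f: "f \<in> borel_measurable \<mu>" and B: "\<And>x. \<bar>f x\<bar> \<le> B" and \<delta>: "0 < \<delta>"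
  shows "(\<lambda>n. measure \<mu> {x. real n * \<delta> \<le> \<bar>birkhoff_sum T n f x - real n * (\<integral>x. f x \<partial>\<mu>)\<bar>}) \<longlonglongrightarrow> 0"
proof -
  have inv: "invariant_prob T \<mu>" using erg by (simp add: ergodic_def)
  interpret prob_space \<mu> using inv by (simp add: invariant_prob_def)
  have sp: "space \<mu> = UNIV" by (rule invariant_prob_space[OF inv])
  let ?a = "\<integral>x. f x \<partial>\<mu>"
  note [measurable] = f birkhoff_sum_measurable[OF inv T f]
  let ?U = "\<lambda>n. {x. real n * (?a + \<delta>) \<le> birkhoff_sum T n f x}"
  let ?V = "\<lambda>n. {x. real n * (- ?a + \<delta>) \<le> birkhoff_sum T n (\<lambda>x. - f x) x}"
  have neg: "birkhoff_sum T n (\<lambda>x. - f x) x = - birkhoff_sum T n f x" for n x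
    by (simp add: birkhoff_sum_def sum_negf)
  have "(\<lambda>n. measure \<mu> (?U n) + measure \<mu> (?V n)) \<longlonglongrightarrow> 0 + 0"
    by (intro tendsto_add ergodic_averages_upper[OF erg T]) (use f B \<delta> in auto)
  then have lim: "(\<lambda>n. measure \<mu> (?U n) + measure \<mu> (?V n)) \<longlonglongrightarrow> 0" by simp
  have Um: "?U n \<in> sets \<mu>" for n
  proof -
    have "{x\<in>space \<mu>. real n * (?a + \<delta>) \<le> birkhoff_sum T n f x} \<in> sets \<mu>" by measurable
    then show ?thesis by (simp add: sp)
  qed
  have Vm: "?V n \<in> sets \<mu>" for n
  proof -
    have "{x\<in>space \<mu>. real n * (- ?a + \<delta>) \<le> - birkhoff_sum T n f x} \<in> sets \<mu>" by measurable
    then show ?thesis by (simp add: sp neg)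
  qed
  show ?thesis
  proof (rule tendsto_sandwich[OF _ _ tendsto_const lim])
    have "measure \<mu> {x. real n * \<delta> \<le> \<bar>birkhoff_sum T n f x - real n * ?a\<bar>}
        \<le> measure \<mu> (?U n) + measure \<mu> (?V n)" for n
    proof -
      have "measure \<mu> {x. real n * \<delta> \<le> \<bar>birkhoff_sum T n f x - real n * ?a\<bar>} \<le> measure \<mu> (?U n \<union> ?V n)"
        using Um[of n] Vm[of n] by (intro finite_measure_mono) (auto simp: neg algebra_simps)
      also have "\<dots> \<le> measure \<mu> (?U n) + measure \<mu> (?V n)"
        by (rule measure_Un_le[OF Um[of n] Vm[of n]])
      finally show ?thesis .
    qed
    then show "\<forall>\<^sub>F n in sequentially. measure \<mu> {x. real n * \<delta> \<le> \<bar>birkhoff_sum T n f x - real n * ?a\<bar>}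
        \<le> measure \<mu> (?U n) + measure \<mu> (?V n)" by simp
  qed simp
qed

section \<open>Topological pressure\<close>

definition ball_weight ::
  "('a::metric_space \<Rightarrow> 'a) \<Rightarrow> ('a \<Rightarrow> real) \<Rightarrow> real \<Rightarrow> real \<Rightarrow> 'a \<Rightarrow> nat \<Rightarrow> real" where
  "ball_weight T \<psi> t \<epsilon> x k = exp (- t * real k + (SUP y\<in>bowen_ball T k x \<epsilon>. birkhoff_sum T k \<psi> y))"

lemma pressure_pre_ball_weight:
  "pressure_pre T Z t \<psi> n \<epsilon> =
     (INF C\<in>bowen_covers T n Z \<epsilon>. \<Sum>\<^sub>\<infinity>(x, k)\<in>C. ennreal (ball_weight T \<psi> t \<epsilon> x k))"
  by (simp add: pressure_pre_def ball_weight_def)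

lemma bowen_dist_less_iff:
  assumes "0 < n"
  shows "bowen_dist T n x y < \<epsilon> \<longleftrightarrow> (\<forall>i<n. dist ((T ^^ i) x) ((T ^^ i) y) < \<epsilon>)"
  unfolding bowen_dist_def using assms by (subst Max_less_iff) auto

lemma mem_bowen_ball:
  assumes "0 < n"
  shows "y \<in> bowen_ball T n x \<epsilon> \<longleftrightarrow> (\<forall>i<n. dist ((T ^^ i) x) ((T ^^ i) y) < \<epsilon>)"
  using bowen_dist_less_iff[OF assms] by (simp add: bowen_ball_def)

lemma open_bowen_ball:
  assumes T: "continuous_on UNIV T" and n: "0 < n"
  shows "open (bowen_ball T n x \<epsilon>)"
proof -
  have "bowen_ball T n x \<epsilon> = (\<Inter>i\<in>{..<n}. (T ^^ i) -` ball ((T ^^ i) x) \<epsilon>)"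
    by (auto simp: mem_bowen_ball[OF n])
  also have "open \<dots>"
    by (intro open_INT finite_lessThan ballI open_vimage open_ball continuous_on_funpow[OF T])
  finally show ?thesis .
qed

lemma bdd_above_birkhoff_sum:
  assumes "\<And>x. \<bar>\<psi> x\<bar> \<le> B"
  shows "bdd_above (birkhoff_sum T k \<psi> ` A)"
  using birkhoff_sum_abs_le[of \<psi> B T k, OF assms] by (intro bdd_aboveI2[where M="real k * B"]) (simp add: abs_le_iff)

lemma pressure_pre_mono_set:
  assumes "Z \<subseteq> Z'"
  shows "pressure_pre T Z t \<psi> n \<epsilon> \<le> pressure_pre T Z' t \<psi> n \<epsilon>"
proof -
  have "bowen_covers T n Z' \<epsilon> \<subseteq> bowen_covers T n Z \<epsilon>"
    unfolding bowen_covers_def using assms by blast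
  then show ?thesis
    unfolding pressure_pre_def by (rule INF_superset_mono) (rule order_refl)
qed

lemma bowen_covers_antimono_length: "n \<le> n' \<Longrightarrow> bowen_covers T n' Z \<epsilon> \<subseteq> bowen_covers T n Z \<epsilon>"
  unfolding bowen_covers_def by (fastforce intro: order_trans)

lemma pressure_pre_mono_length:
  assumes "n \<le> n'"
  shows "pressure_pre T Z t \<psi> n \<epsilon> \<le> pressure_pre T Z t \<psi> n' \<epsilon>"
  unfolding pressure_pre_def
  by (rule INF_superset_mono[OF bowen_covers_antimono_length[OF assms] order_refl])

lemma pressure_pre_mono_exponent:
  assumes "t \<le> t'"
  shows "pressure_pre T Z t' \<psi> n \<epsilon> \<le> pressure_pre T Z t \<psi> n \<epsilon>"
  unfolding pressure_pre_ball_weight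
proof (rule INF_mono)
  fix C assume C: "C \<in> bowen_covers T n Z \<epsilon>"
  have le: "ball_weight T \<psi> t' \<epsilon> x k \<le> ball_weight T \<psi> t \<epsilon> x k" for x k
    unfolding ball_weight_def using mult_right_mono[OF assms, of "real k"] by simp
  have "(\<Sum>\<^sub>\<infinity>(x, k)\<in>C. ennreal (ball_weight T \<psi> t' \<epsilon> x k))
      \<le> (\<Sum>\<^sub>\<infinity>(x, k)\<in>C. ennreal (ball_weight T \<psi> t \<epsilon> x k))"
    by (rule infsum_mono) (auto intro: nonneg_summable_on_complete ennreal_leI le)
  with C show "\<exists>C'\<in>bowen_covers T n Z \<epsilon>.
     (\<Sum>\<^sub>\<infinity>(x, k)\<in>C'. ennreal (ball_weight T \<psi> t' \<epsilon> x k))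
     \<le> (\<Sum>\<^sub>\<infinity>(x, k)\<in>C. ennreal (ball_weight T \<psi> t \<epsilon> x k))" by blast
qed

lemma pressure_outer_eq_SUP: "pressure_outer T Z t \<psi> \<epsilon> = (SUP n. pressure_pre T Z t \<psi> n \<epsilon>)"
  unfolding pressure_outer_def
  by (intro limI LIMSEQ_SUP) (simp add: incseq_def pressure_pre_mono_length)

lemma pressure_pre_le_outer: "pressure_pre T Z t \<psi> n \<epsilon> \<le> pressure_outer T Z t \<psi> \<epsilon>"
  unfolding pressure_outer_eq_SUP by (rule SUP_upper) simp

lemma pressure_outer_mono_set:
  "Z \<subseteq> Z' \<Longrightarrow> pressure_outer T Z t \<psi> \<epsilon> \<le> pressure_outer T Z' t \<psi> \<epsilon>"
  unfolding pressure_outer_eq_SUP by (intro SUP_mono') (rule pressure_pre_mono_set)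

lemma pressure_outer_mono_exponent:
  "t \<le> t' \<Longrightarrow> pressure_outer T Z t' \<psi> \<epsilon> \<le> pressure_outer T Z t \<psi> \<epsilon>"
  unfolding pressure_outer_eq_SUP by (intro SUP_mono') (rule pressure_pre_mono_exponent)

lemma pressure_at_mono_set:
  assumes "Z \<subseteq> Z'"
  shows "pressure_at T Z \<psi> \<epsilon> \<le> pressure_at T Z' \<psi> \<epsilon>"
  unfolding pressure_at_def
proof (rule Inf_superset_mono, rule image_mono, safe)
  fix t assume "pressure_outer T Z' t \<psi> \<epsilon> = 0"
  then show "pressure_outer T Z t \<psi> \<epsilon> = 0"
    using pressure_outer_mono_set[OF assms, of T t \<psi> \<epsilon>] by simp
qed

lemma pressure_at_ge:
  assumes "0 < pressure_outer T Z t \<psi> \<epsilon>"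
  shows "ereal t \<le> pressure_at T Z \<psi> \<epsilon>"
  unfolding pressure_at_def
proof (rule Inf_greatest, safe)
  fix t' assume 0: "pressure_outer T Z t' \<psi> \<epsilon> = 0"
  have "t < t'"
  proof (rule ccontr)
    assume "\<not> t < t'"
    then have "pressure_outer T Z t \<psi> \<epsilon> \<le> pressure_outer T Z t' \<psi> \<epsilon>"
      by (intro pressure_outer_mono_exponent) simp
    then show False using 0 assms by simp
  qed
  then show "ereal t \<le> ereal t'" by simp
qed

text \<open>Shrinking the radius may lower the supremum of the Birkhoff sum over the ball, but by no more than
  the oscillation \<open>v\<close> of \<open>\<psi>\<close> per step; raising the exponent by \<open>v\<close> compensates for it.\<close>

lemma ball_weight_le:
  assumes T: "continuous_on UNIV T" and k: "0 < k" and B: "\<And>x. \<bar>\<psi> x\<bar> \<le> B"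
    and \<epsilon>: "0 < \<epsilon>\<^sub>1" "\<epsilon>\<^sub>1 \<le> \<epsilon>\<^sub>2" and v: "\<And>x y. dist x y < \<epsilon>\<^sub>2 \<Longrightarrow> \<bar>\<psi> x - \<psi> y\<bar> \<le> v"
  shows "ball_weight T \<psi> (t + v) \<epsilon>\<^sub>2 x k \<le> ball_weight T \<psi> t \<epsilon>\<^sub>1 x k"
proof -
  have x1: "x \<in> bowen_ball T k x \<epsilon>\<^sub>1" and x2: "x \<in> bowen_ball T k x \<epsilon>\<^sub>2"
    using \<epsilon> by (auto simp: mem_bowen_ball[OF k])
  have "(SUP y\<in>bowen_ball T k x \<epsilon>\<^sub>2. birkhoff_sum T k \<psi> y) \<le> birkhoff_sum T k \<psi> x + real k * v"
  proof (rule cSUP_least)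
    fix y assume "y \<in> bowen_ball T k x \<epsilon>\<^sub>2"
    then have "\<bar>birkhoff_sum T k \<psi> x - birkhoff_sum T k \<psi> y\<bar> \<le> real k * v"
      by (intro birkhoff_sum_diff_le v) (auto simp: mem_bowen_ball[OF k])
    then show "birkhoff_sum T k \<psi> y \<le> birkhoff_sum T k \<psi> x + real k * v" by linarith
  qed (use x2 in auto)
  moreover have "birkhoff_sum T k \<psi> x \<le> (SUP y\<in>bowen_ball T k x \<epsilon>\<^sub>1. birkhoff_sum T k \<psi> y)"
    by (rule cSUP_upper[OF x1 bdd_above_birkhoff_sum[OF B]])
  ultimately show ?thesis by (simp add: ball_weight_def algebra_simps)
qed

text \<open>The function \<open>\<epsilon> \<mapsto> pressure_at T Z \<psi> \<epsilon>\<close> is antitone up to the oscillation of \<open>\<psi>\<close>: this is what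
  remains of monotonicity when the supremum is taken over the whole ball, and it suffices for the
  limit defining the pressure to exist.\<close>

lemma pressure_at_le_add:
  assumes T: "continuous_on UNIV T" and B: "\<And>x. \<bar>\<psi> x\<bar> \<le> B"
    and \<epsilon>: "0 < \<epsilon>\<^sub>1" "\<epsilon>\<^sub>1 \<le> \<epsilon>\<^sub>2" and v: "\<And>x y. dist x y < \<epsilon>\<^sub>2 \<Longrightarrow> \<bar>\<psi> x - \<psi> y\<bar> \<le> v"
  shows "pressure_at T Z \<psi> \<epsilon>\<^sub>2 \<le> pressure_at T Z \<psi> \<epsilon>\<^sub>1 + ereal v"
proof -
  have pre: "pressure_pre T Z (t + v) \<psi> n \<epsilon>\<^sub>2 \<le> pressure_pre T Z t \<psi> n \<epsilon>\<^sub>1" if n: "0 < n" for t n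
    unfolding pressure_pre_ball_weight
  proof (rule INF_mono)
    fix C assume C: "C \<in> bowen_covers T n Z \<epsilon>\<^sub>1"
    have "C \<in> bowen_covers T n Z \<epsilon>\<^sub>2"
    proof -
      have "bowen_ball T k x \<epsilon>\<^sub>1 \<subseteq> bowen_ball T k x \<epsilon>\<^sub>2" for x k
        using \<epsilon> by (auto simp: bowen_ball_def)
      then have "(\<Union>(x, k)\<in>C. bowen_ball T k x \<epsilon>\<^sub>1) \<subseteq> (\<Union>(x, k)\<in>C. bowen_ball T k x \<epsilon>\<^sub>2)"
        by (intro UN_mono) auto
      then show ?thesis using C unfolding bowen_covers_def by blast
    qed
    moreover have "(\<Sum>\<^sub>\<infinity>(x, k)\<in>C. ennreal (ball_weight T \<psi> (t + v) \<epsilon>\<^sub>2 x k))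
        \<le> (\<Sum>\<^sub>\<infinity>(x, k)\<in>C. ennreal (ball_weight T \<psi> t \<epsilon>\<^sub>1 x k))"
    proof (rule infsum_mono)
      fix a assume a: "a \<in> C"
      obtain x k where [simp]: "a = (x, k)" by (cases a)
      have "0 < k" using a C n by (auto simp: bowen_covers_def)
      then have "ball_weight T \<psi> (t + v) \<epsilon>\<^sub>2 x k \<le> ball_weight T \<psi> t \<epsilon>\<^sub>1 x k"
        by (rule ball_weight_le[OF T _ B \<epsilon> v])
      then show "(case a of (x, k) \<Rightarrow> ennreal (ball_weight T \<psi> (t + v) \<epsilon>\<^sub>2 x k))
          \<le> (case a of (x, k) \<Rightarrow> ennreal (ball_weight T \<psi> t \<epsilon>\<^sub>1 x k))" by (simp add: ennreal_leI)
    qed (auto intro: nonneg_summable_on_complete)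
    ultimately show "\<exists>C'\<in>bowen_covers T n Z \<epsilon>\<^sub>2.
       (\<Sum>\<^sub>\<infinity>(x, k)\<in>C'. ennreal (ball_weight T \<psi> (t + v) \<epsilon>\<^sub>2 x k))
        \<le> (\<Sum>\<^sub>\<infinity>(x, k)\<in>C. ennreal (ball_weight T \<psi> t \<epsilon>\<^sub>1 x k))" by blast
  qed
  have outer: "pressure_outer T Z (t + v) \<psi> \<epsilon>\<^sub>2 \<le> pressure_outer T Z t \<psi> \<epsilon>\<^sub>1" for t
    unfolding pressure_outer_eq_SUP
  proof (rule SUP_mono)
    fix n
    have "pressure_pre T Z (t + v) \<psi> n \<epsilon>\<^sub>2 \<le> pressure_pre T Z (t + v) \<psi> (Suc n) \<epsilon>\<^sub>2"
      by (rule pressure_pre_mono_length) simp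
    also have "\<dots> \<le> pressure_pre T Z t \<psi> (Suc n) \<epsilon>\<^sub>1" by (rule pre) simp
    finally show "\<exists>m\<in>UNIV. pressure_pre T Z (t + v) \<psi> n \<epsilon>\<^sub>2 \<le> pressure_pre T Z t \<psi> m \<epsilon>\<^sub>1" by blast
  qed
  have "pressure_at T Z \<psi> \<epsilon>\<^sub>2 - ereal v \<le> pressure_at T Z \<psi> \<epsilon>\<^sub>1"
    unfolding pressure_at_def[of T Z \<psi> \<epsilon>\<^sub>1]
  proof (rule Inf_greatest, safe)
    fix t assume "pressure_outer T Z t \<psi> \<epsilon>\<^sub>1 = 0"
    then have "pressure_outer T Z (t + v) \<psi> \<epsilon>\<^sub>2 = 0" using outer[of t] by simp
    then have "pressure_at T Z \<psi> \<epsilon>\<^sub>2 \<le> ereal (t + v)"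
      unfolding pressure_at_def by (intro Inf_lower) auto
    then show "pressure_at T Z \<psi> \<epsilon>\<^sub>2 - ereal v \<le> ereal t"
      by (simp add: ereal_minus_le_iff)
  qed
  then show ?thesis by (simp add: ereal_minus_le_iff)
qed

lemma compact_uniform_modulus:
  fixes f :: "'a::metric_space \<Rightarrow> real"
  assumes "compact (UNIV :: 'a set)" "continuous_on UNIV f" "0 < e"
  obtains d where "0 < d" "\<And>x y. dist x y < d \<Longrightarrow> \<bar>f x - f y\<bar> \<le> e"
proof -
  have "uniformly_continuous_on UNIV f" by (rule compact_uniformly_continuous[OF assms(2,1)])
  then obtain d where "0 < d" "\<And>x y. dist x y < d \<Longrightarrow> dist (f x) (f y) < e"
    unfolding uniformly_continuous_on_def using assms(3) by (metis UNIV_I)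
  then show thesis by (intro that[of d]) (auto simp: dist_real_def intro: less_imp_le)
qed

lemma compact_bounded_function:
  fixes f :: "'a::metric_space \<Rightarrow> real"
  assumes "compact (UNIV :: 'a set)" "continuous_on UNIV f"
  obtains B where "0 \<le> B" "\<And>x. \<bar>f x\<bar> \<le> B"
proof -
  have "bounded (range f)" by (rule compact_imp_bounded[OF compact_continuous_image[OF assms(2,1)]])
  then obtain B where "\<And>x. \<bar>f x\<bar> \<le> B" unfolding bounded_iff by auto
  then show thesis by (intro that[of "max B 0"]) (auto simp: le_max_iff_disj)
qed

lemma tendsto_pressure:
  fixes T :: "'a::metric_space \<Rightarrow> 'a"
  assumes X: "compact (UNIV :: 'a set)" and T: "continuous_on UNIV T" and \<psi>: "continuous_on UNIV \<psi>"
  shows "((\<lambda>\<epsilon>. pressure_at T Z \<psi> \<epsilon>) \<longlongrightarrow> pressure T Z \<psi>) (at_right 0)"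
proof -
  let ?P = "\<lambda>\<epsilon>. pressure_at T Z \<psi> \<epsilon>" and ?F = "at_right (0::real)"
  obtain B where B: "\<And>x. \<bar>\<psi> x\<bar> \<le> B" using compact_bounded_function[OF X \<psi>] by blast
  have "Limsup ?F ?P \<le> Liminf ?F ?P + ereal e" if e: "0 < e" for e
  proof -
    obtain d where d: "0 < d" "\<And>x y. dist x y < d \<Longrightarrow> \<bar>\<psi> x - \<psi> y\<bar> \<le> e"
      using compact_uniform_modulus[OF X \<psi> e] by blast
    have le: "?P \<epsilon>\<^sub>2 - ereal e \<le> ?P \<epsilon>\<^sub>1" if "0 < \<epsilon>\<^sub>1" "\<epsilon>\<^sub>1 \<le> \<epsilon>\<^sub>2" "\<epsilon>\<^sub>2 < d" for \<epsilon>\<^sub>1 \<epsilon>\<^sub>2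
      using pressure_at_le_add[OF T B that(1,2), where v=e and Z=Z] d(2) that by (simp add: ereal_minus_le_iff)
    have "?P \<epsilon>\<^sub>2 - ereal e \<le> Liminf ?F ?P" if "0 < \<epsilon>\<^sub>2" "\<epsilon>\<^sub>2 < d" for \<epsilon>\<^sub>2
      by (intro Liminf_bounded eventually_at_rightI[of 0 \<epsilon>\<^sub>2]) (use le that in auto)
    then have "\<forall>\<^sub>F \<epsilon> in ?F. ?P \<epsilon> \<le> Liminf ?F ?P + ereal e"
      using d(1) by (intro eventually_at_rightI[of 0 d]) (auto simp: ereal_minus_le_iff)
    then show ?thesis by (rule Limsup_bounded)
  qed
  then have "Limsup ?F ?P \<le> Liminf ?F ?P" by (rule ereal_le_epsilon2[rule_format]) auto
  then have "Liminf ?F ?P = Limsup ?F ?P" by (intro antisym Liminf_le_Limsup) auto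
  then have *: "(?P \<longlongrightarrow> Liminf ?F ?P) ?F" by (intro Liminf_eq_Limsup) auto
  have "pressure T Z \<psi> = Liminf ?F ?P"
    unfolding pressure_def by (rule tendsto_Lim[OF _ *]) simp
  with * show ?thesis by simp
qed

lemma pressure_mono:
  fixes T :: "'a::metric_space \<Rightarrow> 'a"
  assumes "compact (UNIV :: 'a set)" "continuous_on UNIV T" "continuous_on UNIV \<psi>" "Z \<subseteq> Z'"
  shows "pressure T Z \<psi> \<le> pressure T Z' \<psi>"
  by (rule tendsto_le[OF _ tendsto_pressure tendsto_pressure])
    (use assms in \<open>auto intro!: always_eventually pressure_at_mono_set\<close>)

text \<open>Positivity of the covering sums at a single exponent bounds the critical exponent from below, and a
  bound at all small scales survives the limit.\<close>

lemma pressure_ge: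
  fixes T :: "'a::metric_space \<Rightarrow> 'a"
  assumes "compact (UNIV :: 'a set)" "continuous_on UNIV T" "continuous_on UNIV \<psi>"
    and "0 < \<epsilon>" and "\<And>\<epsilon>'. 0 < \<epsilon>' \<Longrightarrow> \<epsilon>' < \<epsilon> \<Longrightarrow> 0 < pressure_outer T Z t \<psi> \<epsilon>'"
  shows "ereal t \<le> pressure T Z \<psi>"
  by (rule tendsto_lowerbound[OF tendsto_pressure eventually_at_rightI[of 0 \<epsilon>]])
    (use assms in \<open>auto intro: pressure_at_ge\<close>)

section \<open>Shadowing sets\<close>

definition shadows :: "('a::metric_space \<Rightarrow> 'a) \<Rightarrow> nat \<Rightarrow> real \<Rightarrow> 'a \<Rightarrow> 'a \<Rightarrow> bool" where
  "shadows T n \<epsilon> x y \<longleftrightarrow> (\<forall>l<n. dist ((T ^^ l) x) ((T ^^ l) y) \<le> \<epsilon>)"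

definition separated :: "('a::metric_space \<Rightarrow> 'a) \<Rightarrow> nat \<Rightarrow> real \<Rightarrow> 'a set \<Rightarrow> bool" where
  "separated T n r S \<longleftrightarrow> (\<forall>x\<in>S. \<forall>y\<in>S. x \<noteq> y \<longrightarrow> (\<exists>l<n. r \<le> dist ((T ^^ l) x) ((T ^^ l) y)))"

text \<open>No word is fixed for all stages at once: a point may be close to some admissible
  segment at each stage separately. This makes each stage a closed set whose definition does not
  involve the other stages.\<close>

definition shadow_stage ::
  "('a::metric_space \<Rightarrow> 'a) \<Rightarrow> nat \<Rightarrow> nat \<Rightarrow> real \<Rightarrow> (nat \<Rightarrow> 'a set) \<Rightarrow> nat \<Rightarrow> 'a set" where
  "shadow_stage T n L \<epsilon> S i = {z. \<exists>x\<in>S i. shadows T n \<epsilon> x ((T ^^ (i * L)) z)}"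

lemma closed_shadow_stage:
  assumes T: "continuous_on UNIV T" and S: "finite (S i)"
  shows "closed (shadow_stage T n L \<epsilon> S i)"
proof -
  have "shadow_stage T n L \<epsilon> S i
      = (\<Union>x\<in>S i. \<Inter>l\<in>{..<n}. (T ^^ (l + i * L)) -` cball ((T ^^ l) x) \<epsilon>)"
    unfolding shadow_stage_def shadows_def by (fastforce simp: funpow_add)
  also have "closed \<dots>"
    by (intro closed_UN closed_INT ballI closed_vimage closed_cball continuous_on_funpow[OF T] S)
  finally show ?thesis .
qed

text \<open>The complement of the union of the \<open>U a\<close> is compact and covered by the complements of the \<open>E i\<close>, so
  finitely many of the \<open>E i\<close> suffice.\<close>

lemma finite_cover_of_closed_Inter:
  fixes E :: "nat \<Rightarrow> 'a::metric_space set"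
  assumes X: "compact (UNIV :: 'a set)" and E: "\<And>i. closed (E i)"
    and U: "\<And>a. a \<in> C \<Longrightarrow> open (U a)" and cover: "(\<Inter>i. E i) \<subseteq> (\<Union>a\<in>C. U a)"
  obtains C' k where "finite C'" "C' \<subseteq> C" "\<And>k'. k \<le> k' \<Longrightarrow> (\<Inter>i\<in>{..<k'}. E i) \<subseteq> (\<Union>a\<in>C'. U a)"
proof -
  have comp: "compact A" if "closed A" for A :: "'a set"
    using compact_Int_closed[OF X that] by simp
  have "open (\<Union>a\<in>C. U a)" using U by blast
  then have "compact (- (\<Union>a\<in>C. U a))" by (intro comp) (rule closed_Compl)
  moreover have "- (\<Union>a\<in>C. U a) \<subseteq> (\<Union>i\<in>UNIV. - E i)" using cover by blast
  ultimately obtain I where I: "finite I" "- (\<Union>a\<in>C. U a) \<subseteq> (\<Union>i\<in>I. - E i)"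
    using E by (elim compactE_image[where f="\<lambda>i. - E i"]) auto
  have "compact (\<Inter>i\<in>I. E i)" by (intro comp closed_INT) (use E in auto)
  moreover have "(\<Inter>i\<in>I. E i) \<subseteq> (\<Union>a\<in>C. U a)" using I(2) by blast
  ultimately obtain C' where C': "C' \<subseteq> C" "finite C'" "(\<Inter>i\<in>I. E i) \<subseteq> (\<Union>a\<in>C'. U a)"
    using U by (elim compactE_image[where f=U]) auto
  obtain k where "I \<subseteq> {..<k}" using finite_nat_iff_bounded I(1) by blast
  then have "(\<Inter>i\<in>{..<k'}. E i) \<subseteq> (\<Union>a\<in>C'. U a)" if "k \<le> k'" for k'
    using that C'(3) by fastforce
  with C' show thesis by (rule_tac that[of C' k])
qed

text \<open>Points of a Bowen ball of length \<open>m\<close> stay within \<open>2 * \<epsilon>'\<close> of each other for \<open>m\<close> steps. Two words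
  shadowed from inside the ball are then closer than \<open>4 * \<epsilon>\<close> along each of their first \<open>j\<close> segments, which
  forces these segments to agree; a word in \<open>V\<close> is determined by its segments from \<open>j\<close> on.\<close>

lemma shadowed_words_in_ball:
  assumes n: "0 < n" and nL: "n \<le> L" and jL: "j * L \<le> m" and jk: "j \<le> k"
    and fin: "\<And>i. finite (S i)" and sep: "\<And>i. separated T n (4 * \<epsilon>) (S i)"
    and \<epsilon>': "0 < \<epsilon>'" "\<epsilon>' \<le> \<epsilon>"
    and V: "V \<subseteq> (\<Pi>\<^sub>E i\<in>{..<k}. S i)"
    and z: "\<And>w i. w \<in> V \<Longrightarrow> i < k \<Longrightarrow> shadows T n \<epsilon> (w i) ((T ^^ (i * L)) (z w))"
    and ball: "\<And>w. w \<in> V \<Longrightarrow> z w \<in> bowen_ball T m x \<epsilon>'"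
  shows "card V \<le> (\<Prod>i\<in>{j..<k}. card (S i))"
proof -
  have inj: "inj_on (\<lambda>w. restrict w {j..<k}) V"
  proof (rule inj_onI)
    fix w w' assume w: "w \<in> V" "w' \<in> V" and eq: "restrict w {j..<k} = restrict w' {j..<k}"
    have "w i = w' i" if i: "i < k" for i
    proof (cases "i < j")
      case True
      show ?thesis
      proof (rule ccontr)
        assume ne: "w i \<noteq> w' i"
        have "w i \<in> S i" "w' i \<in> S i" using w V i by (auto simp: PiE_def)
        then obtain l where l: "l < n" "4 * \<epsilon> \<le> dist ((T ^^ l) (w i)) ((T ^^ l) (w' i))"
          using sep[of i] ne unfolding separated_def by blast
        have "Suc i * L \<le> j * L" using True by (intro mult_right_mono) auto
        then have il: "l + i * L < m" using l(1) nL jL by simp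
        then have m0: "0 < m" by simp
        have "dist ((T ^^ (l + i * L)) x) ((T ^^ (l + i * L)) (z w)) < \<epsilon>'"
             "dist ((T ^^ (l + i * L)) x) ((T ^^ (l + i * L)) (z w')) < \<epsilon>'"
          using ball[OF w(1)] ball[OF w(2)] il unfolding mem_bowen_ball[OF m0] by blast+
        then have "dist ((T ^^ l) ((T ^^ (i * L)) (z w))) ((T ^^ l) ((T ^^ (i * L)) (z w'))) < 2 * \<epsilon>'"
          using dist_triangle3[of "(T ^^ (l + i * L)) (z w)" "(T ^^ (l + i * L)) (z w')" "(T ^^ (l + i * L)) x"]
          by (simp add: funpow_add)
        moreover have "dist ((T ^^ l) (w i)) ((T ^^ l) ((T ^^ (i * L)) (z w))) \<le> \<epsilon>"
          "dist ((T ^^ l) (w' i)) ((T ^^ l) ((T ^^ (i * L)) (z w'))) \<le> \<epsilon>"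
          using z[OF w(1) i] z[OF w(2) i] l(1) unfolding shadows_def by blast+
        ultimately have "dist ((T ^^ l) (w i)) ((T ^^ l) (w' i)) < 4 * \<epsilon>"
          using \<epsilon>' dist_triangle[of "(T ^^ l) (w i)" "(T ^^ l) (w' i)" "(T ^^ l) ((T ^^ (i * L)) (z w))"]
            dist_triangle2[of "(T ^^ l) ((T ^^ (i * L)) (z w))" "(T ^^ l) (w' i)" "(T ^^ l) ((T ^^ (i * L)) (z w'))"]
          by linarith
        with l(2) show False by simp
      qed
    next
      case False
      then show ?thesis using fun_cong[OF eq, of i] i by simp
    qed
    moreover have "w \<in> extensional {..<k}" "w' \<in> extensional {..<k}"
      using w V by (auto simp: PiE_def)
    ultimately show "w = w'" by (intro extensionalityI[of w "{..<k}"]) auto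
  qed
  have "(\<lambda>w. restrict w {j..<k}) ` V \<subseteq> (\<Pi>\<^sub>E i\<in>{j..<k}. S i)"
    using V by (fastforce simp: PiE_def)
  then have "card V \<le> card (\<Pi>\<^sub>E i\<in>{j..<k}. S i)"
    by (intro card_inj_on_le[OF inj]) (auto intro: finite_PiE fin)
  then show ?thesis by (simp add: card_PiE)
qed

text \<open>The first \<open>m div L\<close> blocks contribute at least \<open>L * t\<close> each to the sum of the \<open>a i\<close> and \<open>S\<^sub>m \<psi>\<close>,
  which cancels \<open>t * m\<close> up to the incomplete last block; that block costs a constant.\<close>

lemma ball_weight_ge:
  assumes B: "\<And>x. \<bar>\<psi> x\<bar> \<le> B" and L: "0 < L" and z: "z \<in> bowen_ball T m x \<epsilon>"
    and block: "\<And>i. i < m div L \<Longrightarrow> real L * t \<le> a i + birkhoff_sum T L \<psi> ((T ^^ (i * L)) z)"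
  shows "exp (- (real L * (\<bar>t\<bar> + B))) \<le> exp (\<Sum>i<m div L. a i) * ball_weight T \<psi> t \<epsilon> x m"
proof -
  define j where "j = m div L"
  have jm: "j * L + m mod L = m" by (simp add: j_def)
  have r: "real (m mod L) \<le> real L" using L by (simp add: less_imp_le)
  have "0 \<le> B" using B[of z] by linarith
  have "real j * (real L * t) = (\<Sum>i<j. real L * t)" by simp
  also have "\<dots> \<le> (\<Sum>i<j. a i + birkhoff_sum T L \<psi> ((T ^^ (i * L)) z))"
    by (rule sum_mono) (use block in \<open>auto simp: j_def\<close>)
  also have "\<dots> = (\<Sum>i<j. a i) + birkhoff_sum T (j * L) \<psi> z"
    by (simp add: sum.distrib birkhoff_sum_mult)
  finally have 1: "real j * (real L * t) \<le> (\<Sum>i<j. a i) + birkhoff_sum T (j * L) \<psi> z" .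
  have "birkhoff_sum T m \<psi> z = birkhoff_sum T (j * L) \<psi> z + birkhoff_sum T (m mod L) \<psi> ((T ^^ (j * L)) z)"
    using birkhoff_sum_add[of T "j * L" "m mod L"] jm by simp
  moreover have "\<bar>birkhoff_sum T (m mod L) \<psi> ((T ^^ (j * L)) z)\<bar> \<le> real L * B"
    using birkhoff_sum_abs_le[of \<psi> B T "m mod L", OF B] mult_right_mono[OF r \<open>0 \<le> B\<close>] order_trans by blast
  moreover have "birkhoff_sum T m \<psi> z \<le> (SUP y\<in>bowen_ball T m x \<epsilon>. birkhoff_sum T m \<psi> y)"
    by (rule cSUP_upper[OF z bdd_above_birkhoff_sum[OF B]])
  ultimately have 2: "birkhoff_sum T (j * L) \<psi> z - real L * B
      \<le> (SUP y\<in>bowen_ball T m x \<epsilon>. birkhoff_sum T m \<psi> y)" by linarith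
  have "t * real m - real j * (real L * t) = t * real (m mod L)"
    using arg_cong[OF jm, of real] by (simp add: algebra_simps flip: distrib_left)
  also have "\<dots> \<le> \<bar>t\<bar> * real L" using r by (intro mult_mono) auto
  finally have "- (real L * (\<bar>t\<bar> + B)) \<le> (\<Sum>i<j. a i) + (- t * real m + (SUP y\<in>bowen_ball T m x \<epsilon>. birkhoff_sum T m \<psi> y))"
    using 1 2 by (simp add: algebra_simps)
  then show ?thesis by (simp add: ball_weight_def j_def flip: exp_add)
qed

text \<open>The counting form of the mass distribution principle. Giving all words of length \<open>k\<close> the same
  mass plays the part of a measure on the set, and \<open>k\<close> is chosen large after a finite subcover has been
  extracted.\<close>

lemma pressure_outer_shadow_set_pos:
  fixes T :: "'a::metric_space \<Rightarrow> 'a"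
  assumes X: "compact (UNIV :: 'a set)" and T: "continuous_on UNIV T"
    and n: "0 < n" "n \<le> L" and B: "\<And>x. \<bar>\<psi> x\<bar> \<le> B"
    and fin: "\<And>i. finite (S i)" and ne: "\<And>i. S i \<noteq> {}"
    and sep: "\<And>i. separated T n (4 * \<epsilon>) (S i)"
    and spec: "\<And>w k. (\<And>i. i < k \<Longrightarrow> w i \<in> S i) \<Longrightarrow>
                 \<exists>z. \<forall>i<k. shadows T n \<epsilon> (w i) ((T ^^ (i * L)) z)"
    and weight: "\<And>i x y. x \<in> S i \<Longrightarrow> shadows T n \<epsilon> x y \<Longrightarrow>
                 real L * t \<le> ln (real (card (S i))) + birkhoff_sum T L \<psi> y"
    and \<epsilon>': "0 < \<epsilon>'" "\<epsilon>' \<le> \<epsilon>"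
  shows "0 < pressure_outer T (\<Inter>i. shadow_stage T n L \<epsilon> S i) t \<psi> \<epsilon>'"
proof -
  let ?F = "\<Inter>i. shadow_stage T n L \<epsilon> S i"
  define c where "c = exp (- (real L * (\<bar>t\<bar> + B)))"
  have "ennreal c \<le> (\<Sum>\<^sub>\<infinity>(x, k)\<in>C. ennreal (ball_weight T \<psi> t \<epsilon>' x k))"
    if C: "C \<in> bowen_covers T 1 ?F \<epsilon>'" for C
  proof -
    let ?wt = "\<lambda>a. ball_weight T \<psi> t \<epsilon>' (fst a) (snd a)"
    let ?ball = "\<lambda>a. bowen_ball T (snd a) (fst a) \<epsilon>'"
    have pos: "0 < snd a" if "a \<in> C" for a
      using C that by (auto simp: bowen_covers_def)
    have "?F \<subseteq> (\<Union>a\<in>C. ?ball a)"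
      using C by (simp add: bowen_covers_def case_prod_unfold)
    then obtain C' k0 where C': "finite C'" "C' \<subseteq> C"
      and k0: "\<And>k. k0 \<le> k \<Longrightarrow> (\<Inter>i\<in>{..<k}. shadow_stage T n L \<epsilon> S i) \<subseteq> (\<Union>a\<in>C'. ?ball a)"
      using finite_cover_of_closed_Inter[where E="shadow_stage T n L \<epsilon> S" and C=C and U="?ball",
          OF X closed_shadow_stage[OF T fin] open_bowen_ball[OF T pos]]
      by metis
    \<comment> \<open>The words must be at least as long as every ball in the subfamily; the sum of the lengths
      is a crude bound.\<close>
    define k where "k = k0 + (\<Sum>a\<in>C'. snd a)"
    have km: "snd a \<le> k" if "a \<in> C'" for a
      using member_le_sum[of a C' snd] that C'(1) by (simp add: k_def)
    define W where "W = (\<Pi>\<^sub>E i\<in>{..<k}. S i)"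
    have Wfin: "finite W" unfolding W_def by (intro finite_PiE) (auto intro: fin)
    have Wcard: "card W = (\<Prod>i<k. card (S i))" unfolding W_def by (simp add: card_PiE)
    have cpos: "0 < card (S i)" for i using fin ne by (simp add: card_gt_0_iff)
    then have Wpos: "0 < card W" unfolding Wcard by (intro prod_pos) auto
    have "\<exists>z. \<forall>i<k. shadows T n \<epsilon> (w i) ((T ^^ (i * L)) z)" if "w \<in> W" for w
      by (rule spec) (use that in \<open>auto simp: W_def\<close>)
    then obtain z where z: "\<And>w i. w \<in> W \<Longrightarrow> i < k \<Longrightarrow> shadows T n \<epsilon> (w i) ((T ^^ (i * L)) (z w))"
      by metis
    define V where "V a = {w \<in> W. z w \<in> ?ball a}" for a
    have "W \<subseteq> (\<Union>a\<in>C'. V a)"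
    proof
      fix w assume w: "w \<in> W"
      have "z w \<in> (\<Inter>i\<in>{..<k}. shadow_stage T n L \<epsilon> S i)"
        using z[OF w] w by (auto simp: shadow_stage_def W_def)
      then have "z w \<in> (\<Union>a\<in>C'. ?ball a)" using k0[of k] by (auto simp: k_def)
      with w show "w \<in> (\<Union>a\<in>C'. V a)" by (auto simp: V_def)
    qed
    then have "card W \<le> card (\<Union>a\<in>C'. V a)"
      by (intro card_mono) (use C' Wfin in \<open>auto simp: V_def\<close>)
    also have "\<dots> \<le> (\<Sum>a\<in>C'. card (V a))" by (rule card_UN_le[OF C'(1)])
    finally have "real (card W) \<le> real (\<Sum>a\<in>C'. card (V a))" by (rule of_nat_mono)
    then have le: "real (card W) \<le> (\<Sum>a\<in>C'. real (card (V a)))" by simp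
    have Va: "c * real (card (V a)) \<le> real (card W) * ?wt a" if a: "a \<in> C'" for a
    proof (cases "V a = {}")
      case True
      then show ?thesis by (simp add: ball_weight_def)
    next
      case False
      then obtain w where w: "w \<in> W" "z w \<in> ?ball a" by (auto simp: V_def)
      define j where "j = snd a div L"
      have jL: "j * L \<le> snd a" by (simp add: j_def)
      have "j \<le> snd a" by (simp add: j_def div_le_dividend)
      then have jk: "j \<le> k" using km[OF a] by simp
      have "card (V a) \<le> (\<Prod>i\<in>{j..<k}. card (S i))"
        by (rule shadowed_words_in_ball[OF n jL jk fin sep \<epsilon>', where V="V a" and z=z and x="fst a"])
          (auto simp: V_def W_def intro: z[unfolded W_def])
      then have "real (card (V a)) \<le> real (\<Prod>i\<in>{j..<k}. card (S i))" by (rule of_nat_mono)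
      then have 1: "real (card (V a)) \<le> (\<Prod>i\<in>{j..<k}. real (card (S i)))" by simp
      have "c \<le> exp (\<Sum>i<snd a div L. ln (real (card (S i)))) * ?wt a"
        unfolding c_def
      proof (rule ball_weight_ge[OF B])
        fix i assume "i < snd a div L"
        then have "i < k" using jk by (simp add: j_def)
        then show "real L * t \<le> ln (real (card (S i))) + birkhoff_sum T L \<psi> ((T ^^ (i * L)) (z w))"
          using w z by (intro weight[of "w i"]) (auto simp: W_def)
      qed (use n w in auto)
      also have "exp (\<Sum>i<snd a div L. ln (real (card (S i)))) = (\<Prod>i<j. real (card (S i)))"
        unfolding j_def using cpos by (simp add: exp_sum)
      finally have "c * real (card (V a)) \<le> ((\<Prod>i<j. real (card (S i))) * ?wt a) * (\<Prod>i\<in>{j..<k}. real (card (S i)))"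
        using 1 by (intro mult_mono) (auto simp: ball_weight_def intro!: mult_nonneg_nonneg prod_nonneg)
      also have "\<dots> = ((\<Prod>i<j. real (card (S i))) * (\<Prod>i\<in>{j..<k}. real (card (S i)))) * ?wt a"
        by simp
      also have "(\<Prod>i<j. real (card (S i))) * (\<Prod>i\<in>{j..<k}. real (card (S i))) = real (card W)"
        using prod.atLeastLessThan_concat[of 0 j k "\<lambda>i. real (card (S i))"] jk
        by (simp add: Wcard lessThan_atLeast0)
      finally show ?thesis .
    qed
    have "c * real (card W) \<le> c * (\<Sum>a\<in>C'. real (card (V a)))"
      using le by (intro mult_left_mono) (auto simp: c_def)
    also have "\<dots> = (\<Sum>a\<in>C'. c * real (card (V a)))" by (rule sum_distrib_left)
    also have "\<dots> \<le> (\<Sum>a\<in>C'. real (card W) * ?wt a)" by (rule sum_mono) (rule Va)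
    also have "\<dots> = (\<Sum>a\<in>C'. ?wt a) * real (card W)" by (simp add: sum_distrib_left mult.commute)
    finally have "c \<le> (\<Sum>a\<in>C'. ?wt a)" using Wpos by simp
    then have "ennreal c \<le> ennreal (\<Sum>a\<in>C'. ?wt a)" by (rule ennreal_leI)
    also have "\<dots> = (\<Sum>a\<in>C'. ennreal (?wt a))"
      by (rule sum_ennreal[symmetric]) (simp add: ball_weight_def)
    also have "\<dots> \<le> (\<Sum>\<^sub>\<infinity>a\<in>C. ennreal (?wt a))"
      unfolding infsum_finite[OF C'(1), symmetric]
      by (rule infsum_mono_neutral) (use C' in \<open>auto intro: nonneg_summable_on_complete\<close>)
    finally show ?thesis by (simp add: case_prod_unfold)
  qed
  then have "ennreal c \<le> pressure_pre T ?F t \<psi> 1 \<epsilon>'"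
    unfolding pressure_pre_ball_weight by (intro INF_greatest)
  also have "\<dots> \<le> pressure_outer T ?F t \<psi> \<epsilon>'" by (rule pressure_pre_le_outer)
  finally show ?thesis by (rule less_le_trans[rotated]) (simp add: c_def)
qed

section \<open>Oscillating averages\<close>

text \<open>Blocks of lengths growing by the factor 4 alternate between the two values, so that at the end of
  each block this block makes up three quarters of the total length.\<close>

lemma ex_oscillating_sequence:
  "\<exists>\<rho> :: nat \<Rightarrow> bool. \<forall>N.
     (\<exists>k\<ge>N. 0 < k \<and> 3 * real k \<le> 4 * real (card {i. i < k \<and> \<rho> i})) \<and>
     (\<exists>k\<ge>N. 0 < k \<and> 4 * real (card {i. i < k \<and> \<rho> i}) \<le> real k)"
proof -
  define \<rho> where "\<rho> i = (\<exists>j. 4 ^ (2 * j) \<le> i \<and> i < 4 ^ (2 * j + 1))" for i :: nat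
  have "(\<exists>k\<ge>N. 0 < k \<and> 3 * real k \<le> 4 * real (card {i. i < k \<and> \<rho> i})) \<and>
     (\<exists>k\<ge>N. 0 < k \<and> 4 * real (card {i. i < k \<and> \<rho> i}) \<le> real k)" for N
  proof
    have "N < 4 ^ N" using less_exp[of N] power_mono[of 2 "4::nat" N] by linarith
    then have N: "N \<le> 4 ^ (2 * N + 1)" "N \<le> 4 ^ (2 * N + 2)"
      using power_increasing[of N "2 * N + 1" "4::nat"] power_increasing[of N "2 * N + 2" "4::nat"]
      by linarith+
    have "{4 ^ (2 * N)..<4 ^ (2 * N + 1)} \<subseteq> {i. i < 4 ^ (2 * N + 1) \<and> \<rho> i}"
      by (auto simp: \<rho>_def)
    then have "card {4 ^ (2 * N)..<4 ^ (2 * N + 1) :: nat} \<le> card {i. i < 4 ^ (2 * N + 1) \<and> \<rho> i}"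
      by (intro card_mono) auto
    then have "3 * 4 ^ (2 * N) \<le> card {i. i < 4 ^ (2 * N + 1) \<and> \<rho> i}" by simp
    then have "real (3 * 4 ^ (2 * N)) \<le> real (card {i. i < 4 ^ (2 * N + 1) \<and> \<rho> i})" by (rule of_nat_mono)
    then have "3 * real (4 ^ (2 * N + 1)) \<le> 4 * real (card {i. i < 4 ^ (2 * N + 1) \<and> \<rho> i})"
      by simp
    then show "\<exists>k\<ge>N. 0 < k \<and> 3 * real k \<le> 4 * real (card {i. i < k \<and> \<rho> i})"
      using N by (intro exI[of _ "4 ^ (2 * N + 1)"]) auto
    have "{i. i < 4 ^ (2 * N + 2) \<and> \<rho> i} \<subseteq> {..<4 ^ (2 * N + 1)}"
    proof clarsimp
      fix i assume i: "i < 16 * 4 ^ (2 * N)" "\<rho> i"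
      then obtain j where j: "4 ^ (2 * j) \<le> i" "i < 4 ^ (2 * j + 1)" unfolding \<rho>_def by blast
      have "(4::nat) ^ (2 * j) < 4 ^ (2 * N + 2)" using i(1) j(1) by simp
      then have "2 * j < 2 * N + 2" by (rule power_less_imp_less_exp[rotated]) simp
      then have "(4::nat) ^ (2 * j + 1) \<le> 4 ^ (2 * N + 1)" by (intro power_increasing) auto
      with j(2) have "i < 4 ^ (2 * N + 1)" by (rule less_le_trans)
      then show "i < 4 * 4 ^ (2 * N)" by simp
    qed
    then have "card {i. i < 4 ^ (2 * N + 2) \<and> \<rho> i} \<le> card {..<4 ^ (2 * N + 1) :: nat}"
      by (intro card_mono) auto
    then have "card {i. i < 4 ^ (2 * N + 2) \<and> \<rho> i} \<le> 4 ^ (2 * N + 1)" by simp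
    then have "real (card {i. i < 4 ^ (2 * N + 2) \<and> \<rho> i}) \<le> real (4 ^ (2 * N + 1))" by (rule of_nat_mono)
    then have "4 * real (card {i. i < 4 ^ (2 * N + 2) \<and> \<rho> i}) \<le> real (4 ^ (2 * N + 2))"
      by simp
    then show "\<exists>k\<ge>N. 0 < k \<and> 4 * real (card {i. i < k \<and> \<rho> i}) \<le> real k"
      using N by (intro exI[of _ "4 ^ (2 * N + 2)"]) auto
  qed
  then show ?thesis by blast
qed

text \<open>If the averages converged, then those at the times \<open>k * L\<close> would differ by little for
  large \<open>k\<close>; but up to the error \<open>e\<close> they are \<open>\<alpha> False + (\<alpha> True - \<alpha> False) * f k\<close> with \<open>f k\<close> the frequency of \<open>True\<close>,
  which oscillates by a half.\<close>

lemma irregular_setI: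
  fixes \<alpha> :: "bool \<Rightarrow> real"
  assumes L: "0 < L" and e: "8 * e < \<bar>\<alpha> True - \<alpha> False\<bar>"
    and osc: "\<And>N. \<exists>k\<ge>N. 0 < k \<and> 3 * real k \<le> 4 * real (card {i. i < k \<and> \<rho> i})"
      "\<And>N. \<exists>k\<ge>N. 0 < k \<and> 4 * real (card {i. i < k \<and> \<rho> i}) \<le> real k"
    and block: "\<And>i. \<bar>birkhoff_sum T L \<phi> ((T ^^ (i * L)) z) - real L * \<alpha> (\<rho> i)\<bar> \<le> real L * e"
  shows "z \<in> irregular_set \<phi> T"
  unfolding irregular_set_def
proof safe
  assume "convergent (\<lambda>n. birkhoff_sum T n \<phi> z / real n)"
  then obtain l where "(\<lambda>n. birkhoff_sum T n \<phi> z / real n) \<longlonglongrightarrow> l" by (auto simp: convergent_def)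
  then have lim: "(\<lambda>k. birkhoff_sum T (k * L) \<phi> z / real (k * L)) \<longlonglongrightarrow> l"
    by (rule filterlim_compose) (use L in \<open>auto intro!: filterlim_subseq strict_monoI\<close>)
  define d where "d = (\<bar>\<alpha> True - \<alpha> False\<bar> - 8 * e) / 8"
  have d: "0 < d" using e by (simp add: d_def)
  define f where "f k = real (card {i. i < k \<and> \<rho> i}) / real k" for k
  have avg: "\<bar>birkhoff_sum T (k * L) \<phi> z / real (k * L) - (\<alpha> False + (\<alpha> True - \<alpha> False) * f k)\<bar> \<le> e"
    if k: "0 < k" for k
  proof -
    have "(\<Sum>i<k. \<alpha> (\<rho> i)) = (\<Sum>i<k. \<alpha> False + (\<alpha> True - \<alpha> False) * of_bool (\<rho> i))"
      by (intro sum.cong) (auto simp: of_bool_def)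
    also have "\<dots> = real k * \<alpha> False + (\<alpha> True - \<alpha> False) * (\<Sum>i<k. of_bool (\<rho> i))"
      by (simp add: sum.distrib flip: sum_distrib_left)
    also have "(\<Sum>i<k. of_bool (\<rho> i)) = real (card {i. i < k \<and> \<rho> i})"
      by (simp add: of_bool_def sum.If_cases Int_def)
    finally have s: "(\<Sum>i<k. \<alpha> (\<rho> i)) = real k * (\<alpha> False + (\<alpha> True - \<alpha> False) * f k)"
      using k by (simp add: f_def distrib_left)
    have "\<bar>birkhoff_sum T (k * L) \<phi> z - real L * (\<Sum>i<k. \<alpha> (\<rho> i))\<bar>
        = \<bar>\<Sum>i<k. birkhoff_sum T L \<phi> ((T ^^ (i * L)) z) - real L * \<alpha> (\<rho> i)\<bar>"
      by (simp add: birkhoff_sum_mult sum_subtractf sum_distrib_left)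
    also have "\<dots> \<le> (\<Sum>i<k. \<bar>birkhoff_sum T L \<phi> ((T ^^ (i * L)) z) - real L * \<alpha> (\<rho> i)\<bar>)"
      by (rule sum_abs)
    also have "\<dots> \<le> (\<Sum>i<k. real L * e)" by (rule sum_mono) (rule block)
    also have "\<dots> = real (k * L) * e" by simp
    finally have "\<bar>birkhoff_sum T (k * L) \<phi> z - real (k * L) * (\<alpha> False + (\<alpha> True - \<alpha> False) * f k)\<bar>
        \<le> real (k * L) * e" unfolding s by (simp add: algebra_simps)
    moreover have kL: "0 < real (k * L)" using k L by simp
    moreover have "birkhoff_sum T (k * L) \<phi> z - real (k * L) * (\<alpha> False + (\<alpha> True - \<alpha> False) * f k)
      = real (k * L) * (birkhoff_sum T (k * L) \<phi> z / real (k * L) - (\<alpha> False + (\<alpha> True - \<alpha> False) * f k))"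
      using kL by (simp add: field_simps)
    ultimately show ?thesis by (metis abs_mult abs_of_pos mult_le_cancel_left_pos)
  qed
  from lim d obtain N where N: "\<And>k. N \<le> k \<Longrightarrow> \<bar>birkhoff_sum T (k * L) \<phi> z / real (k * L) - l\<bar> < d"
    unfolding LIMSEQ_iff by (metis real_norm_def)
  obtain k1 where k1: "N \<le> k1" "0 < k1" "3 * real k1 \<le> 4 * real (card {i. i < k1 \<and> \<rho> i})" using osc(1) by blast
  obtain k2 where k2: "N \<le> k2" "0 < k2" "4 * real (card {i. i < k2 \<and> \<rho> i}) \<le> real k2" using osc(2) by blast
  have "3 / 4 \<le> f k1" "f k2 \<le> 1 / 4" using k1 k2 by (auto simp: f_def field_simps)
  then have "\<bar>\<alpha> True - \<alpha> False\<bar> * (1 / 2) \<le> \<bar>\<alpha> True - \<alpha> False\<bar> * \<bar>f k1 - f k2\<bar>"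
    by (intro mult_left_mono) auto
  also have "\<dots> = \<bar>(\<alpha> True - \<alpha> False) * f k1 - (\<alpha> True - \<alpha> False) * f k2\<bar>"
    by (simp add: abs_mult flip: right_diff_distrib)
  also have "\<dots> \<le> 2 * e + 2 * d"
  proof -
    have "\<bar>u - v\<bar> \<le> 2 * e + 2 * d"
      if "\<bar>A - (a + u)\<bar> \<le> e" "\<bar>A' - (a + v)\<bar> \<le> e" "\<bar>A - l\<bar> < d" "\<bar>A' - l\<bar> < d" for A A' a u v :: real
      using that by linarith
    then show ?thesis using avg[OF k1(2)] avg[OF k2(2)] N[OF k1(1)] N[OF k2(1)] by blast
  qed
  finally have "\<bar>\<alpha> True - \<alpha> False\<bar> \<le> 0" by (simp add: d_def field_simps)
  moreover have "0 \<le> real L * e" using order_trans[OF abs_ge_zero block[of 0]] .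
  ultimately show False using e L by (simp add: zero_le_mult_iff)
qed

section \<open>Entropy of a partition\<close>

text \<open>Sum the inequality \<open>p * ln (q / p) \<le> q - p\<close>.\<close>

lemma gibbs_inequality:
  fixes p q :: "'i \<Rightarrow> real"
  assumes "finite I" and p: "\<And>i. i \<in> I \<Longrightarrow> 0 \<le> p i" and q: "\<And>i. i \<in> I \<Longrightarrow> 0 \<le> q i"
    and abs_cont: "\<And>i. i \<in> I \<Longrightarrow> 0 < p i \<Longrightarrow> 0 < q i" and le: "sum q I \<le> sum p I"
  shows "- (\<Sum>i\<in>I. p i * ln (p i)) \<le> - (\<Sum>i\<in>I. p i * ln (q i))"
proof -
  have "p i * ln (q i) - p i * ln (p i) \<le> q i - p i" if i: "i \<in> I" for i
  proof (cases "p i = 0")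
    case True
    then show ?thesis using q[OF i] by simp
  next
    case False
    with p[OF i] have pi: "0 < p i" by simp
    then have qi: "0 < q i" by (rule abs_cont[OF i])
    have "p i * ln (q i) - p i * ln (p i) = p i * ln (q i / p i)"
      using pi qi by (simp add: ln_div right_diff_distrib)
    also have "\<dots> \<le> p i * (q i / p i - 1)"
      using pi qi by (intro mult_left_mono ln_le_minus_one) auto
    also have "\<dots> = q i - p i" using pi by (simp add: field_simps)
    finally show ?thesis .
  qed
  then have "(\<Sum>i\<in>I. p i * ln (q i) - p i * ln (p i)) \<le> (\<Sum>i\<in>I. q i - p i)" by (rule sum_mono)
  then show ?thesis using le by (simp add: sum_subtractf)
qed

text \<open>Fekete's lemma: division with remainder by a near-optimal \<open>N\<close> bounds \<open>a n\<close> by at most \<open>n / N\<close> copies of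
  \<open>a N\<close> and one of finitely many remainders.\<close>

lemma subadditive_average_converges:
  fixes a :: "nat \<Rightarrow> real"
  assumes sub: "\<And>n m. a (n + m) \<le> a n + a m" and nn: "\<And>n. 0 \<le> a n"
  shows "(\<lambda>n. a n / real n) \<longlonglongrightarrow> (INF n\<in>{1..}. a n / real n)"
proof (rule LIMSEQ_I)
  let ?l = "INF n\<in>{1..}. a n / real n"
  have bdd: "bdd_below ((\<lambda>n. a n / real n) ` {1..})" by (rule bdd_belowI2[where m=0]) (use nn in auto)
  have mult: "a (k * N + r) \<le> real k * a N + a r" for k N r
  proof (induction k)
    case (Suc k)
    have "a (Suc k * N + r) = a (N + (k * N + r))" by (simp add: add.assoc)
    also have "\<dots> \<le> a N + a (k * N + r)" by (rule sub)
    finally show ?case using Suc by (simp add: algebra_simps)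
  qed simp
  fix e :: real assume e: "0 < e"
  obtain N where N: "1 \<le> N" "a N / real N < ?l + e / 2"
  proof -
    have "\<exists>n\<in>{1..}. a n / real n < ?l + e / 2"
      by (subst cINF_less_iff[OF _ bdd, symmetric]) (use e in auto)
    then show thesis using that by auto
  qed
  define M where "M = (\<Sum>r<N. a r)"
  obtain n0 :: nat where n0: "2 * M / e < real n0" using reals_Archimedean2 by blast
  show "\<exists>no. \<forall>n\<ge>no. norm (a n / real n - ?l) < e"
  proof (intro exI allI impI)
    fix n assume "Suc n0 \<le> n"
    then have n: "0 < n" "n0 \<le> n" by auto
    have lower: "?l \<le> a n / real n" by (rule cINF_lower[OF bdd]) (use n in auto)
    have "a n \<le> real (n div N) * a N + a (n mod N)" using mult[of "n div N" N "n mod N"] by simp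
    also have "a (n mod N) \<le> M" unfolding M_def
      by (rule member_le_sum) (use N nn in auto)
    also have "real (n div N) * a N \<le> (real n / real N) * a N"
      using nn[of N] by (intro mult_right_mono of_nat_div_le_of_nat)
    finally have "a n \<le> real n / real N * a N + M" by simp
    then have "a n / real n \<le> (real n / real N * a N + M) / real n" using n by (intro divide_right_mono) auto
    also have "\<dots> = a N / real N + M / real n" using n by (simp add: add_divide_distrib)
    also have "M / real n < e / 2"
    proof -
      have "2 * M / e < real n" using n0 n by (meson le_less_trans less_le_trans of_nat_mono)
      then show ?thesis using e n by (simp add: field_simps)
    qed
    finally show "norm (a n / real n - ?l) < e" using lower N(2) by (simp add: abs_less_iff)
  qed
qed

definition cell :: "'a set set \<Rightarrow> 'a \<Rightarrow> 'a set" where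
  "cell \<xi> x = (THE A. A \<in> \<xi> \<and> x \<in> A)"

definition itinerary :: "('a \<Rightarrow> 'a) \<Rightarrow> 'a set set \<Rightarrow> nat \<Rightarrow> 'a \<Rightarrow> 'a set list" where
  "itinerary T \<xi> n x = map (\<lambda>i. cell \<xi> ((T ^^ i) x)) [0..<n]"

definition words :: "'b set \<Rightarrow> nat \<Rightarrow> 'b list set" where
  "words V n = {w. set w \<subseteq> V \<and> length w = n}"

text \<open>Itineraries are lists of cells, so that joining partitions becomes concatenation. The cells of the
  iterated partition are the cylinders of words; distinct words of equal length share a cylinder only when it is empty,
  which does not affect the entropy.\<close>

definition cylinder :: "('a \<Rightarrow> 'a) \<Rightarrow> 'a set set \<Rightarrow> 'a set list \<Rightarrow> 'a set" where
  "cylinder T \<xi> w = {x. itinerary T \<xi> (length w) x = w}"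

lemma length_itinerary [simp]: "length (itinerary T \<xi> n x) = n"
  by (simp add: itinerary_def)

lemma finite_words: "finite V \<Longrightarrow> finite (words V n)"
  unfolding words_def by (rule finite_lists_length_eq)

lemma card_words: "finite V \<Longrightarrow> card (words V n) = card V ^ n"
  unfolding words_def by (rule card_lists_length_eq)

lemma words_append: "words V (n + m) = (\<lambda>(u, v). u @ v) ` (words V n \<times> words V m)"
proof (intro equalityI subsetI)
  fix w assume "w \<in> words V (n + m)"
  then have "w = take n w @ drop n w" "take n w \<in> words V n" "drop n w \<in> words V m"
    by (auto simp: words_def dest: in_set_takeD in_set_dropD)
  then show "w \<in> (\<lambda>(u, v). u @ v) ` (words V n \<times> words V m)"
    by (intro image_eqI[of _ _ "(take n w, drop n w)"]) auto
qed (auto simp: words_def)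

lemma sum_words_append:
  "(\<Sum>w\<in>words V (n + m). f w) = (\<Sum>u\<in>words V n. \<Sum>v\<in>words V m. f (u @ v))"
proof -
  have "inj_on (\<lambda>(u, v). u @ v) (words V n \<times> words V m)"
    by (auto simp: inj_on_def words_def)
  then show ?thesis
    unfolding words_append by (simp add: sum.reindex sum.cartesian_product case_prod_unfold)
qed

locale invariant_partition =
  fixes T :: "'a::metric_space \<Rightarrow> 'a" and \<mu> :: "'a measure" and \<xi> :: "'a set set"
  assumes inv: "invariant_prob T \<mu>" and T: "continuous_on UNIV T"
    and fin: "finite \<xi>" and meas: "\<xi> \<subseteq> sets \<mu>" and part: "partition_on UNIV \<xi>"
begin

sublocale prob_space \<mu> using inv by (simp add: invariant_prob_def)

lemma sp: "space \<mu> = UNIV" by (rule invariant_prob_space[OF inv])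

lemma cell_unique: "\<exists>!A. A \<in> \<xi> \<and> x \<in> A"
  using part unfolding partition_on_def disjoint_def by blast

lemma cell_in: "cell \<xi> x \<in> \<xi>" and mem_cell: "x \<in> cell \<xi> x"
  using theI'[OF cell_unique[of x]] unfolding cell_def by auto

lemma cell_eq_iff: "A \<in> \<xi> \<Longrightarrow> cell \<xi> x = A \<longleftrightarrow> x \<in> A"
  using cell_unique[of x] cell_in[of x] mem_cell[of x] by blast

lemma itinerary_in_words: "itinerary T \<xi> n x \<in> words \<xi> n"
  by (auto simp: itinerary_def words_def cell_in)

lemma itinerary_eq_iff:
  assumes "w \<in> words \<xi> n"
  shows "itinerary T \<xi> n x = w \<longleftrightarrow> (\<forall>i<n. (T ^^ i) x \<in> w ! i)"
proof -
  have "w ! i \<in> \<xi>" if "i < n" for i using assms that by (auto simp: words_def)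
  then show ?thesis
    using assms by (auto simp: itinerary_def list_eq_iff_nth_eq words_def cell_eq_iff)
qed

lemma itinerary_append:
  "itinerary T \<xi> (n + m) x = itinerary T \<xi> n x @ itinerary T \<xi> m ((T ^^ n) x)"
proof -
  have "(T ^^ (i - n)) ((T ^^ n) x) = (T ^^ i) x" if "\<not> i < n" for i
    using that funpow_add[of "i - n" n T] by simp
  then show ?thesis by (intro nth_equalityI) (auto simp: itinerary_def nth_append)
qed

lemma cylinder_eq:
  assumes "w \<in> words \<xi> n"
  shows "cylinder T \<xi> w = (\<Inter>i<n. (T ^^ i) -` (w ! i))"
  using assms itinerary_eq_iff[OF assms] by (auto simp: cylinder_def words_def)

lemma cylinder_append:
  assumes "u \<in> words \<xi> n" "v \<in> words \<xi> m"
  shows "cylinder T \<xi> (u @ v) = cylinder T \<xi> u \<inter> (T ^^ n) -` cylinder T \<xi> v"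
  using assms itinerary_append[of n m] by (auto simp: cylinder_def words_def)

lemma cylinder_measurable:
  assumes "w \<in> words \<xi> n"
  shows "cylinder T \<xi> w \<in> sets \<mu>"
proof (cases "n = 0")
  case True
  then show ?thesis using cylinder_eq[OF assms] sets.top[of \<mu>] by (simp add: sp)
next
  case False
  have "(T ^^ i) -` (w ! i) \<in> sets \<mu>" if "i < n" for i
  proof -
    have "w ! i \<in> \<xi>" using assms that by (auto simp: words_def)
    then have "w ! i \<in> sets \<mu>" using meas by blast
    from measurable_sets[OF invariant_prob_measurable_funpow[OF inv T] this]
    show ?thesis by (simp add: sp)
  qed
  then show ?thesis unfolding cylinder_eq[OF assms] using False by (intro sets.finite_INT) auto
qed

lemma measure_eq_sum_cylinders:
  assumes E: "E \<in> sets \<mu>"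
  shows "measure \<mu> E = (\<Sum>w\<in>words \<xi> n. measure \<mu> (E \<inter> cylinder T \<xi> w))"
proof -
  have "E = (\<Union>w\<in>words \<xi> n. E \<inter> cylinder T \<xi> w)"
  proof (intro equalityI subsetI)
    fix x assume "x \<in> E"
    then show "x \<in> (\<Union>w\<in>words \<xi> n. E \<inter> cylinder T \<xi> w)"
      using itinerary_in_words[of n x]
      by (intro UN_I[of "itinerary T \<xi> n x"]) (auto simp: cylinder_def itinerary_def)
  qed auto
  moreover have "measure \<mu> (\<Union>w\<in>words \<xi> n. E \<inter> cylinder T \<xi> w)
      = (\<Sum>w\<in>words \<xi> n. measure \<mu> (E \<inter> cylinder T \<xi> w))"
  proof (rule finite_measure_finite_Union[OF finite_words[OF fin]])
    show "(\<lambda>w. E \<inter> cylinder T \<xi> w) ` words \<xi> n \<subseteq> sets \<mu>"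
      using E cylinder_measurable by auto
    show "disjoint_family_on (\<lambda>w. E \<inter> cylinder T \<xi> w) (words \<xi> n)"
      by (auto simp: disjoint_family_on_def cylinder_def words_def)
  qed
  ultimately show ?thesis by simp
qed

lemma sum_measure_cylinders: "(\<Sum>w\<in>words \<xi> n. measure \<mu> (cylinder T \<xi> w)) = 1"
  using measure_eq_sum_cylinders[of UNIV n] sets.top[of \<mu>] prob_space by (simp add: sp)

lemma partition_entropy_join:
  "partition_entropy \<mu> (iterated_join T n \<xi>)
   = - (\<Sum>w\<in>words \<xi> n. measure \<mu> (cylinder T \<xi> w) * ln (measure \<mu> (cylinder T \<xi> w)))"
proof -
  have "iterated_join T n \<xi> = cylinder T \<xi> ` words \<xi> n"
  proof (intro equalityI subsetI)
    fix B assume "B \<in> iterated_join T n \<xi>"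
    then obtain A where A: "B = (\<Inter>i<n. (T ^^ i) -` A i)" "\<forall>i<n. A i \<in> \<xi>"
      unfolding iterated_join_def by blast
    have w: "map A [0..<n] \<in> words \<xi> n" using A(2) by (auto simp: words_def)
    show "B \<in> cylinder T \<xi> ` words \<xi> n"
      by (rule image_eqI[OF _ w]) (auto simp: cylinder_eq[OF w] A(1))
  next
    fix B assume "B \<in> cylinder T \<xi> ` words \<xi> n"
    then obtain w where w: "w \<in> words \<xi> n" "B = cylinder T \<xi> w" by blast
    have "\<forall>i<n. w ! i \<in> \<xi>" using w(1) by (auto simp: words_def)
    then show "B \<in> iterated_join T n \<xi>"
      unfolding iterated_join_def w(2) cylinder_eq[OF w(1)] by blast
  qed
  moreover have "(\<Sum>A\<in>cylinder T \<xi> ` words \<xi> n. measure \<mu> A * ln (measure \<mu> A))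
      = (\<Sum>w\<in>words \<xi> n. measure \<mu> (cylinder T \<xi> w) * ln (measure \<mu> (cylinder T \<xi> w)))"
  proof (subst sum.reindex_nontrivial[OF finite_words[OF fin]])
    fix u v assume "u \<in> words \<xi> n" "v \<in> words \<xi> n" "u \<noteq> v" "cylinder T \<xi> u = cylinder T \<xi> v"
    then have "cylinder T \<xi> u = {}" by (auto simp: cylinder_def words_def)
    then show "measure \<mu> (cylinder T \<xi> u) * ln (measure \<mu> (cylinder T \<xi> u)) = 0" by simp
  qed simp
  ultimately show ?thesis by (simp add: partition_entropy_def)
qed

lemma partition_entropy_join_nonneg: "0 \<le> partition_entropy \<mu> (iterated_join T n \<xi>)"
proof -
  have "(\<Sum>w\<in>words \<xi> n. measure \<mu> (cylinder T \<xi> w) * ln (measure \<mu> (cylinder T \<xi> w))) \<le> 0"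
    by (intro sum_nonpos mult_nonneg_nonpos measure_nonneg) (metis ln_le_zero_iff ln_0 order_refl prob_le_1 zero_less_measure_iff)
  then show ?thesis by (simp add: partition_entropy_join)
qed

text \<open>Gibbs' inequality, comparing the joint distribution of the first \<open>n\<close> and the following \<open>m\<close> cells with the
  product of its marginals; by invariance the second marginal is the distribution of the first \<open>m\<close> cells.\<close>

lemma partition_entropy_join_subadditive:
  "partition_entropy \<mu> (iterated_join T (n + m) \<xi>)
   \<le> partition_entropy \<mu> (iterated_join T n \<xi>) + partition_entropy \<mu> (iterated_join T m \<xi>)"
proof -
  let ?p = "\<lambda>w. measure \<mu> (cylinder T \<xi> w)"
  let ?I = "words \<xi> n \<times> words \<xi> m"
  let ?q = "\<lambda>(u, v). ?p u * ?p v"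
  have app: "?p (u @ v) = measure \<mu> (cylinder T \<xi> u \<inter> (T ^^ n) -` cylinder T \<xi> v)"
    if "u \<in> words \<xi> n" "v \<in> words \<xi> m" for u v
    using cylinder_append[OF that] by simp
  have pre: "(T ^^ n) -` cylinder T \<xi> v \<in> sets \<mu>" if "v \<in> words \<xi> m" for v
    using measurable_sets[OF invariant_prob_measurable_funpow[OF inv T] cylinder_measurable[OF that]]
    by (simp add: sp)
  have mu: "(\<Sum>v\<in>words \<xi> m. ?p (u @ v)) = ?p u" if u: "u \<in> words \<xi> n" for u
  proof -
    have "(\<Sum>v\<in>words \<xi> m. ?p (u @ v)) = measure \<mu> (\<Union>v\<in>words \<xi> m. cylinder T \<xi> (u @ v))"
    proof (rule finite_measure_finite_Union[OF finite_words[OF fin], symmetric])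
      show "(\<lambda>v. cylinder T \<xi> (u @ v)) ` words \<xi> m \<subseteq> sets \<mu>"
        using u cylinder_measurable[of _ "n + m"] by (auto simp: words_def)
      show "disjoint_family_on (\<lambda>v. cylinder T \<xi> (u @ v)) (words \<xi> m)"
        by (auto simp: disjoint_family_on_def cylinder_def words_def)
    qed
    also have "(\<Union>v\<in>words \<xi> m. cylinder T \<xi> (u @ v)) = cylinder T \<xi> u"
    proof (intro equalityI subsetI)
      fix x assume "x \<in> cylinder T \<xi> u"
      then show "x \<in> (\<Union>v\<in>words \<xi> m. cylinder T \<xi> (u @ v))"
        using u itinerary_in_words[of m "(T ^^ n) x"]
        by (intro UN_I[of "itinerary T \<xi> m ((T ^^ n) x)"])
          (auto simp: cylinder_def words_def itinerary_append)
    qed (use cylinder_append[OF u] in auto)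
    finally show ?thesis .
  qed
  have mv: "(\<Sum>u\<in>words \<xi> n. ?p (u @ v)) = ?p v" if v: "v \<in> words \<xi> m" for v
  proof -
    have "(\<Sum>u\<in>words \<xi> n. ?p (u @ v)) = (\<Sum>u\<in>words \<xi> n. measure \<mu> ((T ^^ n) -` cylinder T \<xi> v \<inter> cylinder T \<xi> u))"
      by (intro sum.cong) (auto simp: app v Int_commute)
    also have "\<dots> = measure \<mu> ((T ^^ n) -` cylinder T \<xi> v)"
      by (rule measure_eq_sum_cylinders[OF pre[OF v], symmetric])
    also have "\<dots> = ?p v" by (rule measure_funpow_vimage[OF inv T cylinder_measurable[OF v]])
    finally show ?thesis .
  qed
  have finI: "finite ?I" using finite_words[OF fin] by auto
  have q1: "sum ?q ?I = 1"
    by (simp add: sum_measure_cylinders flip: sum.cartesian_product sum_distrib_left)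
  have p1: "(\<Sum>(u, v)\<in>?I. ?p (u @ v)) = 1"
    using mu sum_measure_cylinders[of n] by (simp add: sum.cartesian_product[symmetric])
  have le: "?p (u @ v) \<le> ?p u \<and> ?p (u @ v) \<le> ?p v" if "u \<in> words \<xi> n" "v \<in> words \<xi> m" for u v
  proof
    show "?p (u @ v) \<le> ?p u" unfolding mu[OF that(1), symmetric]
      by (rule member_le_sum) (use that finite_words[OF fin] in auto)
    show "?p (u @ v) \<le> ?p v" unfolding mv[OF that(2), symmetric]
      by (rule member_le_sum[of u _ "\<lambda>u. ?p (u @ v)"]) (use that finite_words[OF fin] in auto)
  qed
  have "partition_entropy \<mu> (iterated_join T (n + m) \<xi>) = - (\<Sum>i\<in>?I. ?p (fst i @ snd i) * ln (?p (fst i @ snd i)))"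
    by (simp add: partition_entropy_join sum_words_append sum.cartesian_product case_prod_unfold)
  also have "\<dots> \<le> - (\<Sum>i\<in>?I. ?p (fst i @ snd i) * ln (?q i))"
  proof (rule gibbs_inequality[OF finI])
    fix i assume "i \<in> ?I" "0 < ?p (fst i @ snd i)"
    then show "0 < ?q i" using le[of "fst i" "snd i"] by (auto simp: case_prod_unfold intro!: mult_pos_pos)
  next
    show "sum ?q ?I \<le> (\<Sum>i\<in>?I. ?p (fst i @ snd i))"
      using p1 q1 by (simp add: case_prod_unfold)
  qed (auto simp: case_prod_unfold)
  also have "(\<Sum>i\<in>?I. ?p (fst i @ snd i) * ln (?q i))
      = (\<Sum>i\<in>?I. ?p (fst i @ snd i) * ln (?p (fst i)) + ?p (fst i @ snd i) * ln (?p (snd i)))"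
  proof (rule sum.cong[OF refl])
    fix i assume i: "i \<in> ?I"
    obtain u v where uv: "i = (u, v)" by (cases i)
    show "?p (fst i @ snd i) * ln (?q i) = ?p (fst i @ snd i) * ln (?p (fst i)) + ?p (fst i @ snd i) * ln (?p (snd i))"
    proof (cases "?p (u @ v) = 0")
      case False
      then have "0 < ?p (u @ v)" by (simp add: zero_less_measure_iff)
      then have "0 < ?p u" "0 < ?p v" using le[of u v] i uv by auto
      then show ?thesis by (simp add: uv ln_mult distrib_left)
    qed (simp add: uv)
  qed
  also have "\<dots> = (\<Sum>u\<in>words \<xi> n. \<Sum>v\<in>words \<xi> m. ?p (u @ v) * ln (?p u))
      + (\<Sum>u\<in>words \<xi> n. \<Sum>v\<in>words \<xi> m. ?p (u @ v) * ln (?p v))"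
    by (simp add: sum.distrib sum.cartesian_product case_prod_unfold)
  also have "(\<Sum>u\<in>words \<xi> n. \<Sum>v\<in>words \<xi> m. ?p (u @ v) * ln (?p v))
      = (\<Sum>v\<in>words \<xi> m. \<Sum>u\<in>words \<xi> n. ?p (u @ v) * ln (?p v))" by (rule sum.swap)
  finally show ?thesis
    using mu mv by (simp add: partition_entropy_join flip: sum_distrib_right)
qed

lemma entropy_wrt_partition_le:
  "real n * entropy_wrt_partition T \<mu> \<xi> \<le> partition_entropy \<mu> (iterated_join T n \<xi>)"
proof (cases "n = 0")
  case True
  then show ?thesis using partition_entropy_join_nonneg[of 0] by simp
next
  case False
  let ?a = "\<lambda>n. partition_entropy \<mu> (iterated_join T n \<xi>)"
  have "entropy_wrt_partition T \<mu> \<xi> = (INF n\<in>{1..}. ?a n / real n)"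
    unfolding entropy_wrt_partition_def
    by (intro limI subadditive_average_converges partition_entropy_join_subadditive
        partition_entropy_join_nonneg)
  also have "\<dots> \<le> ?a n / real n"
    by (rule cINF_lower) (use False partition_entropy_join_nonneg in \<open>auto intro!: bdd_belowI2[where m=0]\<close>)
  finally show ?thesis using False by (simp add: field_simps)
qed

lemma card_partition_pos: "0 < card \<xi>"
  using cell_in fin by (auto simp: card_gt_0_iff)

text \<open>Fano's inequality, again from Gibbs' inequality: compare with weights that spread one half
  evenly over \<open>G\<close> and at most another half evenly over the remaining words. As \<open>\<kappa>\<close> can be made small against the number of cells, the
  entropy is essentially bounded by \<open>ln |G|\<close>.\<close>

lemma entropy_le_log_card:
  assumes G: "G \<subseteq> words \<xi> n" and ne: "G \<noteq> {}"
    and large: "1 - \<kappa> \<le> (\<Sum>w\<in>G. measure \<mu> (cylinder T \<xi> w))"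
  shows "partition_entropy \<mu> (iterated_join T n \<xi>)
     \<le> ln 2 + ln (real (card G)) + \<kappa> * (real n * ln (real (card \<xi>)))"
proof -
  let ?p = "\<lambda>w. measure \<mu> (cylinder T \<xi> w)" and ?W = "words \<xi> n"
  have finW: "finite ?W" by (rule finite_words[OF fin])
  have finG: "finite G" by (rule finite_subset[OF G finW])
  have cG: "1 \<le> card G" using ne finG by (simp add: Suc_le_eq card_gt_0_iff)
  have cW: "card ?W = card \<xi> ^ n" by (rule card_words[OF fin])
  define q where "q w = (if w \<in> G then 1 / (2 * real (card G)) else 1 / (2 * real (card ?W)))" for w
  have Wpos: "0 < card ?W" using card_partition_pos by (simp add: cW)
  have "sum q ?W = sum q G + sum q (?W - G)"
    using sum.subset_diff[OF G finW, of q] by simp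
  also have "sum q G = 1 / 2" using cG by (simp add: q_def)
  also have "sum q (?W - G) = real (card (?W - G)) / (2 * real (card ?W))"
    by (simp add: q_def)
  also have "\<dots> \<le> 1 / 2"
    using Wpos card_mono[OF finW, of "?W - G"] by (simp add: field_simps)
  finally have q1: "sum q ?W \<le> sum ?p ?W" by (simp add: sum_measure_cylinders)
  have "partition_entropy \<mu> (iterated_join T n \<xi>) \<le> - (\<Sum>w\<in>?W. ?p w * ln (q w))"
    unfolding partition_entropy_join
    by (rule gibbs_inequality[OF finW]) (use q1 cG Wpos in \<open>auto simp: q_def\<close>)
  also have "\<dots> = (\<Sum>w\<in>?W. ?p w * - ln (q w))" by (simp add: sum_negf)
  also have "\<dots> = (\<Sum>w\<in>G. ?p w * - ln (q w)) + (\<Sum>w\<in>?W - G. ?p w * - ln (q w))"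
    using sum.subset_diff[OF G finW, of "\<lambda>w. ?p w * - ln (q w)"] by simp
  also have "(\<Sum>w\<in>G. ?p w * - ln (q w)) = sum ?p G * (ln 2 + ln (real (card G)))"
    using cG by (simp add: q_def ln_div ln_mult sum_distrib_right add.commute)
  also have "(\<Sum>w\<in>?W - G. ?p w * - ln (q w)) = sum ?p (?W - G) * (ln 2 + real n * ln (real (card \<xi>)))"
    using Wpos card_partition_pos by (simp add: q_def ln_div ln_mult sum_distrib_right cW ln_realpow add.commute)
  also have "sum ?p (?W - G) = 1 - sum ?p G"
    using sum.subset_diff[OF G finW, of ?p] by (simp add: sum_measure_cylinders)
  also have "sum ?p G * (ln 2 + ln (real (card G))) + (1 - sum ?p G) * (ln 2 + real n * ln (real (card \<xi>)))
      = ln 2 + sum ?p G * ln (real (card G)) + (1 - sum ?p G) * (real n * ln (real (card \<xi>)))"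
    by (simp add: algebra_simps)
  also have "\<dots> \<le> ln 2 + 1 * ln (real (card G)) + \<kappa> * (real n * ln (real (card \<xi>)))"
  proof (intro add_mono mult_right_mono order_refl)
    have "sum ?p G \<le> sum ?p ?W" by (rule sum_mono2[OF finW G]) auto
    then show "sum ?p G \<le> 1" by (simp add: sum_measure_cylinders)
    show "0 \<le> real n * ln (real (card \<xi>))" using card_partition_pos by (intro mult_nonneg_nonneg ln_ge_zero) auto
  qed (use cG large in auto)
  finally show ?thesis by simp
qed

end

section \<open>Hamming balls\<close>

fun hamming :: "'b list \<Rightarrow> 'b list \<Rightarrow> nat" where
  "hamming (x # xs) (y # ys) = (if x = y then 0 else 1) + hamming xs ys"
| "hamming _ _ = 0"

lemma hamming_eq_card:
  "length xs = length ys \<Longrightarrow> hamming xs ys = card {i. i < length xs \<and> xs ! i \<noteq> ys ! i}"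
proof (induction xs ys rule: list_induct2)
  case (Cons x xs y ys)
  have "{i. i < length (x # xs) \<and> (x # xs) ! i \<noteq> (y # ys) ! i}
      = (if x = y then {} else {0}) \<union> Suc ` {i. i < length xs \<and> xs ! i \<noteq> ys ! i}"
    by (auto simp: less_Suc_eq_0_disj)
  then show ?case using Cons by (simp add: card_image)
qed simp

text \<open>The left side is the generating function of the Hamming distance from \<open>xs\<close>. It factors over the
  letters, each factor being \<open>1 + (card V - 1) * t\<close> when the letter belongs to \<open>V\<close>.\<close>

lemma sum_power_hamming_le:
  assumes V: "finite V" and t: "0 \<le> (t::real)"
  shows "(\<Sum>ys\<in>words V (length xs). t ^ hamming xs ys) \<le> (1 + real (card V) * t) ^ length xs"
proof (induction xs)
  case Nil
  have "words V 0 = {[]}" by (auto simp: words_def)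
  then show ?case by simp
next
  case (Cons x xs)
  have "words V (Suc n) = (\<lambda>(y, ys). y # ys) ` (V \<times> words V n)" for n
    by (force simp: words_def length_Suc_conv image_iff)
  then have "(\<Sum>ys\<in>words V (length (x # xs)). t ^ hamming (x # xs) ys)
      = (\<Sum>(y, ys)\<in>V \<times> words V (length xs). t ^ hamming (x # xs) (y # ys))"
    by (simp add: sum.reindex inj_on_def case_prod_unfold)
  also have "\<dots> = (\<Sum>y\<in>V. t ^ (if x = y then 0 else 1)) * (\<Sum>ys\<in>words V (length xs). t ^ hamming xs ys)"
    by (simp add: sum_product power_add flip: sum.cartesian_product)
  also have "\<dots> \<le> (1 + real (card V) * t) * (1 + real (card V) * t) ^ length xs"
  proof (intro mult_mono Cons.IH)
    have "(\<Sum>y\<in>V. t ^ (if x = y then 0 else 1)) \<le> (\<Sum>y\<in>V. of_bool (x = y) + t)"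
      by (rule sum_mono) (use t in auto)
    also have "\<dots> = (\<Sum>y\<in>V. of_bool (x = y)) + real (card V) * t" by (simp add: sum.distrib)
    also have "(\<Sum>y\<in>V. of_bool (x = y) :: real) \<le> 1"
      using V by (simp add: of_bool_def sum.delta')
    finally show "(\<Sum>y\<in>V. t ^ (if x = y then 0 else 1)) \<le> 1 + real (card V) * t" by simp
  qed (use t in \<open>auto intro!: sum_nonneg\<close>)
  finally show ?case by simp
qed

text \<open>Every word in the ball has weight at least \<open>t\<close> to the power \<open>r\<close> in the generating function. Choosing \<open>t\<close>
  and then \<open>r\<close> small makes the exponential rate arbitrarily small.\<close>

lemma card_hamming_ball_le:
  assumes V: "finite V" and t: "0 < t" "t \<le> 1" and r: "0 \<le> r"
  shows "real (card {ys \<in> words V (length xs). real (hamming xs ys) \<le> r})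
      \<le> exp (real (length xs) * (real (card V) * t) + r * ln (1 / t))"
proof -
  let ?B = "{ys \<in> words V (length xs). real (hamming xs ys) \<le> r}"
  have "real (card ?B) * t powr r = (\<Sum>ys\<in>?B. t powr r)" by simp
  also have "\<dots> \<le> (\<Sum>ys\<in>?B. t ^ hamming xs ys)"
  proof (rule sum_mono)
    fix ys assume "ys \<in> ?B"
    then have "t powr r \<le> t powr real (hamming xs ys)" using t by (intro powr_mono') auto
    then show "t powr r \<le> t ^ hamming xs ys" using t by (simp add: powr_realpow)
  qed
  also have "\<dots> \<le> (\<Sum>ys\<in>words V (length xs). t ^ hamming xs ys)"
    by (rule sum_mono2) (use t finite_words[OF V] in auto)
  also have "\<dots> \<le> (1 + real (card V) * t) ^ length xs"
    by (rule sum_power_hamming_le[OF V]) (use t in simp)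
  also have "\<dots> \<le> exp (real (card V) * t) ^ length xs"
    by (rule power_mono) (use t in \<open>auto intro: exp_ge_add_one_self\<close>)
  also have "\<dots> = exp (real (length xs) * (real (card V) * t))" by (simp add: exp_of_nat_mult)
  finally have "real (card ?B) \<le> exp (real (length xs) * (real (card V) * t)) / t powr r"
    using t by (simp add: field_simps)
  also have "1 / t powr r = exp (r * ln (1 / t))"
    using t by (simp add: powr_def ln_div exp_minus field_simps)
  then have "exp (real (length xs) * (real (card V) * t)) / t powr r
      = exp (real (length xs) * (real (card V) * t)) * exp (r * ln (1 / t))"
    by (metis divide_inverse_commute inverse_eq_divide mult.commute)
  finally show ?thesis by (simp add: exp_add)
qed

section \<open>Closed approximation of Borel sets\<close>

lemma open_closed_approximation:
  fixes \<mu> :: "'a::metric_space measure"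
  assumes \<mu>: "finite_measure \<mu>" "sets \<mu> = sets borel" and A: "open A" and e: "0 < e"
  shows "\<exists>C. closed C \<and> C \<subseteq> A \<and> measure \<mu> (A - C) < e"
proof (cases "A = UNIV")
  case True
  then show ?thesis using e by (intro exI[of _ UNIV]) auto
next
  case False
  interpret finite_measure \<mu> by fact
  define C where "C n = {x. 1 / real (Suc n) \<le> infdist x (- A)}" for n
  have cl: "closed (C n)" for n
    unfolding C_def by (intro closed_Collect_le continuous_intros)
  have sub: "C n \<subseteq> A" for n
  proof
    fix x assume "x \<in> C n"
    then have "infdist x (- A) \<noteq> 0" by (auto simp: C_def)
    then show "x \<in> A" using infdist_zero[of x "- A"] by (metis ComplI)
  qed
  have dec: "decseq (\<lambda>n. A - C n)"
  proof (rule decseq_SucI)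
    fix n
    have "1 / real (Suc (Suc n)) \<le> 1 / real (Suc n)" by (simp add: field_simps)
    then show "A - C (Suc n) \<subseteq> A - C n" unfolding C_def by fastforce
  qed
  have "(\<Inter>n. A - C n) = {}"
  proof (rule equals0I)
    fix x assume x: "x \<in> (\<Inter>n. A - C n)"
    then have "x \<notin> - A" by auto
    then have "0 < infdist x (- A)"
      by (intro infdist_pos_not_in_closed closed_Compl A) (use False in auto)
    then obtain n where "1 / real (Suc n) < infdist x (- A)"
      using reals_Archimedean[of "infdist x (- A)"] by (auto simp: inverse_eq_divide)
    then have "x \<in> C n" by (simp add: C_def)
    then show False using x by auto
  qed
  moreover have m: "A - C n \<in> sets \<mu>" for n using A cl[of n] \<mu> by (simp add: sets.Diff)
  have "(\<lambda>n. measure \<mu> (A - C n)) \<longlonglongrightarrow> measure \<mu> (\<Inter>n. A - C n)"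
    by (rule finite_Lim_measure_decseq[OF _ dec]) (use m in blast)
  ultimately have "(\<lambda>n. measure \<mu> (A - C n)) \<longlonglongrightarrow> 0" by (simp only: measure_empty)
  then have "\<forall>\<^sub>F n in sequentially. measure \<mu> (A - C n) < e" using e by (rule order_tendstoD)
  then obtain n where "measure \<mu> (A - C n) < e" by (auto simp: eventually_sequentially)
  then show ?thesis using cl sub by blast
qed

text \<open>The sets with such approximations form a \<sigma>-algebra containing the open sets. Asking for an open
  superset as well is what makes the class closed under complements.\<close>

lemma borel_closed_open_approximation:
  fixes \<mu> :: "'a::metric_space measure"
  assumes \<mu>: "finite_measure \<mu>" "sets \<mu> = sets borel" and A: "A \<in> sets \<mu>" and e: "0 < e"
  shows "\<exists>C U. closed C \<and> open U \<and> C \<subseteq> A \<and> A \<subseteq> U \<and> measure \<mu> (U - C) < e"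
proof -
  interpret finite_measure \<mu> by fact
  have msets: "U - C \<in> sets \<mu>" if "open U" "closed C" for U C using that \<mu> by (auto intro: sets.Diff)
  have "A \<in> sigma_sets UNIV {S. open S}" using A \<mu> by (simp add: sets_borel)
  then show ?thesis using e
  proof (induction arbitrary: e rule: sigma_sets.induct)
    case (Basic A)
    then have "open A" by simp
    moreover from open_closed_approximation[OF \<mu> this Basic(2)]
    obtain C where "closed C" "C \<subseteq> A" "measure \<mu> (A - C) < e" by (elim exE conjE)
    ultimately show ?case by (intro exI[of _ C] exI[of _ A]) auto
  next
    case Empty
    then show ?case by (intro exI[of _ "{}"]) auto
  next
    case (Compl A)
    obtain C U where "closed C" "open U" "C \<subseteq> A" "A \<subseteq> U" "measure \<mu> (U - C) < e"
      using Compl.IH[OF Compl.prems] by (elim exE conjE)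
    moreover have "- C - - U = U - C" by auto
    ultimately show ?case by (intro exI[of _ "- U"] exI[of _ "- C"]) auto
  next
    case (Union A)
    have "\<exists>C U. closed C \<and> open U \<and> C \<subseteq> A i \<and> A i \<subseteq> U \<and> measure \<mu> (U - C) < e / 4 * (1 / 2) ^ i" for i
      by (rule Union.IH) (use Union.prems in simp)
    then obtain C U where CU: "\<And>i. closed (C i)" "\<And>i. open (U i)" "\<And>i. C i \<subseteq> A i" "\<And>i. A i \<subseteq> U i"
        "\<And>i. measure \<mu> (U i - C i) < e / 4 * (1 / 2) ^ i"
      by metis
    let ?U = "\<Union>i. U i" and ?C = "\<lambda>n. \<Union>i\<in>{..<n}. C i"
    have oU: "open ?U" and cC: "closed (?C n)" for n using CU by auto
    have geo: "(\<lambda>i. e / 4 * (1 / 2) ^ i) sums (e / 2)"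
      using sums_mult[OF geometric_sums[of "1 / 2 :: real"], of "e / 4"] by simp
    have summ: "summable (\<lambda>i. measure \<mu> (U i - C i))"
      by (rule summable_comparison_test'[OF sums_summable[OF geo], of 0]) (use CU(5) in \<open>auto intro: less_imp_le\<close>)
    have "measure \<mu> (\<Union>i. U i - C i) \<le> (\<Sum>i. measure \<mu> (U i - C i))"
      by (rule finite_measure_subadditive_countably[OF _ summ]) (use msets CU in auto)
    also have "\<dots> \<le> (\<Sum>i. e / 4 * (1 / 2) ^ i)"
      by (rule suminf_le[OF _ summ sums_summable[OF geo]]) (use CU(5) in \<open>auto intro: less_imp_le\<close>)
    also have "\<dots> = e / 2" by (rule sums_unique[OF geo, symmetric])
    finally have half: "measure \<mu> (\<Union>i. U i - C i) \<le> e / 2" .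
    have "measure \<mu> (\<Inter>n. ?U - ?C n) \<le> measure \<mu> (\<Union>i. U i - C i)"
    proof (rule finite_measure_mono)
      show "(\<Inter>n. ?U - ?C n) \<subseteq> (\<Union>i. U i - C i)"
      proof
        fix x assume x: "x \<in> (\<Inter>n. ?U - ?C n)"
        then obtain i where "x \<in> U i" by blast
        moreover have "x \<notin> ?C (Suc i)" using x by blast
        then have "x \<notin> C i" by auto
        ultimately show "x \<in> (\<Union>i. U i - C i)" by blast
      qed
      show "(\<Union>i. U i - C i) \<in> sets \<mu>" using msets CU(1,2) by (intro sets.countable_UN) auto
    qed
    also have "\<dots> < e" using half Union.prems by simp
    finally have "measure \<mu> (\<Inter>n. ?U - ?C n) < e" .
    moreover have "(\<lambda>n. measure \<mu> (?U - ?C n)) \<longlonglongrightarrow> measure \<mu> (\<Inter>n. ?U - ?C n)"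
    proof (rule finite_Lim_measure_decseq)
      show "range (\<lambda>n. ?U - ?C n) \<subseteq> sets \<mu>" using msets[OF oU cC] by (intro image_subsetI)
      show "decseq (\<lambda>n. ?U - ?C n)" unfolding decseq_def
        by (intro allI impI Diff_mono order_refl UN_mono) auto
    qed
    ultimately have "\<forall>\<^sub>F n in sequentially. measure \<mu> (?U - ?C n) < e" by (rule order_tendstoD(2)[rotated])
    then obtain n where "measure \<mu> (?U - ?C n) < e" by (auto simp: eventually_sequentially)
    moreover have "?C n \<subseteq> (\<Union>i. A i)" "(\<Union>i. A i) \<subseteq> ?U" using CU(3,4) by blast+
    ultimately show ?case using oU cC[of n] by (intro exI[of _ "?C n"] exI[of _ ?U] conjI) assumption+
  qed
qed

lemma closed_inner_approximation:
  fixes \<mu> :: "'a::metric_space measure"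
  assumes \<mu>: "finite_measure \<mu>" "sets \<mu> = sets borel" and A: "A \<in> sets \<mu>" and e: "0 < e"
  obtains C where "closed C" "C \<subseteq> A" "measure \<mu> (A - C) < e"
proof -
  interpret finite_measure \<mu> by fact
  obtain C U where CU: "closed C" "open U" "C \<subseteq> A" "A \<subseteq> U" "measure \<mu> (U - C) < e"
    using borel_closed_open_approximation[OF assms] by blast
  have "measure \<mu> (A - C) \<le> measure \<mu> (U - C)"
    by (rule finite_measure_mono) (use CU \<mu> in \<open>auto intro: sets.Diff\<close>)
  with CU show thesis by (intro that[of C]) auto
qed

lemma disjoint_closed_gap:
  fixes C D :: "'a::metric_space set"
  assumes X: "compact (UNIV :: 'a set)" and "closed C" "closed D" "C \<inter> D = {}"
  shows "\<exists>d>0. \<forall>x\<in>C. \<forall>y\<in>D. d \<le> dist x y"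
proof (cases "C = {} \<or> D = {}")
  case False
  have "compact C" using compact_Int_closed[OF X \<open>closed C\<close>] by simp
  moreover have "continuous_on C (\<lambda>x. infdist x D)"
    by (rule continuous_on_infdist[OF continuous_on_id])
  ultimately obtain x0 where x0: "x0 \<in> C" "\<And>x. x \<in> C \<Longrightarrow> infdist x0 D \<le> infdist x D"
    using continuous_attains_inf[of C "\<lambda>x. infdist x D"] False by blast
  have "0 < infdist x0 D"
    using x0 assms False by (intro infdist_pos_not_in_closed) auto
  moreover have "infdist x0 D \<le> dist x y" if "x \<in> C" "y \<in> D" for x y
    using x0(2)[OF that(1)] infdist_le[OF that(2), of x] by linarith
  ultimately show ?thesis by blast
qed (auto intro: exI[of _ 1])

lemma disjoint_closed_family_gap:
  fixes C :: "'i \<Rightarrow> 'a::metric_space set"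
  assumes X: "compact (UNIV :: 'a set)" and I: "finite I" and C: "\<And>i. i \<in> I \<Longrightarrow> closed (C i)"
    and disj: "disjoint_family_on C I"
  obtains r where "0 < r"
    "\<And>i j x y. i \<in> I \<Longrightarrow> j \<in> I \<Longrightarrow> i \<noteq> j \<Longrightarrow> x \<in> C i \<Longrightarrow> y \<in> C j \<Longrightarrow> r \<le> dist x y"
proof -
  let ?P = "{(i, j) \<in> I \<times> I. i \<noteq> j}"
  have "\<exists>d>0. \<forall>x\<in>C (fst p). \<forall>y\<in>C (snd p). d \<le> dist x y" if p: "p \<in> ?P" for p
  proof (rule disjoint_closed_gap[OF X])
    show "closed (C (fst p))" "closed (C (snd p))" using p C by auto
    show "C (fst p) \<inter> C (snd p) = {}"
      using p disj by (cases p) (simp add: disjoint_family_on_def)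
  qed
  then have "\<forall>p\<in>?P. \<exists>d. 0 < d \<and> (\<forall>x\<in>C (fst p). \<forall>y\<in>C (snd p). d \<le> dist x y)" by blast
  from bchoice[OF this] obtain d where d0: "\<forall>p\<in>?P. 0 < d p \<and> (\<forall>x\<in>C (fst p). \<forall>y\<in>C (snd p). d p \<le> dist x y)"
    by blast
  then have d: "\<And>p. p \<in> ?P \<Longrightarrow> 0 < d p"
      "\<And>p x y. p \<in> ?P \<Longrightarrow> x \<in> C (fst p) \<Longrightarrow> y \<in> C (snd p) \<Longrightarrow> d p \<le> dist x y"
    by blast+
  have fin: "finite (insert 1 (d ` ?P))" using I by (auto intro: finite_subset[of _ "I \<times> I"])
  let ?r = "Min (insert 1 (d ` ?P))"
  have "0 < ?r" using fin d(1) by (subst Min_gr_iff) auto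
  moreover have "?r \<le> dist x y" if "i \<in> I" "j \<in> I" "i \<noteq> j" "x \<in> C i" "y \<in> C j" for i j x y
  proof -
    have p: "(i, j) \<in> ?P" using that by auto
    have "?r \<le> d (i, j)" using fin p by (intro Min_le) auto
    also have "\<dots> \<le> dist x y" using d(2)[OF p] that by simp
    finally show ?thesis .
  qed
  ultimately show thesis by (rule that)
qed

section \<open>Separated sets and entropy\<close>

text \<open>A separated set of greatest size cannot be enlarged, so each point of \<open>A\<close> is near one of its points. The
  cardinality bound \<open>R\<close> guarantees that a greatest size exists.\<close>

lemma ex_maximal_separated:
  assumes bound: "\<And>S. S \<subseteq> A \<Longrightarrow> finite S \<Longrightarrow> separated T n r S \<Longrightarrow> real (card S) < R"
  obtains S where "S \<subseteq> A" "finite S" "separated T n r S"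
    "\<And>y. y \<in> A \<Longrightarrow> \<exists>x\<in>S. \<forall>l<n. dist ((T ^^ l) x) ((T ^^ l) y) < r \<or> x = y"
proof -
  let ?P = "\<lambda>S. S \<subseteq> A \<and> finite S \<and> separated T n r S"
  have "?P {}" by (simp add: separated_def)
  moreover have "card S \<le> nat \<lceil>R\<rceil>" if "?P S" for S
  proof -
    have "real (card S) < R" using bound[of S] that by blast
    then show ?thesis by linarith
  qed
  ultimately obtain S where S: "?P S" "\<forall>S'. ?P S' \<longrightarrow> card S' \<le> card S"
    using ex_has_greatest_nat[of ?P "{}" card "Suc (nat \<lceil>R\<rceil>)"] unfolding less_Suc_eq_le by blast
  have "\<exists>x\<in>S. \<forall>l<n. dist ((T ^^ l) x) ((T ^^ l) y) < r \<or> x = y" if y: "y \<in> A" for y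
  proof (rule ccontr)
    assume *: "\<not> ?thesis"
    then have "y \<notin> S" by blast
    moreover have "separated T n r (insert y S)"
      unfolding separated_def
    proof (intro ballI impI)
      fix u v assume uv: "u \<in> insert y S" "v \<in> insert y S" "u \<noteq> v"
      have far: "\<exists>l<n. r \<le> dist ((T ^^ l) x) ((T ^^ l) y)" if "x \<in> S" for x
        using * that by (auto simp: not_less)
      show "\<exists>l<n. r \<le> dist ((T ^^ l) u) ((T ^^ l) v)"
      proof (cases "u = y \<or> v = y")
        case True
        then show ?thesis
        proof
          assume "u = y"
          then show ?thesis using far[of v] uv by (simp add: dist_commute)
        next
          assume "v = y"
          then show ?thesis using far[of u] uv by simp
        qed
      next
        case False
        then show ?thesis using uv S(1) unfolding separated_def by blast
      qed
    qed
    ultimately have "?P (insert y S)" using S(1) y by simp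
    with S(2) have "card (insert y S) \<le> card S" by (elim allE impE)
    with \<open>y \<notin> S\<close> S(1) show False by simp
  qed
  with S(1) show thesis by (intro that[of S]) auto
qed

context invariant_partition
begin

lemma measure_words_ge:
  assumes Q: "\<And>Q. Q \<in> sets \<mu> \<Longrightarrow> A \<subseteq> Q \<Longrightarrow> c \<le> measure \<mu> Q"
  shows "c \<le> (\<Sum>w\<in>itinerary T \<xi> n ` A. measure \<mu> (cylinder T \<xi> w))"
proof -
  let ?G = "itinerary T \<xi> n ` A"
  have G: "?G \<subseteq> words \<xi> n" using itinerary_in_words by blast
  have finG: "finite ?G" by (rule finite_subset[OF G finite_words[OF fin]])
  have m: "cylinder T \<xi> ` ?G \<subseteq> sets \<mu>" using G cylinder_measurable by blast
  have "c \<le> measure \<mu> (\<Union>w\<in>?G. cylinder T \<xi> w)"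
  proof (rule Q)
    show "(\<Union>w\<in>?G. cylinder T \<xi> w) \<in> sets \<mu>" using m by (intro sets.finite_UN[OF finG]) blast
    show "A \<subseteq> (\<Union>w\<in>?G. cylinder T \<xi> w)"
    proof
      fix x assume "x \<in> A"
      then show "x \<in> (\<Union>w\<in>?G. cylinder T \<xi> w)"
        by (intro UN_I[of "itinerary T \<xi> n x"]) (simp_all add: cylinder_def)
    qed
  qed
  also have "\<dots> \<le> (\<Sum>w\<in>?G. measure \<mu> (cylinder T \<xi> w))"
    by (rule finite_measure_subadditive_finite[OF finG m])
  finally show ?thesis .
qed

text \<open>Shrinking the cells to closed subsets leaves an exceptional set \<open>B\<close> of small measure. The closed cores are
  disjoint and compact, hence have a positive distance from each other.\<close>

lemma closed_cores:
  assumes X: "compact (UNIV :: 'a set)" and e: "0 < e"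
  obtains B r where "B \<in> sets \<mu>" "measure \<mu> B \<le> e" "0 < r"
    "\<And>x y. x \<notin> B \<Longrightarrow> y \<notin> B \<Longrightarrow> dist x y < r \<Longrightarrow> cell \<xi> x = cell \<xi> y"
proof -
  have sets: "sets \<mu> = sets borel" using inv by (simp add: invariant_prob_def)
  have k: "0 < real (card \<xi>)" using card_partition_pos by simp
  have "\<exists>C. closed C \<and> C \<subseteq> A \<and> measure \<mu> (A - C) < e / card \<xi>" if "A \<in> \<xi>" for A
  proof -
    have "A \<in> sets \<mu>" using that meas by blast
    then obtain C where "closed C" "C \<subseteq> A" "measure \<mu> (A - C) < e / card \<xi>"
      by (rule closed_inner_approximation[OF finite_measure_axioms sets _ divide_pos_pos[OF e k]])
    then show ?thesis by blast
  qed
  then have "\<forall>A\<in>\<xi>. \<exists>C. closed C \<and> C \<subseteq> A \<and> measure \<mu> (A - C) < e / card \<xi>" by blast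
  from bchoice[OF this] obtain C where "\<forall>A\<in>\<xi>. closed (C A) \<and> C A \<subseteq> A \<and> measure \<mu> (A - C A) < e / card \<xi>"
    by blast
  then have C: "\<And>A. A \<in> \<xi> \<Longrightarrow> closed (C A)" "\<And>A. A \<in> \<xi> \<Longrightarrow> C A \<subseteq> A"
      "\<And>A. A \<in> \<xi> \<Longrightarrow> measure \<mu> (A - C A) < e / card \<xi>"
    by blast+
  have disj: "disjoint_family_on C \<xi>"
    unfolding disjoint_family_on_def
  proof (intro ballI impI)
    fix A A' assume "A \<in> \<xi>" "A' \<in> \<xi>" "A \<noteq> A'"
    then have "A \<inter> A' = {}" using part by (auto simp: partition_on_def disjoint_def)
    with C(2)[OF \<open>A \<in> \<xi>\<close>] C(2)[OF \<open>A' \<in> \<xi>\<close>] show "C A \<inter> C A' = {}" by blast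
  qed
  obtain r where r: "0 < r"
    "\<And>i j x y. i \<in> \<xi> \<Longrightarrow> j \<in> \<xi> \<Longrightarrow> i \<noteq> j \<Longrightarrow> x \<in> C i \<Longrightarrow> y \<in> C j \<Longrightarrow> r \<le> dist x y"
    using disjoint_closed_family_gap[OF X fin C(1) disj] by blast
  define B where "B = (\<Union>A\<in>\<xi>. A - C A)"
  have m: "(\<lambda>A. A - C A) ` \<xi> \<subseteq> sets \<mu>" using meas C(1) sets by (auto intro!: sets.Diff)
  have "measure \<mu> B \<le> (\<Sum>A\<in>\<xi>. measure \<mu> (A - C A))"
    unfolding B_def by (rule finite_measure_subadditive_finite[OF fin m])
  also have "\<dots> \<le> (\<Sum>A\<in>\<xi>. e / card \<xi>)" by (rule sum_mono) (use C(3) in \<open>auto intro: less_imp_le\<close>)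
  also have "\<dots> = e" using k by simp
  finally have "measure \<mu> B \<le> e" .
  moreover have "B \<in> sets \<mu>" unfolding B_def using m by (intro sets.finite_UN[OF fin]) blast
  moreover have "cell \<xi> x = cell \<xi> y" if "x \<notin> B" "y \<notin> B" "dist x y < r" for x y
  proof (rule ccontr)
    assume ne: "cell \<xi> x \<noteq> cell \<xi> y"
    have core: "z \<in> C (cell \<xi> z)" if "z \<notin> B" for z
      using that cell_in[of z] mem_cell[of z] unfolding B_def by blast
    have "x \<in> C (cell \<xi> x)" "y \<in> C (cell \<xi> y)" by (rule core, fact)+
    then have "r \<le> dist x y" using r(2)[OF cell_in cell_in ne] by blast
    with that(3) show False by simp
  qed
  ultimately show thesis using r(1) by (intro that[of B r])
qed

text \<open>Markov's inequality for the number of visits to \<open>B\<close>, whose mean is \<open>n * measure \<mu> B\<close> by invariance.\<close>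

lemma measure_frequent_visits_le:
  assumes B: "B \<in> sets \<mu>" and n: "0 < n" and \<theta>: "0 < \<theta>"
  shows "{x. \<theta> * real n \<le> birkhoff_sum T n (indicator B) x} \<in> sets \<mu>"
    and "measure \<mu> {x. \<theta> * real n \<le> birkhoff_sum T n (indicator B) x} \<le> measure \<mu> B / \<theta>"
proof -
  let ?f = "indicator B :: 'a \<Rightarrow> real"
  have f [measurable]: "?f \<in> borel_measurable \<mu>" using B by simp
  note S [measurable] = birkhoff_sum_measurable[OF inv T f]
  have m: "{x\<in>space \<mu>. \<theta> * real n \<le> birkhoff_sum T n ?f x} \<in> sets \<mu>" by measurable
  then show "{x. \<theta> * real n \<le> birkhoff_sum T n ?f x} \<in> sets \<mu>" by (simp add: sp)
  have [measurable]: "T ^^ i \<in> measurable \<mu> \<mu>" for i by (rule invariant_prob_measurable_funpow[OF inv T])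
  have i: "integrable \<mu> (\<lambda>x. ?f ((T ^^ i) x))" for i
    by (rule integrable_const_bound[where B=1]) auto
  have iS: "integrable \<mu> (birkhoff_sum T n ?f)"
    unfolding birkhoff_sum_def[abs_def] by (intro Bochner_Integration.integrable_sum i)
  have "(\<integral>x. birkhoff_sum T n ?f x \<partial>\<mu>) = (\<Sum>i<n. \<integral>x. ?f ((T ^^ i) x) \<partial>\<mu>)"
    unfolding birkhoff_sum_def by (intro Bochner_Integration.integral_sum i)
  also have "\<dots> = real n * measure \<mu> B"
    using B by (simp add: integral_funpow[OF inv T f])
  finally have I: "(\<integral>x. birkhoff_sum T n ?f x \<partial>\<mu>) = real n * measure \<mu> B" .
  have "measure \<mu> {x\<in>space \<mu>. \<theta> * real n \<le> birkhoff_sum T n ?f x} \<le> (real n * measure \<mu> B) / (\<theta> * real n)"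
    unfolding I[symmetric]
    by (rule integral_Markov_inequality_measure[OF iS sets.top])
      (use n \<theta> in \<open>auto simp: birkhoff_sum_def intro!: sum_nonneg\<close>)
  then show "measure \<mu> {x. \<theta> * real n \<le> birkhoff_sum T n ?f x} \<le> measure \<mu> B / \<theta>"
    using n by (simp add: sp)
qed

lemma hamming_itinerary_le:
  assumes cells: "\<And>x y. x \<notin> B \<Longrightarrow> y \<notin> B \<Longrightarrow> dist x y < r \<Longrightarrow> cell \<xi> x = cell \<xi> y"
    and close: "\<And>l. l < n \<Longrightarrow> dist ((T ^^ l) x) ((T ^^ l) y) < r"
  shows "real (hamming (itinerary T \<xi> n x) (itinerary T \<xi> n y))
    \<le> birkhoff_sum T n (indicator B) x + birkhoff_sum T n (indicator B) y"
proof -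
  have vis: "birkhoff_sum T n (indicator B) z = real (card {i. i < n \<and> (T ^^ i) z \<in> B})" for z
  proof -
    have "birkhoff_sum T n (indicator B) z = (\<Sum>i<n. if (T ^^ i) z \<in> B then 1 else 0)"
      by (simp add: birkhoff_sum_def indicator_def of_bool_def)
    also have "\<dots> = real (card {i. i < n \<and> (T ^^ i) z \<in> B})"
      by (simp add: sum.If_cases Int_def)
    finally show ?thesis .
  qed
  have "hamming (itinerary T \<xi> n x) (itinerary T \<xi> n y)
      = card {i. i < n \<and> itinerary T \<xi> n x ! i \<noteq> itinerary T \<xi> n y ! i}"
    by (simp add: hamming_eq_card)
  also have "\<dots> \<le> card ({i. i < n \<and> (T ^^ i) x \<in> B} \<union> {i. i < n \<and> (T ^^ i) y \<in> B})"
  proof (rule card_mono)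
    show "{i. i < n \<and> itinerary T \<xi> n x ! i \<noteq> itinerary T \<xi> n y ! i}
        \<subseteq> {i. i < n \<and> (T ^^ i) x \<in> B} \<union> {i. i < n \<and> (T ^^ i) y \<in> B}"
    proof
      fix i assume "i \<in> {i. i < n \<and> itinerary T \<xi> n x ! i \<noteq> itinerary T \<xi> n y ! i}"
      then have i: "i < n" "cell \<xi> ((T ^^ i) x) \<noteq> cell \<xi> ((T ^^ i) y)" by (auto simp: itinerary_def)
      then have "(T ^^ i) x \<in> B \<or> (T ^^ i) y \<in> B" using cells close by blast
      with i(1) show "i \<in> {i. i < n \<and> (T ^^ i) x \<in> B} \<union> {i. i < n \<and> (T ^^ i) y \<in> B}" by blast
    qed
  qed simp
  also have "\<dots> \<le> card {i. i < n \<and> (T ^^ i) x \<in> B} + card {i. i < n \<and> (T ^^ i) y \<in> B}"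
    by (rule card_Un_le)
  finally show ?thesis unfolding vis by linarith
qed

text \<open>A maximal separated set \<open>S\<close> covers \<open>A\<close> by Bowen balls. Discarding the points that visit the exceptional
  set of \<open>closed_cores\<close> too often, the itineraries in one ball lie in a Hamming ball, which
  has few elements; so the number of itineraries is at most \<open>card S\<close> up to a small exponential factor. By
  Fano's inequality this number is nearly \<open>exp (n * h)\<close>, because its cylinders have almost full measure.
  The set \<open>A\<close> is arbitrary, so largeness is expressed through its measurable supersets.\<close>

lemma many_separated_points:
  assumes X: "compact (UNIV :: 'a set)" and \<delta>: "0 < \<delta>"
  shows "\<exists>r>0. \<exists>\<kappa>>0. \<exists>N. \<forall>n\<ge>N. \<forall>A. (\<forall>Q\<in>sets \<mu>. A \<subseteq> Q \<longrightarrow> 1 - \<kappa> \<le> measure \<mu> Q) \<longrightarrow>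
    (\<exists>S\<subseteq>A. finite S \<and> separated T n r S
      \<and> exp (real n * (entropy_wrt_partition T \<mu> \<xi> - \<delta>)) \<le> real (card S))"
proof -
  define k where "k = real (card \<xi>)"
  define h where "h = entropy_wrt_partition T \<mu> \<xi>"
  have k: "1 \<le> k" using card_partition_pos by (simp add: k_def)
  then have lnk: "0 \<le> ln k" by simp
  \<comment> \<open>The loss \<open>\<delta>\<close> is split into four quarters: the Hamming balls cost \<open>k * t\<close> and \<open>2 * \<theta> * s\<close>, Fano's
    inequality \<open>2 * \<kappa> * ln k\<close>, and its term \<open>ln 2\<close> is absorbed by taking \<open>n\<close> large.\<close>
  define t where "t = min 1 (\<delta> / (4 * k))"
  have t: "0 < t" "t \<le> 1" using \<delta> k by (auto simp: t_def)
  have kt: "k * t \<le> \<delta> / 4"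
    using k mult_left_mono[of t "\<delta> / (4 * k)" k] by (simp add: t_def field_simps)
  define s where "s = ln (1 / t)"
  have s: "0 \<le> s" using t by (simp add: s_def ln_div)
  define \<theta> where "\<theta> = \<delta> / (8 * (1 + s))"
  have \<theta>: "0 < \<theta>" using \<delta> s by (simp add: \<theta>_def)
  have \<theta>s: "2 * \<theta> * s \<le> \<delta> / 4" using \<delta> s by (simp add: \<theta>_def field_simps)
  define \<kappa> where "\<kappa> = min (1 / 4) (\<delta> / (8 * (1 + ln k)))"
  have \<kappa>: "0 < \<kappa>" using \<delta> lnk by (simp add: \<kappa>_def)
  have \<kappa>4: "\<kappa> \<le> 1 / 4" unfolding \<kappa>_def by (rule min.cobounded1)
  have "\<kappa> * ln k \<le> \<delta> / (8 * (1 + ln k)) * ln k" using lnk by (intro mult_right_mono) (auto simp: \<kappa>_def)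
  also have "\<dots> \<le> \<delta> / 8" using \<delta> lnk by (simp add: field_simps)
  finally have \<kappa>k: "2 * \<kappa> * ln k \<le> \<delta> / 4" by simp
  obtain B r where B: "B \<in> sets \<mu>" "measure \<mu> B \<le> \<theta> * \<kappa>" and r: "0 < r"
    and cells: "\<And>x y. x \<notin> B \<Longrightarrow> y \<notin> B \<Longrightarrow> dist x y < r \<Longrightarrow> cell \<xi> x = cell \<xi> y"
    by (rule closed_cores[OF X mult_pos_pos[OF \<theta> \<kappa>]]) blast
  obtain N :: nat where N: "4 * ln 2 / \<delta> \<le> real N" using real_arch_simple by blast
  have main: "\<exists>S\<subseteq>A. finite S \<and> separated T n r S \<and> exp (real n * (h - \<delta>)) \<le> real (card S)"
    if n: "max 1 N \<le> n" and A: "\<forall>Q\<in>sets \<mu>. A \<subseteq> Q \<longrightarrow> 1 - \<kappa> \<le> measure \<mu> Q" for n A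
  proof (rule ccontr)
    assume "\<not> ?thesis"
    then have few: "real (card S) < exp (real n * (h - \<delta>))"
      if "S \<subseteq> A" "finite S" "separated T n r S" for S
      using that by (meson not_le)
    have n0: "0 < n" using n by simp
    have "4 * ln 2 / \<delta> \<le> real n" using N n by linarith
    then have ln2: "ln 2 \<le> real n * (\<delta> / 4)" using \<delta> by (simp add: field_simps)
    let ?visits = "birkhoff_sum T n (indicator B)"
    let ?bad = "{x. \<theta> * real n \<le> ?visits x}"
    note bad = measure_frequent_visits_le[OF B(1) n0 \<theta>]
    have "measure \<mu> B / \<theta> \<le> \<kappa>" using B(2) \<theta> by (simp add: field_simps)
    with bad(2) have bad\<kappa>: "measure \<mu> ?bad \<le> \<kappa>" by linarith
    \<comment> \<open>Discarding the frequent visitors doubles the admissible defect of the outer measure.\<close>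
    let ?A = "A - ?bad"
    have A': "1 - 2 * \<kappa> \<le> measure \<mu> Q" if Q: "Q \<in> sets \<mu>" "?A \<subseteq> Q" for Q
    proof -
      have "1 - \<kappa> \<le> measure \<mu> (Q \<union> ?bad)" using A Q bad(1) by blast
      also have "\<dots> \<le> measure \<mu> Q + measure \<mu> ?bad" by (rule measure_Un_le[OF Q(1) bad(1)])
      finally show ?thesis using bad\<kappa> by linarith
    qed
    let ?G = "itinerary T \<xi> n ` ?A"
    have G: "?G \<subseteq> words \<xi> n" using itinerary_in_words by blast
    have "?A \<noteq> {}"
    proof
      assume "?A = {}"
      then have "1 - 2 * \<kappa> \<le> measure \<mu> {}" using A'[of "{}"] by simp
      then show False using \<kappa>4 by simp
    qed
    then have ne: "?G \<noteq> {}" by simp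
    have finG: "finite ?G" by (rule finite_subset[OF G finite_words[OF fin]])
    have Gpos: "0 < real (card ?G)" using ne finG by (simp add: card_gt_0_iff)
    obtain S where S: "S \<subseteq> ?A" "finite S" "separated T n r S"
      and cov: "\<And>y. y \<in> ?A \<Longrightarrow> \<exists>x\<in>S. \<forall>l<n. dist ((T ^^ l) x) ((T ^^ l) y) < r \<or> x = y"
    proof (rule ex_maximal_separated[of ?A T n r "exp (real n * (h - \<delta>))"])
      show "real (card S) < exp (real n * (h - \<delta>))" if "S \<subseteq> ?A" "finite S" "separated T n r S" for S
        using that by (intro few) auto
    qed blast
    let ?H = "\<lambda>x. {w \<in> words \<xi> n. real (hamming (itinerary T \<xi> n x) w) \<le> 2 * \<theta> * real n}"
    let ?E = "exp (real n * (k * t) + 2 * \<theta> * real n * s)"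
    have "?G \<subseteq> (\<Union>x\<in>S. ?H x)"
    proof
      fix w assume "w \<in> ?G"
      then obtain y where y: "y \<in> ?A" "w = itinerary T \<xi> n y" by blast
      obtain x where x: "x \<in> S" "\<forall>l<n. dist ((T ^^ l) x) ((T ^^ l) y) < r \<or> x = y" using cov[OF y(1)] by blast
      have "real (hamming (itinerary T \<xi> n x) w) \<le> ?visits x + ?visits y"
        unfolding y(2) by (rule hamming_itinerary_le[where r=r, OF cells]) (use x r in auto)
      also have "?visits x \<le> \<theta> * real n" using x(1) S(1) by auto
      also have "?visits y \<le> \<theta> * real n" using y(1) by auto
      finally have "w \<in> ?H x" using y(2) itinerary_in_words[of n y] by simp
      with x(1) show "w \<in> (\<Union>x\<in>S. ?H x)" by blast
    qed
    then have "card ?G \<le> card (\<Union>x\<in>S. ?H x)"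
      using S(2) finite_words[OF fin] by (intro card_mono) auto
    also have "\<dots> \<le> (\<Sum>x\<in>S. card (?H x))" by (rule card_UN_le[OF S(2)])
    finally have "real (card ?G) \<le> real (\<Sum>x\<in>S. card (?H x))" by (rule of_nat_mono)
    also have "\<dots> = (\<Sum>x\<in>S. real (card (?H x)))" by (rule of_nat_sum)
    also have "\<dots> \<le> (\<Sum>x\<in>S. ?E)"
    proof (rule sum_mono)
      fix x
      show "real (card (?H x)) \<le> ?E"
        using card_hamming_ball_le[OF fin t, of "2 * \<theta> * real n" "itinerary T \<xi> n x"] \<theta>
        by (simp add: k_def s_def)
    qed
    also have "\<dots> = real (card S) * ?E" by simp
    also have "\<dots> < exp (real n * (h - \<delta>)) * ?E" using few[of S] S by auto
    finally have "real (card ?G) < exp (real n * (h - \<delta>) + (real n * (k * t) + 2 * \<theta> * real n * s))"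
      by (simp add: exp_add)
    then have lnG: "ln (real (card ?G)) < real n * (h - \<delta>) + (real n * (k * t) + 2 * \<theta> * real n * s)"
      using Gpos by (metis ln_exp ln_less_cancel_iff exp_gt_zero)
    have "real n * h \<le> partition_entropy \<mu> (iterated_join T n \<xi>)"
      unfolding h_def by (rule entropy_wrt_partition_le)
    also have "\<dots> \<le> ln 2 + ln (real (card ?G)) + (2 * \<kappa>) * (real n * ln (real (card \<xi>)))"
      by (rule entropy_le_log_card[OF G ne measure_words_ge]) (rule A')
    finally have "real n * h < ln 2 + (real n * (h - \<delta>) + (real n * (k * t) + 2 * \<theta> * real n * s))
        + 2 * \<kappa> * (real n * ln k)" using lnG unfolding k_def by linarith
    also have "\<dots> = ln 2 + real n * (h - \<delta>) + real n * (k * t) + real n * (2 * \<theta> * s) + real n * (2 * \<kappa> * ln k)"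
      by (simp add: algebra_simps)
    also have "\<dots> \<le> real n * (\<delta> / 4) + real n * (h - \<delta>) + real n * (\<delta> / 4) + real n * (\<delta> / 4) + real n * (\<delta> / 4)"
      using ln2 kt \<theta>s \<kappa>k by (intro add_mono mult_left_mono) auto
    also have "\<dots> = real n * h" by (simp add: algebra_simps)
    finally show False by simp
  qed
  show ?thesis unfolding h_def[symmetric]
    by (rule exI[of _ r], rule conjI[OF r], rule exI[of _ \<kappa>], rule conjI[OF \<kappa>], rule exI[of _ "max 1 N"])
      (intro allI impI, rule main)
qed

end

section \<open>Good orbit segments\<close>

text \<open>Outer measure is continuous along increasing sequences of arbitrary sets: intersecting measurable
  hulls of the later sets gives an increasing sequence of measurable sets that exhausts \<open>K\<close>.\<close>

lemma increasing_sets_outer_measure: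
  assumes \<mu>: "prob_space \<mu>" and K: "K \<in> sets \<mu>" "measure \<mu> K = 1" and A: "incseq A" "K \<subseteq> (\<Union>n. A n)"
    and \<kappa>: "0 < \<kappa>"
  shows "\<forall>\<^sub>F n in sequentially. \<forall>Q\<in>sets \<mu>. A n \<subseteq> Q \<longrightarrow> 1 - \<kappa> \<le> measure \<mu> Q"
proof (rule ccontr)
  interpret prob_space \<mu> by fact
  assume "\<not> ?thesis"
  then have "\<forall>N. \<exists>n\<ge>N. \<exists>Q\<in>sets \<mu>. A n \<subseteq> Q \<and> measure \<mu> Q < 1 - \<kappa>"
    unfolding eventually_sequentially by (meson not_le)
  then have "\<forall>N. \<exists>Q. Q \<in> sets \<mu> \<and> A N \<subseteq> Q \<and> measure \<mu> Q < 1 - \<kappa>"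
    using A(1) unfolding incseq_def by (meson order_trans)
  then obtain Q where Q: "\<And>N. Q N \<in> sets \<mu>" "\<And>N. A N \<subseteq> Q N" "\<And>N. measure \<mu> (Q N) < 1 - \<kappa>"
    by metis
  define R where "R N = (\<Inter>j\<in>{N..}. Q j)" for N
  have Rm: "R N \<in> sets \<mu>" for N
    unfolding R_def by (intro sets.countable_INT') (use Q(1) in auto)
  have inc: "incseq R" unfolding R_def incseq_def by (intro allI impI INT_anti_mono) auto
  have lim: "(\<lambda>N. measure \<mu> (R N)) \<longlonglongrightarrow> measure \<mu> (\<Union>N. R N)"
    by (rule finite_Lim_measure_incseq[OF _ inc]) (use Rm in auto)
  have "measure \<mu> (R N) \<le> 1 - \<kappa>" for N
  proof -
    have "measure \<mu> (R N) \<le> measure \<mu> (Q N)" by (rule finite_measure_mono[OF _ Q(1)]) (auto simp: R_def)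
    with Q(3)[of N] show ?thesis by linarith
  qed
  with lim have "measure \<mu> (\<Union>N. R N) \<le> 1 - \<kappa>" by (intro LIMSEQ_le_const2) auto
  moreover have "K \<subseteq> (\<Union>N. R N)"
  proof
    fix x assume "x \<in> K"
    then obtain N where N: "x \<in> A N" using A(2) by blast
    have "x \<in> Q j" if "N \<le> j" for j using N A(1) Q(2)[of j] that by (auto simp: incseq_def)
    then show "x \<in> (\<Union>N. R N)" by (auto simp: R_def)
  qed
  then have "measure \<mu> K \<le> measure \<mu> (\<Union>N. R N)" by (rule finite_measure_mono) (use Rm in auto)
  ultimately show False using K(2) \<kappa> by simp
qed

text \<open>The radius \<open>r\<close> is obtained before the eventual property \<open>P\<close> is given, because the gap bound that is
  later used for \<open>P\<close> depends on a shadowing scale chosen below \<open>r\<close>. The points where \<open>P\<close> holds from time \<open>N\<close>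
  on exhaust \<open>K\<close>, so those for a large \<open>N\<close> have outer measure near \<open>1\<close>.\<close>

lemma typical_separated_points:
  fixes T :: "'a::metric_space \<Rightarrow> 'a" and f g :: "'a \<Rightarrow> real"
  assumes X: "compact (UNIV :: 'a set)" and T: "continuous_on UNIV T"
    and erg: "ergodic T \<mu>" and K: "K \<in> sets borel" "measure \<mu> K = 1"
    and \<xi>: "finite \<xi>" "\<xi> \<subseteq> sets \<mu>" "partition_on UNIV \<xi>"
    and f: "continuous_on UNIV f" and g: "continuous_on UNIV g" and \<delta>: "0 < \<delta>"
  obtains r where "0 < r"
    "\<And>P. (\<And>x. x \<in> K \<Longrightarrow> \<forall>\<^sub>F n in sequentially. P x n) \<Longrightarrow>
     \<forall>\<^sub>F n in sequentially. \<exists>S\<subseteq>K. finite S \<and> separated T n r S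
       \<and> exp (real n * (entropy_wrt_partition T \<mu> \<xi> - \<delta>)) \<le> real (card S)
       \<and> (\<forall>x\<in>S. P x n \<and> \<bar>birkhoff_sum T n f x - real n * (\<integral>x. f x \<partial>\<mu>)\<bar> \<le> real n * \<delta>
             \<and> \<bar>birkhoff_sum T n g x - real n * (\<integral>x. g x \<partial>\<mu>)\<bar> \<le> real n * \<delta>)"
proof -
  have inv: "invariant_prob T \<mu>" using erg by (simp add: ergodic_def)
  interpret invariant_partition T \<mu> \<xi> by unfold_locales (use inv T \<xi> in auto)
  have sets: "sets \<mu> = sets borel" using inv by (simp add: invariant_prob_def)
  obtain r \<kappa> N where r: "0 < r" and \<kappa>: "0 < \<kappa>" and ev:
    "\<forall>n\<ge>N. \<forall>A. (\<forall>Q\<in>sets \<mu>. A \<subseteq> Q \<longrightarrow> 1 - \<kappa> \<le> measure \<mu> Q) \<longrightarrow>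
      (\<exists>S\<subseteq>A. finite S \<and> separated T n r S
        \<and> exp (real n * (entropy_wrt_partition T \<mu> \<xi> - \<delta>)) \<le> real (card S))"
    using many_separated_points[OF X \<delta>] by (elim exE conjE)
  have many: "\<exists>S\<subseteq>A. finite S \<and> separated T n r S
      \<and> exp (real n * (entropy_wrt_partition T \<mu> \<xi> - \<delta>)) \<le> real (card S)"
    if "N \<le> n" "\<forall>Q\<in>sets \<mu>. A \<subseteq> Q \<longrightarrow> 1 - \<kappa> \<le> measure \<mu> Q" for n A
    by (rule ev[THEN spec, THEN mp, OF that(1), THEN spec, THEN mp, OF that(2)])
  let ?bad = "\<lambda>f n. {x. real n * \<delta> \<le> \<bar>birkhoff_sum T n f x - real n * (\<integral>x. f x \<partial>\<mu>)\<bar>}"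
  have badm: "?bad f n \<in> sets \<mu>" and bad: "\<forall>\<^sub>F n in sequentially. measure \<mu> (?bad f n) < \<kappa> / 3"
    if f: "continuous_on UNIV f" for f :: "'a \<Rightarrow> real" and n
  proof -
    have fm: "f \<in> borel_measurable \<mu>"
      using borel_measurable_continuous_onI[OF f] measurable_cong_sets[OF sets refl] by blast
    note [measurable] = birkhoff_sum_measurable[OF inv T fm]
    have "{x\<in>space \<mu>. real n * \<delta> \<le> \<bar>birkhoff_sum T n f x - real n * (\<integral>x. f x \<partial>\<mu>)\<bar>} \<in> sets \<mu>"
      by measurable
    then show "?bad f n \<in> sets \<mu>" by (simp add: sp)
    obtain B where "\<And>x. \<bar>f x\<bar> \<le> B" using compact_bounded_function[OF X f] by blast
    from ergodic_averages[OF erg T fm this \<delta>]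
    show "\<forall>\<^sub>F n in sequentially. measure \<mu> (?bad f n) < \<kappa> / 3"
      by (rule order_tendstoD) (use \<kappa> in simp)
  qed
  show thesis
  proof (rule that[OF r])
    fix P :: "'a \<Rightarrow> nat \<Rightarrow> bool"
    assume P: "\<And>x. x \<in> K \<Longrightarrow> \<forall>\<^sub>F n in sequentially. P x n"
    define A where "A N = {x \<in> K. \<forall>n\<ge>N. P x n}" for N
    have inc: "incseq A" unfolding incseq_def A_def by (auto intro: order_trans)
    have cov: "K \<subseteq> (\<Union>N. A N)" using P unfolding A_def eventually_sequentially by blast
    have KM: "K \<in> sets \<mu>" using K(1) sets by simp
    have "0 < \<kappa> / 3" using \<kappa> by simp
    note outer = increasing_sets_outer_measure[OF prob_space_axioms KM K(2) inc cov this]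
    show "\<forall>\<^sub>F n in sequentially. \<exists>S\<subseteq>K. finite S \<and> separated T n r S
       \<and> exp (real n * (entropy_wrt_partition T \<mu> \<xi> - \<delta>)) \<le> real (card S)
       \<and> (\<forall>x\<in>S. P x n \<and> \<bar>birkhoff_sum T n f x - real n * (\<integral>x. f x \<partial>\<mu>)\<bar> \<le> real n * \<delta>
             \<and> \<bar>birkhoff_sum T n g x - real n * (\<integral>x. g x \<partial>\<mu>)\<bar> \<le> real n * \<delta>)"
      using outer bad[OF f] bad[OF g] eventually_ge_at_top[of N]
    proof eventually_elim
      case (elim n)
      let ?A = "A n - ?bad f n - ?bad g n"
      have "1 - \<kappa> \<le> measure \<mu> Q" if Q: "Q \<in> sets \<mu>" "?A \<subseteq> Q" for Q
      proof -
        have "1 - \<kappa> / 3 \<le> measure \<mu> (Q \<union> (?bad f n \<union> ?bad g n))"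
        proof (rule elim(1)[THEN bspec, THEN mp])
          show "Q \<union> (?bad f n \<union> ?bad g n) \<in> sets \<mu>" by (intro sets.Un Q badm f g)
          show "A n \<subseteq> Q \<union> (?bad f n \<union> ?bad g n)" using Q(2) by blast
        qed
        also have "\<dots> \<le> measure \<mu> Q + measure \<mu> (?bad f n \<union> ?bad g n)"
          by (intro measure_Un_le Q sets.Un badm f g)
        also have "measure \<mu> (?bad f n \<union> ?bad g n) \<le> measure \<mu> (?bad f n) + measure \<mu> (?bad g n)"
          by (intro measure_Un_le badm f g)
        finally show ?thesis using elim by linarith
      qed
      then obtain S where S: "S \<subseteq> ?A" "finite S" "separated T n r S"
        "exp (real n * (entropy_wrt_partition T \<mu> \<xi> - \<delta>)) \<le> real (card S)"
        using many[OF elim(4), of ?A] by blast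
      have "P x n \<and> \<bar>birkhoff_sum T n f x - real n * (\<integral>x. f x \<partial>\<mu>)\<bar> \<le> real n * \<delta>
             \<and> \<bar>birkhoff_sum T n g x - real n * (\<integral>x. g x \<partial>\<mu>)\<bar> \<le> real n * \<delta>" if "x \<in> S" for x
      proof -
        have "x \<in> ?A" using S(1) that by blast
        then show ?thesis by (simp add: A_def not_le)
      qed
      moreover have "S \<subseteq> K" using S(1) by (auto simp: A_def)
      ultimately show ?case using S by blast
    qed
  qed
qed

text \<open>The upper limits of the relative gaps increase as the scale decreases and tend to \<open>0\<close>, so they vanish at
  every scale below \<open>\<eta>\<close>.\<close>

lemma nonuniform_gap_eventually_small:
  assumes spec: "nonuniform_specification T m K \<eta> p"
    and p_mono: "\<And>x n \<epsilon>\<^sub>1 \<epsilon>\<^sub>2. x \<in> K \<Longrightarrow> 1 \<le> n \<Longrightarrow> 0 < \<epsilon>\<^sub>1 \<Longrightarrow> \<epsilon>\<^sub>1 < \<epsilon>\<^sub>2 \<Longrightarrow> \<epsilon>\<^sub>2 < \<eta> \<Longrightarrow> p x n \<epsilon>\<^sub>2 \<le> p x n \<epsilon>\<^sub>1"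
    and x: "x \<in> K" and \<epsilon>: "0 < \<epsilon>" "\<epsilon> < \<eta>" and \<delta>: "0 < \<delta>"
  shows "\<forall>\<^sub>F n in sequentially. real (p x n \<epsilon>) \<le> \<delta> * real n"
proof -
  have "((\<lambda>\<epsilon>. limsup (\<lambda>n. ereal (real (p x n \<epsilon>) / real n))) \<longlongrightarrow> 0) (at_right 0)"
    using spec x by (simp add: nonuniform_specification_def)
  then have "\<forall>\<^sub>F e in at_right 0. limsup (\<lambda>n. ereal (real (p x n e) / real n)) < ereal \<delta>"
    by (rule order_tendstoD) (use \<delta> in simp)
  moreover have "\<forall>\<^sub>F e in at_right (0::real). e < \<epsilon> \<and> 0 < e"
    using \<epsilon>(1) by (auto intro: eventually_at_rightI[of 0 \<epsilon>])
  ultimately have "\<forall>\<^sub>F e in at_right 0. limsup (\<lambda>n. ereal (real (p x n e) / real n)) < ereal \<delta> \<and> e < \<epsilon> \<and> 0 < e"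
    by eventually_elim simp
  then obtain e where e: "limsup (\<lambda>n. ereal (real (p x n e) / real n)) < ereal \<delta>" "e < \<epsilon>" "0 < e"
    using eventually_happens[of _ "at_right (0::real)"] by auto
  from Limsup_lessD[OF e(1)] eventually_ge_at_top[of 1] show ?thesis
  proof eventually_elim
    case (elim n)
    have "real (p x n \<epsilon>) \<le> real (p x n e)" using p_mono[of x n e \<epsilon>] x elim e \<epsilon> by simp
    also have "\<dots> \<le> \<delta> * real n" using elim by (simp add: field_simps)
    finally show ?case .
  qed
qed

section \<open>Pressure of the irregular set\<close>

text \<open>The loss of \<open>3 * \<gamma>\<close> is made up of one \<open>\<gamma>\<close> from the choice of the measures, one from the errors in entropy
  and Birkhoff sums, and one from the length of the gaps.\<close>

lemma pressure_irregular_ge: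
  fixes T :: "'a::metric_space \<Rightarrow> 'a" and \<mu> :: "bool \<Rightarrow> 'a measure" and c \<gamma> :: real
  assumes X: "compact (UNIV :: 'a set)" and T: "continuous_on UNIV T"
    and spec: "nonuniform_specification T m K \<eta> p"
    and p_mono: "\<And>x n \<epsilon>\<^sub>1 \<epsilon>\<^sub>2. x \<in> K \<Longrightarrow> 1 \<le> n \<Longrightarrow> 0 < \<epsilon>\<^sub>1 \<Longrightarrow> \<epsilon>\<^sub>1 < \<epsilon>\<^sub>2 \<Longrightarrow> \<epsilon>\<^sub>2 < \<eta> \<Longrightarrow> p x n \<epsilon>\<^sub>2 \<le> p x n \<epsilon>\<^sub>1"
    and \<phi>: "continuous_on UNIV \<phi>" and \<psi>: "continuous_on UNIV \<psi>"
    and erg: "\<And>b. ergodic T (\<mu> b)" and K: "\<And>b. measure (\<mu> b) K = 1"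
    and large: "\<And>b. ereal (c - \<gamma>) < measure_entropy T (\<mu> b) + ereal (\<integral>x. \<psi> x \<partial>\<mu> b)"
    and differ: "(\<integral>x. \<phi> x \<partial>\<mu> True) \<noteq> (\<integral>x. \<phi> x \<partial>\<mu> False)"
    and \<gamma>: "0 < \<gamma>"
  shows "ereal (c - 3 * \<gamma>) \<le> pressure T (irregular_set \<phi> T) \<psi>"
proof -
  have inv: "invariant_prob T (\<mu> b)" for b using erg by (simp add: ergodic_def)
  have \<eta>: "0 < \<eta>" and KB: "K \<in> sets borel" and shadow: "shadowing_on T K \<eta> p"
    using spec by (simp_all add: nonuniform_specification_def)
  define \<alpha> where "\<alpha> b = (\<integral>x. \<phi> x \<partial>\<mu> b)" for b
  define \<beta> where "\<beta> b = (\<integral>x. \<psi> x \<partial>\<mu> b)" for b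
  have "\<exists>\<xi>. finite \<xi> \<and> \<xi> \<subseteq> sets (\<mu> b) \<and> partition_on UNIV \<xi> \<and> c - \<gamma> - \<beta> b < entropy_wrt_partition T (\<mu> b) \<xi>" for b
  proof -
    have "ereal (c - \<gamma> - \<beta> b) < measure_entropy T (\<mu> b)"
      using large[of b] by (cases "measure_entropy T (\<mu> b)") (auto simp: \<beta>_def)
    then show ?thesis
      unfolding measure_entropy_def less_SUP_iff by (auto simp: invariant_prob_space[OF inv])
  qed
  then obtain \<xi> where \<xi>: "\<And>b. finite (\<xi> b)" "\<And>b. \<xi> b \<subseteq> sets (\<mu> b)" "\<And>b. partition_on UNIV (\<xi> b)"
    and hgt: "\<And>b. c - \<gamma> - \<beta> b < entropy_wrt_partition T (\<mu> b) (\<xi> b)"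
    by metis
  define h where "h b = entropy_wrt_partition T (\<mu> b) (\<xi> b)" for b
  obtain B1 where B1: "0 \<le> B1" "\<And>x. \<bar>\<phi> x\<bar> \<le> B1" using compact_bounded_function[OF X \<phi>] by blast
  obtain B2 where B2: "0 \<le> B2" "\<And>x. \<bar>\<psi> x\<bar> \<le> B2" using compact_bounded_function[OF X \<psi>] by blast
  define B where "B = max B1 B2"
  have B: "0 \<le> B" "\<And>x. \<bar>\<phi> x\<bar> \<le> B" "\<And>x. \<bar>\<psi> x\<bar> \<le> B"
    using B1 B2 by (auto simp: B_def le_max_iff_disj)
  have \<alpha>B: "\<bar>\<alpha> b\<bar> \<le> B" for b
  proof -
    interpret prob_space "\<mu> b" using inv by (simp add: invariant_prob_def)
    have "\<phi> \<in> borel_measurable (\<mu> b)"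
      using borel_measurable_continuous_onI[OF \<phi>] inv[of b] measurable_cong_sets
      unfolding invariant_prob_def by blast
    then have "integrable (\<mu> b) \<phi>" by (intro integrable_const_bound[where B=B]) (auto simp: B)
    then have "\<alpha> b \<le> B" "- B \<le> \<alpha> b"
      unfolding \<alpha>_def using B(2) by (auto intro!: integral_le_const integral_ge_const simp: abs_le_iff minus_le_iff)
    then show ?thesis by (simp add: abs_le_iff)
  qed
  define D where "D = \<bar>\<alpha> True - \<alpha> False\<bar>"
  have D: "0 < D" using differ by (simp add: D_def \<alpha>_def)
  \<comment> \<open>\<open>\<delta> * M\<close> dominates all errors per unit of time, in the Birkhoff sums of both functions and in
    replacing \<open>n\<close> by \<open>L\<close>.\<close>
  define M where "M = 4 + 2 * B + \<bar>c - 3 * \<gamma>\<bar>"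
  have M: "0 < M" using B(1) by (simp add: M_def)
  define \<delta> where "\<delta> = min (\<gamma> / M) (D / (16 * M))"
  have \<delta>: "0 < \<delta>" using \<gamma> D M by (simp add: \<delta>_def)
  have \<delta>M: "\<delta> * M \<le> \<gamma>" "\<delta> * M \<le> D / 16"
    using M by (auto simp: \<delta>_def min_def field_simps)
  have \<delta>1: "\<delta> * (3 + B) \<le> \<gamma>" "\<delta> * \<bar>c - 3 * \<gamma>\<bar> \<le> \<gamma>" "\<delta> * (2 + 2 * B) \<le> D / 16"
  proof -
    have le: "\<delta> * a \<le> \<delta> * M" if "a \<le> M" for a
      by (rule mult_left_mono[OF that]) (use \<delta> in simp)
    have "3 + B \<le> M" "\<bar>c - 3 * \<gamma>\<bar> \<le> M" "2 + 2 * B \<le> M"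
      using B(1) by (auto simp: M_def)
    from this[THEN le] show "\<delta> * (3 + B) \<le> \<gamma>" "\<delta> * \<bar>c - 3 * \<gamma>\<bar> \<le> \<gamma>"
      "\<delta> * (2 + 2 * B) \<le> D / 16"
      using \<delta>M by linarith+
  qed
  let ?good = "\<lambda>b r P n. \<exists>S\<subseteq>K. finite S \<and> separated T n r S
       \<and> exp (real n * (h b - \<delta>)) \<le> real (card S)
       \<and> (\<forall>x\<in>S. P x n \<and> \<bar>birkhoff_sum T n \<phi> x - real n * \<alpha> b\<bar> \<le> real n * \<delta>
             \<and> \<bar>birkhoff_sum T n \<psi> x - real n * \<beta> b\<bar> \<le> real n * \<delta>)"
  have "\<exists>r. 0 < r \<and> (\<forall>P. (\<forall>x\<in>K. \<forall>\<^sub>F n in sequentially. P x n) \<longrightarrow>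
     (\<forall>\<^sub>F n in sequentially. ?good b r P n))" for b
    unfolding h_def \<alpha>_def \<beta>_def
    by (rule typical_separated_points[OF X T erg KB K \<xi> \<phi> \<psi> \<delta>, of b]) (intro exI conjI allI impI, assumption, simp)
  then have "\<forall>b. \<exists>r. 0 < r \<and> (\<forall>P. (\<forall>x\<in>K. \<forall>\<^sub>F n in sequentially. P x n) \<longrightarrow>
     (\<forall>\<^sub>F n in sequentially. ?good b r P n))" by (rule allI)
  from choice[OF this] obtain r where good: "\<forall>b. 0 < r b \<and>
     (\<forall>P. (\<forall>x\<in>K. \<forall>\<^sub>F n in sequentially. P x n) \<longrightarrow> (\<forall>\<^sub>F n in sequentially. ?good b (r b) P n))"
    by (elim exE)
  have r: "0 < r b" for b using good by (elim allE conjE)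
  obtain d1 where d1: "0 < d1" "\<And>x y. dist x y < d1 \<Longrightarrow> \<bar>\<phi> x - \<phi> y\<bar> \<le> \<delta>"
    using compact_uniform_modulus[OF X \<phi> \<delta>] by blast
  obtain d2 where d2: "0 < d2" "\<And>x y. dist x y < d2 \<Longrightarrow> \<bar>\<psi> x - \<psi> y\<bar> \<le> \<delta>"
    using compact_uniform_modulus[OF X \<psi> \<delta>] by blast
  define \<epsilon> where "\<epsilon> = Min {d1 / 2, d2 / 2, \<eta> / 2, r True / 4, r False / 4}"
  have \<epsilon>: "0 < \<epsilon>" using d1 d2 \<eta> r by (simp add: \<epsilon>_def)
  have \<epsilon>le: "\<epsilon> \<le> d1 / 2" "\<epsilon> \<le> d2 / 2" "\<epsilon> \<le> \<eta> / 2" "\<epsilon> \<le> r True / 4" "\<epsilon> \<le> r False / 4"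
    unfolding \<epsilon>_def by (rule Min_le; simp)+
  have \<epsilon>r: "4 * \<epsilon> \<le> r b" for b using \<epsilon>le(4,5) by (cases b) auto
  have \<epsilon>\<eta>: "\<epsilon> < \<eta>" using \<epsilon>le(3) \<eta> by linarith
  let ?P = "\<lambda>x n. real (p x n \<epsilon>) \<le> \<delta> * real n"
  have gaps: "\<forall>x\<in>K. \<forall>\<^sub>F n in sequentially. ?P x n"
  proof
    fix x assume "x \<in> K"
    from spec _ this \<epsilon> \<epsilon>\<eta> \<delta> show "\<forall>\<^sub>F n in sequentially. ?P x n"
      by (rule nonuniform_gap_eventually_small) (rule p_mono)
  qed
  have ev: "\<forall>\<^sub>F n in sequentially. ?good b (r b) ?P n" for b
    by (rule good[THEN HOL.spec[where x=b], THEN conjunct2, THEN HOL.spec[where x="?P"], THEN mp, OF gaps])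
  have "\<forall>\<^sub>F n in sequentially. 0 < n \<and> (\<forall>b. ?good b (r b) ?P n)"
    using ev[of True] ev[of False] eventually_gt_at_top[of 0]
    by eventually_elim (simp add: all_bool_eq)
  then obtain n where n: "0 < n" and "\<forall>b. ?good b (r b) ?P n"
    unfolding eventually_sequentially by blast
  from choice[OF this(2)] obtain S where S: "\<forall>b. S b \<subseteq> K \<and> finite (S b) \<and> separated T n (r b) (S b)
       \<and> exp (real n * (h b - \<delta>)) \<le> real (card (S b))
       \<and> (\<forall>x\<in>S b. ?P x n \<and> \<bar>birkhoff_sum T n \<phi> x - real n * \<alpha> b\<bar> \<le> real n * \<delta>
             \<and> \<bar>birkhoff_sum T n \<psi> x - real n * \<beta> b\<bar> \<le> real n * \<delta>)" by blast
  have SK: "S b \<subseteq> K" and Sfin: "finite (S b)" and Ssep: "separated T n (r b) (S b)"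
    and Scard: "exp (real n * (h b - \<delta>)) \<le> real (card (S b))" for b
    using S by blast+
  have Sp: "real (p x n \<epsilon>) \<le> \<delta> * real n" and S\<phi>: "\<bar>birkhoff_sum T n \<phi> x - real n * \<alpha> b\<bar> \<le> real n * \<delta>"
    and S\<psi>: "\<bar>birkhoff_sum T n \<psi> x - real n * \<beta> b\<bar> \<le> real n * \<delta>" if "x \<in> S b" for b x
    using S that by blast+
  have Spos: "0 < real (card (S b))" for b using Scard[of b] by (rule less_le_trans[OF exp_gt_zero])
  \<comment> \<open>Specification allows any gap above the required one, so all gaps get the same length.\<close>
  define q where "q = nat \<lfloor>\<delta> * real n\<rfloor>"
  have q: "real q \<le> \<delta> * real n" using \<delta> by (simp add: q_def)
  have pq: "p x n \<epsilon> \<le> q" if "x \<in> S b" for x b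
    using Sp[OF that] by (simp add: q_def le_nat_floor)
  define L where "L = n + q"
  have L: "real L = real n + real q" by (simp add: L_def)
  have tail: "\<bar>birkhoff_sum T q f y\<bar> \<le> real n * (\<delta> * B)" if "\<And>x. \<bar>f x\<bar> \<le> B" for f y
  proof -
    have "\<bar>birkhoff_sum T q f y\<bar> \<le> real q * B" by (rule birkhoff_sum_abs_le[OF that])
    also have "\<dots> \<le> (\<delta> * real n) * B" by (rule mult_right_mono[OF q B(1)])
    finally show ?thesis by (simp add: mult_ac)
  qed
  have split: "birkhoff_sum T L f y = birkhoff_sum T n f y + birkhoff_sum T q f ((T ^^ n) y)" for f y
    unfolding L_def by (rule birkhoff_sum_add)
  have close: "\<bar>birkhoff_sum T n \<phi> x - birkhoff_sum T n \<phi> y\<bar> \<le> real n * \<delta>"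
    "\<bar>birkhoff_sum T n \<psi> x - birkhoff_sum T n \<psi> y\<bar> \<le> real n * \<delta>" if "shadows T n \<epsilon> x y" for x y
  proof -
    have "dist ((T ^^ i) x) ((T ^^ i) y) < d1" "dist ((T ^^ i) x) ((T ^^ i) y) < d2" if "i < n" for i
      using \<open>shadows T n \<epsilon> x y\<close> that \<epsilon>le(1,2) d1(1) d2(1) unfolding shadows_def by fastforce+
    then show "\<bar>birkhoff_sum T n \<phi> x - birkhoff_sum T n \<phi> y\<bar> \<le> real n * \<delta>"
      "\<bar>birkhoff_sum T n \<psi> x - birkhoff_sum T n \<psi> y\<bar> \<le> real n * \<delta>"
      by (auto intro!: birkhoff_sum_diff_le d1 d2)
  qed
  have block_\<phi>: "\<bar>birkhoff_sum T L \<phi> y - real L * \<alpha> b\<bar> \<le> real L * (\<delta> * (2 + 2 * B))"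
    if x: "x \<in> S b" and y: "shadows T n \<epsilon> x y" for b x y
  proof -
    have "\<bar>real q * \<alpha> b\<bar> \<le> (\<delta> * real n) * B"
      unfolding abs_mult by (rule mult_mono) (use q \<alpha>B \<delta> in auto)
    then have "\<bar>real q * \<alpha> b\<bar> \<le> real n * (\<delta> * B)" by (simp add: mult_ac)
    moreover have "birkhoff_sum T L \<phi> y - real L * \<alpha> b
      = (birkhoff_sum T n \<phi> x - real n * \<alpha> b) - (birkhoff_sum T n \<phi> x - birkhoff_sum T n \<phi> y)
        + birkhoff_sum T q \<phi> ((T ^^ n) y) - real q * \<alpha> b"
      by (simp add: split L algebra_simps)
    ultimately have "\<bar>birkhoff_sum T L \<phi> y - real L * \<alpha> b\<bar>
        \<le> real n * \<delta> + real n * \<delta> + real n * (\<delta> * B) + real n * (\<delta> * B)"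
      using S\<phi>[OF x] close(1)[OF y] tail[of \<phi>, OF B(2), where y="(T ^^ n) y"] by linarith
    also have "\<dots> = real n * (\<delta> * (2 + 2 * B))" by (simp add: algebra_simps)
    also have "\<dots> \<le> real L * (\<delta> * (2 + 2 * B))"
      by (rule mult_right_mono) (use \<delta> B(1) in \<open>auto simp: L\<close>)
    finally show ?thesis .
  qed
  have block_\<psi>: "real L * (c - 3 * \<gamma>) \<le> ln (real (card (S b))) + birkhoff_sum T L \<psi> y"
    if x: "x \<in> S b" and y: "shadows T n \<epsilon> x y" for b x y
  proof -
    have "real q * (c - 3 * \<gamma>) \<le> real q * \<bar>c - 3 * \<gamma>\<bar>" by (intro mult_left_mono) auto
    also have "\<dots> \<le> (\<delta> * real n) * \<bar>c - 3 * \<gamma>\<bar>" by (rule mult_right_mono[OF q]) simp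
    also have "\<dots> = real n * (\<delta> * \<bar>c - 3 * \<gamma>\<bar>)" by (simp add: mult_ac)
    also have "\<dots> \<le> real n * \<gamma>" by (rule mult_left_mono[OF \<delta>1(2)]) simp
    finally have 1: "real L * (c - 3 * \<gamma>) \<le> real n * (c - 2 * \<gamma>)" by (simp add: L algebra_simps)
    have "real n * (c - \<gamma>) \<le> real n * (h b + \<beta> b)"
      using hgt[of b] by (intro mult_left_mono) (auto simp: h_def)
    moreover have "real n * (\<delta> * (3 + B)) \<le> real n * \<gamma>" by (rule mult_left_mono[OF \<delta>1(1)]) simp
    ultimately have 2: "real n * (c - 2 * \<gamma>) \<le> real n * (h b - \<delta>) + real n * \<beta> b - 2 * (real n * \<delta>) - real n * (\<delta> * B)"
      by (simp add: algebra_simps)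
    have 3: "real n * (h b - \<delta>) \<le> ln (real (card (S b)))"
      using Scard[of b] Spos[of b] by (simp add: ln_ge_iff)
    have "birkhoff_sum T L \<psi> y \<ge> real n * \<beta> b - 2 * (real n * \<delta>) - real n * (\<delta> * B)"
      using S\<psi>[OF x] close(2)[OF y] tail[of \<psi>, OF B(3), where y="(T ^^ n) y"] unfolding split by linarith
    with 1 2 3 show ?thesis by linarith
  qed
  obtain \<rho> :: "nat \<Rightarrow> bool" where \<rho>:
    "\<And>N. \<exists>k\<ge>N. 0 < k \<and> 3 * real k \<le> 4 * real (card {i. i < k \<and> \<rho> i})"
    "\<And>N. \<exists>k\<ge>N. 0 < k \<and> 4 * real (card {i. i < k \<and> \<rho> i}) \<le> real k"
    using ex_oscillating_sequence by blast
  let ?F = "\<Inter>i. shadow_stage T n L \<epsilon> (\<lambda>i. S (\<rho> i)) i"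
  have sub: "?F \<subseteq> irregular_set \<phi> T"
  proof
    fix z assume z: "z \<in> ?F"
    have "\<bar>birkhoff_sum T L \<phi> ((T ^^ (i * L)) z) - real L * \<alpha> (\<rho> i)\<bar> \<le> real L * (\<delta> * (2 + 2 * B))" for i
    proof -
      obtain x where "x \<in> S (\<rho> i)" "shadows T n \<epsilon> x ((T ^^ (i * L)) z)"
        using z by (auto simp: shadow_stage_def)
      then show ?thesis by (rule block_\<phi>)
    qed
    moreover have "8 * (\<delta> * (2 + 2 * B)) < \<bar>\<alpha> True - \<alpha> False\<bar>" using \<delta>1(3) D by (simp add: D_def)
    moreover have "0 < L" using n by (simp add: L_def)
    ultimately show "z \<in> irregular_set \<phi> T" by (intro irregular_setI[OF _ _ \<rho>])
  qed
  have "0 < pressure_outer T (irregular_set \<phi> T) (c - 3 * \<gamma>) \<psi> \<epsilon>'" if \<epsilon>': "0 < \<epsilon>'" "\<epsilon>' < \<epsilon>" for \<epsilon>'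
  proof -
    have "0 < pressure_outer T ?F (c - 3 * \<gamma>) \<psi> \<epsilon>'"
    proof (rule pressure_outer_shadow_set_pos[OF X T n])
      show "n \<le> L" by (simp add: L_def)
      show "\<bar>\<psi> x\<bar> \<le> B" for x by (rule B(3))
      show "finite (S (\<rho> i))" for i by (rule Sfin)
      show "S (\<rho> i) \<noteq> {}" for i using Spos[of "\<rho> i"] by auto
      show "separated T n (4 * \<epsilon>) (S (\<rho> i))" for i
        using Ssep[of "\<rho> i"] \<epsilon>r[of "\<rho> i"] unfolding separated_def by (meson order_trans)
      show "\<exists>z. \<forall>i<k. shadows T n \<epsilon> (w i) ((T ^^ (i * L)) z)" if w: "\<And>i. i < k \<Longrightarrow> w i \<in> S (\<rho> i)" for w k
      proof -
        have "\<forall>i<k. w i \<in> K \<and> 1 \<le> n \<and> p (w i) n \<epsilon> \<le> q"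
        proof (intro allI impI conjI)
          fix i assume "i < k"
          then show "w i \<in> K" "p (w i) n \<epsilon> \<le> q" using SK pq[OF w] w by blast+
          show "1 \<le> n" using n by simp
        qed
        then obtain z where z: "\<forall>i<k. (T ^^ (\<Sum>j<i. n + q)) z \<in> bowen_ball T n (w i) \<epsilon>"
          using shadow[unfolded shadowing_on_def, THEN HOL.spec[where x="\<epsilon>"], THEN HOL.spec[where x=k],
              THEN HOL.spec[where x=w], THEN HOL.spec[where x="\<lambda>_. n"], THEN HOL.spec[where x="\<lambda>_. q"],
              THEN mp, OF \<epsilon>, THEN mp, OF \<epsilon>\<eta>]
          by (elim impE exE)
        have "shadows T n \<epsilon> (w i) ((T ^^ (i * L)) z)" if "i < k" for i
          using z that unfolding mem_bowen_ball[OF n] shadows_def by (auto simp: L_def intro: less_imp_le)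
        then show ?thesis by blast
      qed
      show "real L * (c - 3 * \<gamma>) \<le> ln (real (card (S (\<rho> i)))) + birkhoff_sum T L \<psi> y"
        if "x \<in> S (\<rho> i)" "shadows T n \<epsilon> x y" for i x y by (rule block_\<psi>[OF that])
      show "0 < \<epsilon>'" "\<epsilon>' \<le> \<epsilon>" using \<epsilon>' by auto
    qed
    also have "\<dots> \<le> pressure_outer T (irregular_set \<phi> T) (c - 3 * \<gamma>) \<psi> \<epsilon>'"
      by (rule pressure_outer_mono_set[OF sub])
    finally show ?thesis .
  qed
  then show ?thesis by (rule pressure_ge[OF X T \<psi> \<epsilon>])
qed

theorem theorem1p2:
  fixes T :: "'a::metric_space \<Rightarrow> 'a" and m :: "'a measure" and K :: "'a set"
    and \<eta> :: real and p :: "'a \<Rightarrow> nat \<Rightarrow> real \<Rightarrow> nat"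
    and \<phi> \<psi> :: "'a \<Rightarrow> real" and CC :: ereal
  assumes compact_X: "compact (UNIV :: 'a set)"
    and T: "continuous_on UNIV T"
    and m: "prob_space m" "sets m = sets borel"
    and spec: "nonuniform_specification T m K \<eta> p"
    and K_inv: "T ` K \<subseteq> K"
    and p_mono: "\<And>x n \<epsilon>\<^sub>1 \<epsilon>\<^sub>2. x \<in> K \<Longrightarrow> 1 \<le> n \<Longrightarrow> 0 < \<epsilon>\<^sub>1 \<Longrightarrow> \<epsilon>\<^sub>1 < \<epsilon>\<^sub>2 \<Longrightarrow> \<epsilon>\<^sub>2 < \<eta> \<Longrightarrow> p x n \<epsilon>\<^sub>2 \<le> p x n \<epsilon>\<^sub>1"
    and \<phi>: "continuous_on UNIV \<phi>"
    and \<phi>_int: "(INF \<mu>\<in>invariant_probs_on K T. ereal (\<integral>x. \<phi> x \<partial>\<mu>))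
               < (SUP \<mu>\<in>invariant_probs_on K T. ereal (\<integral>x. \<phi> x \<partial>\<mu>))"
    and \<psi>: "continuous_on UNIV \<psi>"
    and CC: "CC = (SUP \<mu>\<in>invariant_probs_on K T. measure_entropy T \<mu> + ereal (\<integral>x. \<psi> x \<partial>\<mu>))"
    and P_finite: "\<bar>pressure T UNIV \<psi>\<bar> \<noteq> \<infinity>"
    and erg: "\<And>\<gamma>::real. 0 < \<gamma> \<Longrightarrow>
       \<exists>\<mu>\<^sub>1\<in>invariant_probs_on K T. \<exists>\<mu>\<^sub>2\<in>invariant_probs_on K T.
         ergodic T \<mu>\<^sub>1 \<and> ergodic T \<mu>\<^sub>2 \<and>
         measure_entropy T \<mu>\<^sub>1 + ereal (\<integral>x. \<psi> x \<partial>\<mu>\<^sub>1) > CC - ereal \<gamma> \<and>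
         measure_entropy T \<mu>\<^sub>2 + ereal (\<integral>x. \<psi> x \<partial>\<mu>\<^sub>2) > CC - ereal \<gamma> \<and>
         (\<integral>x. \<phi> x \<partial>\<mu>\<^sub>1) \<noteq> (\<integral>x. \<phi> x \<partial>\<mu>\<^sub>2)"
  shows "pressure T (irregular_set \<phi> T) \<psi> \<ge> CC \<and>
         ((\<exists>\<mu>\<in>invariant_probs_on K T. equilibrium_state T \<psi> \<mu>) \<longrightarrow>
            pressure T (irregular_set \<phi> T) \<psi> = pressure T UNIV \<psi>)"
proof -
  obtain \<mu>1 where \<mu>1: "CC - ereal 1 < measure_entropy T \<mu>1 + ereal (\<integral>x. \<psi> x \<partial>\<mu>1)"
    and \<mu>1K: "\<mu>1 \<in> invariant_probs_on K T"
    using erg[of 1] by auto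
  \<comment> \<open>Were \<open>CC\<close> infinite, no value could exceed \<open>CC - 1 = \<infinity>\<close>.\<close>
  have "CC \<noteq> \<infinity>" using \<mu>1 by auto
  moreover have "CC \<noteq> -\<infinity>"
  proof
    assume "CC = -\<infinity>"
    moreover have "measure_entropy T \<mu>1 + ereal (\<integral>x. \<psi> x \<partial>\<mu>1) \<le> CC"
      unfolding CC by (rule SUP_upper[OF \<mu>1K])
    ultimately show False using \<mu>1 by auto
  qed
  ultimately obtain c where c: "CC = ereal c" by (cases CC) auto
  have approx: "ereal (c - 3 * \<gamma>) \<le> pressure T (irregular_set \<phi> T) \<psi>" if \<gamma>: "0 < \<gamma>" for \<gamma>
  proof -
    obtain \<mu>\<^sub>1 \<mu>\<^sub>2 where \<mu>K: "\<mu>\<^sub>1 \<in> invariant_probs_on K T" "\<mu>\<^sub>2 \<in> invariant_probs_on K T"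
      and \<mu>: "ergodic T \<mu>\<^sub>1" "ergodic T \<mu>\<^sub>2"
        "measure_entropy T \<mu>\<^sub>1 + ereal (\<integral>x. \<psi> x \<partial>\<mu>\<^sub>1) > CC - ereal \<gamma>"
        "measure_entropy T \<mu>\<^sub>2 + ereal (\<integral>x. \<psi> x \<partial>\<mu>\<^sub>2) > CC - ereal \<gamma>"
        "(\<integral>x. \<phi> x \<partial>\<mu>\<^sub>1) \<noteq> (\<integral>x. \<phi> x \<partial>\<mu>\<^sub>2)"
      using erg[OF \<gamma>] by blast
    let ?\<mu> = "\<lambda>b. if b then \<mu>\<^sub>1 else \<mu>\<^sub>2"
    show ?thesis
      by (rule pressure_irregular_ge[OF compact_X T spec p_mono \<phi> \<psi>, where \<mu>="?\<mu>"])
        (use \<mu> \<mu>K \<gamma> c in \<open>auto simp: invariant_probs_on_def\<close>)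
  qed
  have ge: "CC \<le> pressure T (irregular_set \<phi> T) \<psi>"
  proof (rule ereal_le_epsilon2)
    fix e :: real assume "0 < e"
    then have "ereal (c - 3 * (e / 3)) \<le> pressure T (irregular_set \<phi> T) \<psi>" by (intro approx) simp
    then show "CC \<le> pressure T (irregular_set \<phi> T) \<psi> + ereal e"
      unfolding c by (cases "pressure T (irregular_set \<phi> T) \<psi>") auto
  qed
  moreover have "pressure T (irregular_set \<phi> T) \<psi> = pressure T UNIV \<psi>"
    if \<mu>: "\<mu> \<in> invariant_probs_on K T" "equilibrium_state T \<psi> \<mu>" for \<mu>
  proof (rule antisym)
    show "pressure T (irregular_set \<phi> T) \<psi> \<le> pressure T UNIV \<psi>"
      by (rule pressure_mono[OF compact_X T \<psi> subset_UNIV])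
    have "pressure T UNIV \<psi> = measure_entropy T \<mu> + ereal (\<integral>x. \<psi> x \<partial>\<mu>)"
      using \<mu>(2) by (simp add: equilibrium_state_def)
    also have "\<dots> \<le> CC" unfolding CC by (rule SUP_upper[OF \<mu>(1)])
    also note ge
    finally show "pressure T UNIV \<psi> \<le> pressure T (irregular_set \<phi> T) \<psi>" .
  qed
  ultimately show ?thesis by blast
qed

end
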